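(* Consider the generalized linear model with natural link and the Bridge estimator $\hat{\boldsymbol\beta}_\lambda$ described in the context, with known $\gamma\in(0,1)$ and tuning parameter $\lambda_n=n^{(\gamma_0-2)/2}\lambda$, where $\lambda>0$ is fixed and $\gamma_0\in(\gamma,1]$. Assume conditions (C1) and (C2) on the regressors, as listed in the context. Let $z^{\rm limit}$ be the limit in distribution, as $n\to\infty$, of $$\sum_{i=1}^n\{g_i(\hat{\boldsymbol\beta}_\lambda)-g_i(\boldsymbol\beta^* )\}-\sum_{i=1}^n\{\tilde g_i(\hat{\boldsymbol\beta}_\lambda)-\tilde g_i(\boldsymbol\beta^* )\},$$ where $\tilde g_i$ is the log-likelihood based on an independent copy of the data. Then the size $|\hat{\mathcal J}^{(2)}|$ of the active set $\hat{\mathcal J}^{(2)}=\{j:\hat\beta_{\lambda,j}\neq0\}$ is a consistent estimator of the asymptotic bias $\mathrm E[z^{\rm limit}]$, i.e. $|\hat{\mathcal J}^{(2)}|$ converges in probability to $\mathrm E[z^{\rm limit}]$ as $n\to\infty$.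
   Context: Model. Let $f(\boldsymbol y;\boldsymbol\theta)=\exp\{\boldsymbol y^{\rm T}\boldsymbol\theta-a(\boldsymbol\theta)+b(\boldsymbol y)\}$ be a natural exponential family of densities on $\mathbb R^r$ with respect to a $\sigma$-finite measure, where $\boldsymbol\theta\in\Theta\subset\mathbb R^r$ and $\Theta$ is the natural parameter space (those $\boldsymbol\theta$ for which the normalizing integral of $\exp\{\boldsymbol y^{\rm T}\boldsymbol\theta+b(\boldsymbol y)\}$ is positive and finite); $\Theta^\circ$ is its interior. It is assumed that $\mathrm V[\boldsymbol y]=a''(\boldsymbol\theta)$ is positive definite (primes denote gradient and Hessian). The data are $(\boldsymbol y_i,\boldsymbol X_i)$, $i=1,\dots,n$, with $\boldsymbol y_i$ independent $r$-dimensional random vectors and $\boldsymbol X_i\in\mathcal X\subset\mathbb R^{r\times p}$ known constant matrices; $\boldsymbol y_i$ has density $f(\cdot;\boldsymbol X_i\boldsymbol\beta^* )$, where $\boldsymbol\beta^*\in\mathcal B$ is the true parameter and $\mathcal B\subset\mathbb R^p$ is an open convex set; $p$ and $r$ are fixed and $n\to\infty$. The log-likelihood of $\boldsymbol y_i$ is $g_i(\boldsymbol\beta)=\boldsymbol y_i^{\rm T}\boldsymbol X_i\boldsymbol\beta-a(\boldsymbol X_i\boldsymbol\beta)+b(\boldsymbol y_i)$. Copy of the data. $(\tilde{\boldsymbol y}_1,\dots,\tilde{\boldsymbol y}_n)$ has the same distribution as $(\boldsymbol y_1,\dots,\boldsymbol y_n)$ and is independent of it; $\tilde g_i(\boldsymbol\beta)=\log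 f(\tilde{\boldsymbol y}_i;\boldsymbol X_i\boldsymbol\beta)$. Conditions on regressors. (C1) $\mathcal X$ is compact and $\boldsymbol X\boldsymbol\beta\in\Theta^\circ$ for all $\boldsymbol X\in\mathcal X$, $\boldsymbol\beta\in\mathcal B$. (C2) There exists an invariant distribution $\mu$ on $\mathcal X$; in particular, $n^{-1}\sum_{i=1}^n\boldsymbol X_i^{\rm T}a''(\boldsymbol X_i\boldsymbol\beta)\boldsymbol X_i$ converges to a positive-definite matrix $\boldsymbol J(\boldsymbol\beta)=\int_{\mathcal X}\boldsymbol X^{\rm T}a''(\boldsymbol X\boldsymbol\beta)\boldsymbol X\,\mu(\mathrm d\boldsymbol X)$. Bridge estimator. $\hat{\boldsymbol\beta}_\lambda=\mathrm{argmin}_{\boldsymbol\beta\in\mathcal B}\{-\sum_{i=1}^n g_i(\boldsymbol\beta)+n\lambda_n\sum_{j=1}^p|\beta_j|^\gamma\}$. *)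

theory Defs
  imports "HOL-Probability.Probability"
begin

definition positive_definite :: "real^'n^'n \<Rightarrow> bool" where
  "positive_definite A \<longleftrightarrow> transpose A = A \<and> (\<forall>v. v \<noteq> 0 \<longrightarrow> 0 < v \<bullet> (A *v v))"

definition gradient :: "(real^'n \<Rightarrow> real) \<Rightarrow> real^'n \<Rightarrow> real^'n" where
  "gradient f x = (\<chi> i. frechet_derivative f (at x) (axis i 1))"

definition hessian :: "(real^'n \<Rightarrow> real) \<Rightarrow> real^'n \<Rightarrow> real^'n^'n" where
  "hessian f x = jacobian (gradient f) (at x)"

text \<open>The natural exponential family with dominating measure \<open>\<nu>\<close> and carrier \<open>b\<close>.\<close>

definition natural_parameter_space ::
    "(real^'r) measure \<Rightarrow> (real^'r \<Rightarrow> real) \<Rightarrow> (real^'r) set" where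
  "natural_parameter_space \<nu> b =
    {\<theta>. 0 < (\<integral>\<^sup>+ y. ennreal (exp (y \<bullet> \<theta> + b y)) \<partial>\<nu>) \<and>
        (\<integral>\<^sup>+ y. ennreal (exp (y \<bullet> \<theta> + b y)) \<partial>\<nu>) < \<infinity>}"

text \<open>The normalising function \<open>a\<close>; it is meaningful only on the natural parameter space.\<close>

definition cumulant :: "(real^'r) measure \<Rightarrow> (real^'r \<Rightarrow> real) \<Rightarrow> real^'r \<Rightarrow> real" where
  "cumulant \<nu> b \<theta> = ln (\<integral> y. exp (y \<bullet> \<theta> + b y) \<partial>\<nu>)"

definition expfam_density ::
    "(real^'r) measure \<Rightarrow> (real^'r \<Rightarrow> real) \<Rightarrow> real^'r \<Rightarrow> real^'r \<Rightarrow> real" where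
  "expfam_density \<nu> b \<theta> y = exp (y \<bullet> \<theta> - cumulant \<nu> b \<theta> + b y)"

definition log_lik ::
    "(real^'r) measure \<Rightarrow> (real^'r \<Rightarrow> real) \<Rightarrow> real^'p^'r \<Rightarrow> real^'r \<Rightarrow> real^'p \<Rightarrow> real" where
  "log_lik \<nu> b X y \<beta> = y \<bullet> (X *v \<beta>) - cumulant \<nu> b (X *v \<beta>) + b y"

definition condition_C1 ::
    "(real^'r) measure \<Rightarrow> (real^'r \<Rightarrow> real) \<Rightarrow> (real^'p^'r) set \<Rightarrow> (real^'p) set \<Rightarrow> bool" where
  "condition_C1 \<nu> b \<X> B \<longleftrightarrow>
    compact \<X> \<and> (\<forall>X\<in>\<X>. \<forall>\<beta>\<in>B. X *v \<beta> \<in> interior (natural_parameter_space \<nu> b))"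

definition information ::
    "(real^'r) measure \<Rightarrow> (real^'r \<Rightarrow> real) \<Rightarrow> real^'p \<Rightarrow> real^'p^'r \<Rightarrow> real^'p^'p" where
  "information \<nu> b \<beta> X = transpose X ** hessian (cumulant \<nu> b) (X *v \<beta>) ** X"

text \<open>For a deterministic design the invariance of \<open>\<mu>\<close> means that averages along the design
  converge to \<open>\<mu>\<close>-averages. Only the averages of the information matrices are required to do so,
  which is implied by convergence for all continuous functions on the compact set \<open>\<X>\<close>.\<close>

definition condition_C2 ::
    "(real^'r) measure \<Rightarrow> (real^'r \<Rightarrow> real) \<Rightarrow> (real^'p^'r) set \<Rightarrow> (real^'p) set
      \<Rightarrow> (nat \<Rightarrow> real^'p^'r) \<Rightarrow> bool" where
  "condition_C2 \<nu> b \<X> B X \<longleftrightarrow>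
    (\<exists>\<mu>. prob_space \<mu> \<and> sets \<mu> = sets (restrict_space borel \<X>) \<and>
      (\<forall>\<beta>\<in>B.
        (\<lambda>n. (1 / real n) *\<^sub>R (\<Sum>i<n. information \<nu> b \<beta> (X i)))
          \<longlonglongrightarrow> (\<integral>x. information \<nu> b \<beta> x \<partial>\<mu>) \<and>
        positive_definite (\<integral>x. information \<nu> b \<beta> x \<partial>\<mu>)))"

text \<open>The data are indexed by \<open>i < n\<close>. Note that \<open>0 powr \<gamma> = 0\<close>, as the penalty requires.\<close>

definition bridge_objective ::
    "(real^'r) measure \<Rightarrow> (real^'r \<Rightarrow> real) \<Rightarrow> (nat \<Rightarrow> real^'p^'r) \<Rightarrow> (nat \<Rightarrow> real^'r)
      \<Rightarrow> real \<Rightarrow> real \<Rightarrow> nat \<Rightarrow> real^'p \<Rightarrow> real" where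
  "bridge_objective \<nu> b X y \<gamma> lam n \<beta> =
    - (\<Sum>i<n. log_lik \<nu> b (X i) (y i) \<beta>) + real n * lam * (\<Sum>j\<in>UNIV. \<bar>\<beta> $ j\<bar> powr \<gamma>)"

definition active_set :: "real^'p \<Rightarrow> 'p set" where
  "active_set \<beta> = {j. \<beta> $ j \<noteq> 0}"

end

theory Submission
  imports Defs "HOL-Real_Asymp.Real_Asymp"
begin

text \<open>The cumulant function and the carrier cancel in the bias, which is exactly
  \<open>\<surd>n (\<beta>hat - \<beta>\<^sub>0) \<bullet> (S - S')\<close> for the normalized scores \<open>S\<close>, \<open>S'\<close> of the data and of the copy.
  Locally the negative log-likelihood is a quadratic with linear part \<open>- S\<close> and Hessian \<open>J\<close>, up to a
  deterministic error that is uniformly small on balls of radius \<open>const / \<surd>n\<close>. The penalty forces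
  the inactive coordinates to be exactly zero and acts on the active ones as a linear term, so
  \<open>\<surd>n (\<beta>hat - \<beta>\<^sub>0)\<close> is close in probability to the minimizer of a quadratic over the active subspace,
  namely \<open>\<Sum>\<^sub>j (w\<^sub>j \<bullet> S - r\<^sub>j) w\<^sub>j\<close> for a \<open>J\<close>-orthonormal basis \<open>w\<^sub>j\<close> of that subspace. The coordinates
  \<open>w\<^sub>j \<bullet> S\<close>, \<open>w\<^sub>j \<bullet> S'\<close> converge jointly to independent standard normal variables \<open>G\<^sub>j\<close>, \<open>G'\<^sub>j\<close>, so the
  limit of the bias is \<open>\<Sum>\<^sub>j (G\<^sub>j - r\<^sub>j) (G\<^sub>j - G'\<^sub>j)\<close>, whose expectation is the number of active
  coordinates.\<close>

section \<open>Weak convergence from characteristic functions\<close>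

text \<open>With the natural link the data enter the log-likelihood linearly, so nothing random is
  left once the linear term is split off. The optimization is therefore analysed for all score
  values of norm at most \<open>K\<close> at once, and randomness enters only through the event that
  both scores are that small. The exponents: moving an inactive coordinate by x / sqrt n costs
  n^(gamma0/2) (|x| / sqrt n)^gamma = n^((gamma0 - gamma)/2) |x|^gamma, which diverges since gamma <
  gamma0. For an active coordinate the first-order cost is of order n^((gamma0 - 1)/2) |x|, bounded
  since gamma0 <= 1. The obstacle is that the penalty is not convex and \<open>B\<close> is not
  compact. The minimizer is localized because the convex part grows at least linearly away from the
  truth, while the penalty falls at most linearly and with a smaller slope. The limiting functional
  is quadratic and hence unbounded, so weak convergence is applied to its cosine and sine. The claim
  concerns the mean of the limit law; no convergence of expectations is involved.\<close>

inductive trig_poly :: "('a::euclidean_space \<Rightarrow> real) \<Rightarrow> bool" where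
  wave: "trig_poly (\<lambda>x. c * cos (\<xi> \<bullet> x + \<phi>))"
| add: "trig_poly f \<Longrightarrow> trig_poly g \<Longrightarrow> trig_poly (\<lambda>x. f x + g x)"

lemma trig_poly_const: "trig_poly (\<lambda>x. c)"
  using trig_poly.wave[of c 0 0] by simp

text \<open>The phase in the generator serves this case and the constants: a sine is a cosine
  shifted by pi/2 and a constant is a cosine of frequency zero, so cosine waves suffice as
  generators.\<close>

lemma trig_poly_sin: "trig_poly (\<lambda>x. c * sin (\<xi> \<bullet> x))"
  using trig_poly.wave[of c \<xi> "- (pi / 2)"] by (simp add: cos_diff)

lemma trig_poly_sum:
  assumes "finite I" "\<And>i. i \<in> I \<Longrightarrow> trig_poly (f i)"
  shows "trig_poly (\<lambda>x. \<Sum>i\<in>I. f i x)"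
  using assms by (induction I rule: finite_induct) (auto intro: trig_poly_const trig_poly.add)

text \<open>Product-to-sum: cos a cos b is the mean of cos (a - b) and cos (a + b). Closure under
  products is what makes a polynomial in sines a trigonometric sum.\<close>

lemma trig_poly_mult_wave:
  assumes "trig_poly g"
  shows "trig_poly (\<lambda>x. (c * cos (\<xi> \<bullet> x + \<phi>)) * g x)"
  using assms
proof induction
  case (wave d \<eta> \<psi>)
  have "trig_poly (\<lambda>x. (c * d / 2) * cos ((\<xi> - \<eta>) \<bullet> x + (\<phi> - \<psi>)) + (c * d / 2) * cos ((\<xi> + \<eta>) \<bullet> x + (\<phi> + \<psi>)))"
    by (intro trig_poly.intros)
  also have "(\<lambda>x. (c * d / 2) * cos ((\<xi> - \<eta>) \<bullet> x + (\<phi> - \<psi>)) + (c * d / 2) * cos ((\<xi> + \<eta>) \<bullet> x + (\<phi> + \<psi>)))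
     = (\<lambda>x. (c * cos (\<xi> \<bullet> x + \<phi>)) * (d * cos (\<eta> \<bullet> x + \<psi>)))"
  proof
    fix x
    have "(\<xi> - \<eta>) \<bullet> x + (\<phi> - \<psi>) = (\<xi> \<bullet> x + \<phi>) - (\<eta> \<bullet> x + \<psi>)"
         "(\<xi> + \<eta>) \<bullet> x + (\<phi> + \<psi>) = (\<xi> \<bullet> x + \<phi>) + (\<eta> \<bullet> x + \<psi>)"
      by (simp_all add: inner_diff_left inner_add_left)
    then show "(c * d / 2) * cos ((\<xi> - \<eta>) \<bullet> x + (\<phi> - \<psi>)) + (c * d / 2) * cos ((\<xi> + \<eta>) \<bullet> x + (\<phi> + \<psi>))
      = (c * cos (\<xi> \<bullet> x + \<phi>)) * (d * cos (\<eta> \<bullet> x + \<psi>))"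
      by (simp only: cos_add cos_diff) (simp add: algebra_simps)
  qed
  finally show ?case .
next
  case (add f g)
  then show ?case by (simp add: distrib_left trig_poly.add)
qed

lemma trig_poly_mult:
  assumes "trig_poly f" "trig_poly g"
  shows "trig_poly (\<lambda>x. f x * g x)"
  using assms
  by (induction f) (auto intro: trig_poly_mult_wave trig_poly.add simp: distrib_right)

text \<open>Real polynomial functions are generated by the linear ones, which become sums of sines
  of frequency \<open>i /\<^sub>R R\<close>; sums and products stay in the class.\<close>

lemma trig_poly_polynomial_sin:
  assumes "real_polynomial_function p"
  shows "trig_poly (\<lambda>x. p (\<Sum>i\<in>Basis. sin (x \<bullet> i / R) *\<^sub>R i))"
  using assms
proof induction
  case (linear f)
  interpret bounded_linear f by fact
  have *: "f (\<Sum>i\<in>Basis. sin (x \<bullet> i / R) *\<^sub>R i) = (\<Sum>i\<in>Basis. f i * sin ((i /\<^sub>R R) \<bullet> x))" for x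
    by (simp add: sum scaleR inner_commute divide_inverse mult.commute)
  show ?case unfolding * by (intro trig_poly_sum trig_poly_sin) auto
qed (auto intro: trig_poly_const trig_poly.add trig_poly_mult)

lemma trig_poly_continuous: "trig_poly f \<Longrightarrow> continuous_on UNIV f"
  by (induction rule: trig_poly.induct) (auto intro!: continuous_intros)

lemma trig_poly_bounded: "trig_poly f \<Longrightarrow> \<exists>K. \<forall>x. \<bar>f x\<bar> \<le> K"
proof (induction rule: trig_poly.induct)
  case (wave c \<xi> \<phi>)
  have "\<bar>c * cos (\<xi> \<bullet> x + \<phi>)\<bar> \<le> \<bar>c\<bar>" for x
    using mult_left_mono[OF abs_cos_le_one[of "\<xi> \<bullet> x + \<phi>"] abs_ge_zero[of c]] by (simp add: abs_mult)
  then show ?case by blast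
next
  case (add f g)
  then obtain K L where "\<forall>x. \<bar>f x\<bar> \<le> K" "\<forall>x. \<bar>g x\<bar> \<le> L" by blast
  then have "\<forall>x. \<bar>f x + g x\<bar> \<le> K + L" by (meson abs_triangle_ineq add_mono order_trans)
  then show ?case by blast
qed

lemma integrable_bounded_continuous:
  fixes f :: "'a::euclidean_space \<Rightarrow> 'b::{banach,second_countable_topology}"
  assumes "finite_measure M" and "sets M = sets borel" and "continuous_on UNIV f" and "\<And>x. norm (f x) \<le> K"
  shows "integrable M f"
proof -
  interpret finite_measure M by fact
  have "f \<in> borel_measurable M"
    using borel_measurable_continuous_onI[OF assms(3)] measurable_cong_sets[OF assms(2) refl] by blast
  then show ?thesis using assms(4) by (intro integrable_const_bound[of _ K]) auto
qed

text \<open>A wave is the real part of a fixed complex multiple of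
  \<open>cis (\<xi> \<bullet> x)\<close>, so its integral is a fixed real-linear function of the
  characteristic function at \<open>\<xi>\<close>.\<close>

lemma trig_poly_integral_convergence:
  fixes \<mu> :: "nat \<Rightarrow> 'a::euclidean_space measure"
  assumes P: "\<And>n. prob_space (\<mu> n)" "\<And>n. sets (\<mu> n) = sets borel"
    and Q: "prob_space \<rho>" "sets \<rho> = sets borel"
    and char: "\<And>\<xi>. (\<lambda>n. \<integral>x. cis (\<xi> \<bullet> x) \<partial>\<mu> n) \<longlonglongrightarrow> (\<integral>x. cis (\<xi> \<bullet> x) \<partial>\<rho>)"
    and "trig_poly f"
  shows "(\<lambda>n. \<integral>x. f x \<partial>\<mu> n) \<longlonglongrightarrow> (\<integral>x. f x \<partial>\<rho>)"
  using \<open>trig_poly f\<close>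
proof induction
  case (wave c \<xi> \<phi>)
  have *: "(\<integral>x. c * cos (\<xi> \<bullet> x + \<phi>) \<partial>N) = c * Re (cis \<phi> * (\<integral>x. cis (\<xi> \<bullet> x) \<partial>N))"
    if "prob_space N" "sets N = sets borel" for N :: "'a measure"
  proof -
    interpret prob_space N by fact
    have "integrable N (\<lambda>x. cis (\<xi> \<bullet> x))"
      by (rule integrable_bounded_continuous[of _ _ 1])
        (auto intro!: continuous_intros that finite_measure_axioms)
    then have "integrable N (\<lambda>x. cis \<phi> * cis (\<xi> \<bullet> x))"
      and "cis \<phi> * (\<integral>x. cis (\<xi> \<bullet> x) \<partial>N) = (\<integral>x. cis \<phi> * cis (\<xi> \<bullet> x) \<partial>N)"
      by (auto simp del: cis_mult)
    then show ?thesis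
      using integral_Re[of N "\<lambda>x. cis \<phi> * cis (\<xi> \<bullet> x)"]
      by (simp only: cis_mult cis.sel add.commute) simp
  qed
  show ?case
    unfolding *[OF P] *[OF Q] by (intro tendsto_intros char)
next
  case (add f g)
  have i: "integrable N h" if "prob_space N" "sets N = sets borel" "trig_poly h" for N and h :: "'a \<Rightarrow> real"
    using integrable_bounded_continuous[of N h] trig_poly_continuous trig_poly_bounded[OF that(3)] that
    by (auto simp: prob_space.finite_measure)
  show ?case
    using tendsto_add[OF add.IH] add.hyps by (simp add: i P Q)
qed

text \<open>On \<open>cbox (-R) R\<close> each coordinate is recovered from \<open>sin (x\<^sub>i / R)\<close> by \<open>arcsin\<close>, so a polynomial
  in these sines that is uniformly close to \<open>f\<close> there is bounded on the whole space: no periodic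
  extension of \<open>f\<close> is needed.\<close>

lemma trig_poly_approximation:
  fixes f :: "'a::euclidean_space \<Rightarrow> real"
  assumes cont: "continuous_on UNIV f" and bound: "\<And>x. \<bar>f x\<bar> \<le> K" and "0 < R" "0 < e"
  obtains g where "trig_poly g" "\<And>x. norm x \<le> R \<Longrightarrow> \<bar>f x - g x\<bar> \<le> e" "\<And>x. \<bar>g x\<bar> \<le> K + e"
proof -
  define F where "F s = f (\<Sum>i\<in>Basis. (R * arcsin (s \<bullet> i)) *\<^sub>R i)" for s :: 'a
  let ?C = "cbox (- One) One :: 'a set"
  have contF: "continuous_on ?C F"
    unfolding F_def
    by (rule continuous_on_compose2[OF cont])
      (auto intro!: continuous_intros continuous_on_arcsin simp: mem_box)
  obtain p where p: "real_polynomial_function p" "\<And>s. s \<in> ?C \<Longrightarrow> \<bar>F s - p s\<bar> < e"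
    using Stone_Weierstrass_real_polynomial_function[OF compact_cbox contF \<open>0 < e\<close>] by blast
  define \<psi> where "\<psi> x = (\<Sum>i\<in>Basis. sin (x \<bullet> i / R) *\<^sub>R i)" for x :: 'a
  have \<psi>: "\<psi> x \<in> ?C" for x by (auto simp: \<psi>_def mem_box)
  have F\<psi>: "F (\<psi> x) = f x" if "norm x \<le> R" for x
  proof -
    have "R * arcsin (\<psi> x \<bullet> i) = x \<bullet> i" if i: "i \<in> Basis" for i
    proof -
      have "\<bar>x \<bullet> i / R\<bar> \<le> 1" using Basis_le_norm[OF i, of x] \<open>norm x \<le> R\<close> \<open>0 < R\<close> by auto
      then have "\<bar>x \<bullet> i / R\<bar> \<le> pi / 2" using pi_ge_two by linarith
      then have "arcsin (sin (x \<bullet> i / R)) = x \<bullet> i / R" by (intro arcsin_sin) linarith+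
      then show ?thesis using i \<open>0 < R\<close> by (simp add: \<psi>_def)
    qed
    then show ?thesis by (simp add: F_def euclidean_representation cong: sum.cong)
  qed
  show thesis
  proof
    show "trig_poly (\<lambda>x. p (\<psi> x))" unfolding \<psi>_def by (rule trig_poly_polynomial_sin[OF p(1)])
    show "\<bar>f x - p (\<psi> x)\<bar> \<le> e" if "norm x \<le> R" for x
      using p(2)[OF \<psi>[of x]] F\<psi>[OF that] by simp
    show "\<bar>p (\<psi> x)\<bar> \<le> K + e" for x
      using p(2)[OF \<psi>[of x]] bound[of "\<Sum>i\<in>Basis. (R * arcsin (\<psi> x \<bullet> i)) *\<^sub>R i"] by (simp add: F_def)
  qed
qed

text \<open>One direction of the Levy continuity theorem in several dimensions. Tightness is a
  hypothesis rather than a consequence of the continuity of the limiting characteristic function,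
  since second moments supply it directly in the application.\<close>

theorem bounded_continuous_integral_convergence:
  fixes \<mu> :: "nat \<Rightarrow> 'a::euclidean_space measure" and f :: "'a \<Rightarrow> real"
  assumes P: "\<And>n. prob_space (\<mu> n)" "\<And>n. sets (\<mu> n) = sets borel"
    and Q: "prob_space \<rho>" "sets \<rho> = sets borel"
    and char: "\<And>\<xi>. (\<lambda>n. \<integral>x. cis (\<xi> \<bullet> x) \<partial>\<mu> n) \<longlonglongrightarrow> (\<integral>x. cis (\<xi> \<bullet> x) \<partial>\<rho>)"
    and tight: "\<And>e. 0 < e \<Longrightarrow> \<exists>R>0. measure \<rho> {x. R < norm x} \<le> e \<and> (\<forall>n. measure (\<mu> n) {x. R < norm x} \<le> e)"
    and cont: "continuous_on UNIV f" and bound: "\<And>x. \<bar>f x\<bar> \<le> K"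
  shows "(\<lambda>n. \<integral>x. f x \<partial>\<mu> n) \<longlonglongrightarrow> (\<integral>x. f x \<partial>\<rho>)"
proof -
  have K: "0 \<le> K" using bound[of 0] by linarith
  \<comment> \<open>Inside the ball the integrands differ by at most \<open>e\<close>; outside they
    differ by at most \<open>2 * K + e\<close>, on a set of mass at most \<open>d\<close>.\<close>
  have close: "\<bar>(\<integral>x. f x \<partial>N) - (\<integral>x. g x \<partial>N)\<bar> \<le> e + (2 * K + e) * d"
    if N: "prob_space N" "sets N = sets borel" and g: "trig_poly g" "\<And>x. norm x \<le> R \<Longrightarrow> \<bar>f x - g x\<bar> \<le> e"
       "\<And>x. \<bar>g x\<bar> \<le> K + e" and R: "measure N {x. R < norm x} \<le> d" and "0 \<le> e"
     for N R e d g
  proof -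
    interpret prob_space N by fact
    have [measurable]: "{x. R < norm x} \<in> sets N" unfolding N(2) by measurable
    have i: "integrable N f" "integrable N g"
      using integrable_bounded_continuous[OF finite_measure_axioms N(2), of f K]
        integrable_bounded_continuous[OF finite_measure_axioms N(2), of g "K + e"]
        cont bound trig_poly_continuous[OF g(1)] g(3) by auto
    have ind: "integrable N (indicat_real {x. R < norm x})"
      by (intro integrable_real_indicator) (auto simp: emeasure_eq_measure)
    have "\<bar>f x - g x\<bar> \<le> e + (2 * K + e) * indicator {x. R < norm x} x" for x
      using bound[of x] g(2,3)[of x] \<open>0 \<le> e\<close> by (auto simp: indicator_def)
    then have "(\<integral>x. \<bar>f x - g x\<bar> \<partial>N) \<le> (\<integral>x. e + (2 * K + e) * indicator {x. R < norm x} x \<partial>N)"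
      using i by (intro integral_mono) (auto intro!: integrable_real_mult_indicator)
    also have "\<dots> = e + (2 * K + e) * measure N {x. R < norm x}"
      by (subst Bochner_Integration.integral_add) (auto simp: prob_space ind)
    also have "\<dots> \<le> e + (2 * K + e) * d" using K R \<open>0 \<le> e\<close> by (intro add_left_mono mult_left_mono) auto
    finally show ?thesis
      using integral_abs_bound[of N "\<lambda>x. f x - g x"] i by (simp add: Bochner_Integration.integral_diff)
  qed
  show ?thesis
  proof (rule LIMSEQ_I)
    fix r :: real assume "0 < r"
    \<comment> \<open>Since \<open>e\<close> is at most 1, e + (2K + e) e <= (2K + 2) e <= r/4. This
      error occurs once for each of the two measures, and the trigonometric sum costs less than
      another r/4.\<close>
    define e where "e = min 1 (r / 4 / (2 * K + 2))"
    have e: "0 < e" "e \<le> 1" using \<open>0 < r\<close> K by (auto simp: e_def)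
    have "e \<le> r / 4 / (2 * K + 2)" by (simp add: e_def)
    then have e3: "e * (2 * K + 2) \<le> r / 4" using K by (subst (asm) pos_le_divide_eq) auto
    obtain R where R: "0 < R" "measure \<rho> {x. R < norm x} \<le> e" "\<And>n. measure (\<mu> n) {x. R < norm x} \<le> e"
      using tight[OF \<open>0 < e\<close>] by blast
    obtain g where g: "trig_poly g" "\<And>x. norm x \<le> R \<Longrightarrow> \<bar>f x - g x\<bar> \<le> e" "\<And>x. \<bar>g x\<bar> \<le> K + e"
      using trig_poly_approximation[OF cont bound \<open>0 < R\<close> \<open>0 < e\<close>] by blast
    have small: "e + (2 * K + e) * e \<le> r / 4"
    proof -
      have "e * e \<le> e" using e by (simp add: mult_left_le)
      then show ?thesis using e3 by (simp add: algebra_simps)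
    qed
    have "(\<lambda>n. \<integral>x. g x \<partial>\<mu> n) \<longlonglongrightarrow> (\<integral>x. g x \<partial>\<rho>)"
      by (rule trig_poly_integral_convergence[OF P Q char g(1)])
    then obtain N where N: "\<And>n. n \<ge> N \<Longrightarrow> \<bar>(\<integral>x. g x \<partial>\<mu> n) - (\<integral>x. g x \<partial>\<rho>)\<bar> < r / 4"
      using LIMSEQ_D[of _ _ "r / 4"] \<open>0 < r\<close> by (metis real_norm_def divide_pos_pos zero_less_numeral)
    show "\<exists>N. \<forall>n\<ge>N. norm ((\<integral>x. f x \<partial>\<mu> n) - (\<integral>x. f x \<partial>\<rho>)) < r"
    proof (intro exI allI impI)
      fix n assume "n \<ge> N"
      show "norm ((\<integral>x. f x \<partial>\<mu> n) - (\<integral>x. f x \<partial>\<rho>)) < r"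
        using close[OF P g R(3)[of n]] close[OF Q g R(2)] N[OF \<open>n \<ge> N\<close>] small less_imp_le[OF e(1)]
          unfolding real_norm_def by linarith
    qed
  qed
qed

section \<open>Natural exponential families\<close>

text \<open>In the interior of the parameter space only some small exponential moment is known to be
  finite, so integrands are required to stay below every exp (e |y|). The class contains the
  constants and is stable under multiplication by coordinates, hence under differentiation of
  moments in the parameter.\<close>

definition subexponential :: "(real^'r \<Rightarrow> real) \<Rightarrow> bool" where
  "subexponential g \<longleftrightarrow> g \<in> borel_measurable borel \<and>
    (\<forall>e>0. \<exists>C. \<forall>y. \<bar>g y\<bar> \<le> C * exp (e * norm y))"

lemma subexponential_measurable: "subexponential g \<Longrightarrow> g \<in> borel_measurable borel"
  by (simp add: subexponential_def)

lemma subexponentialE: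
  assumes "subexponential g" "0 < e"
  obtains C where "0 \<le> C" "\<And>y. \<bar>g y\<bar> \<le> C * exp (e * norm y)"
proof -
  obtain C where C: "\<And>y. \<bar>g y\<bar> \<le> C * exp (e * norm y)"
    using assms by (auto simp: subexponential_def)
  have "\<bar>g y\<bar> \<le> \<bar>C\<bar> * exp (e * norm y)" for y
    by (rule order_trans[OF C[of y] mult_right_mono[OF abs_ge_self]]) simp
  then show thesis using that[of "\<bar>C\<bar>"] by simp
qed

lemma subexponential_const: "subexponential (\<lambda>_. c)"
  unfolding subexponential_def
proof (intro conjI allI impI exI)
  fix e :: real and y :: "real^'r" assume "0 < e"
  then show "\<bar>c\<bar> \<le> \<bar>c\<bar> * exp (e * norm y)" by (simp add: mult_le_cancel_left1)
qed simp

text \<open>Half of the exponent \<open>e\<close> pays for the new factor, because (e/2) |y| <= exp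
  ((e/2) |y|), and the other half pays for \<open>g\<close>.\<close>

lemma subexponential_mult_norm_bounded:
  assumes g: "subexponential g" and f: "f \<in> borel_measurable borel" and le: "\<And>y. \<bar>f y\<bar> \<le> norm y"
  shows "subexponential (\<lambda>y. f y * g y)"
  unfolding subexponential_def
proof (intro conjI allI impI)
  show "(\<lambda>y. f y * g y) \<in> borel_measurable borel" using f subexponential_measurable[OF g] by measurable
  fix e :: real assume e: "0 < e"
  obtain C where C: "0 \<le> C" "\<And>y. \<bar>g y\<bar> \<le> C * exp (e / 2 * norm y)"
    using subexponentialE[OF g, of "e / 2"] e by auto
  have "\<bar>f y * g y\<bar> \<le> (2 / e * C) * exp (e * norm y)" for y
  proof -
    have "e / 2 * norm y \<le> exp (e / 2 * norm y)" using exp_ge_add_one_self[of "e / 2 * norm y"] by linarith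
    then have "norm y \<le> 2 / e * exp (e / 2 * norm y)" using e by (simp add: field_simps)
    then have "\<bar>f y\<bar> \<le> 2 / e * exp (e / 2 * norm y)" using le[of y] by linarith
    then have "\<bar>f y\<bar> * \<bar>g y\<bar> \<le> (2 / e * exp (e / 2 * norm y)) * (C * exp (e / 2 * norm y))"
      using C e by (intro mult_mono) auto
    also have "\<dots> = 2 / e * C * exp (e / 2 * norm y + e / 2 * norm y)" by (simp only: exp_add mult_ac)
    finally show ?thesis by (simp add: abs_mult)
  qed
  then show "\<exists>C. \<forall>y. \<bar>f y * g y\<bar> \<le> C * exp (e * norm y)" by blast
qed

lemma subexponential_component: "subexponential g \<Longrightarrow> subexponential (\<lambda>y. y $ j * g y)"
  by (rule subexponential_mult_norm_bounded) (auto simp: component_le_norm_cart)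

lemma subexponential_norm_power: "subexponential (\<lambda>y. norm y ^ k)"
  by (induction k) (auto intro: subexponential_const subexponential_mult_norm_bounded)

text \<open>Everything follows from (1 - t) exp t <= 1, that is exp t - 1 <= t exp t. The bound
  holds for all t, as it will be integrated over unbounded arguments.\<close>

lemma exp_remainder_bound:
  fixes t :: real
  shows "\<bar>exp t - 1 - t\<bar> \<le> t\<^sup>2 * exp \<bar>t\<bar>"
proof -
  have "1 - t \<le> exp (- t)" using exp_ge_add_one_self[of "- t"] by simp
  then have "exp t * (1 - t) \<le> exp t * exp (- t)" by (rule mult_left_mono) simp
  then have u: "exp t - 1 \<le> t * exp t" by (simp add: exp_minus algebra_simps)
  have l: "0 \<le> exp t - 1 - t" using exp_ge_add_one_self[of t] by linarith
  have "exp t - 1 - t \<le> t\<^sup>2 * exp \<bar>t\<bar>"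
  proof (cases "0 \<le> t")
    case True
    then have "exp t - 1 - t \<le> t * (exp t - 1)" using u by (simp add: algebra_simps)
    also have "\<dots> \<le> t * (t * exp t)" using True u by (rule mult_left_mono[rotated])
    finally show ?thesis using True by (simp add: power2_eq_square)
  next
    case False
    have "exp t - 1 - t \<le> (- t) * (1 - exp t)" using u by (simp add: algebra_simps)
    also have "\<dots> \<le> (- t) * (- t)" using False l by (intro mult_left_mono) auto
    also have "\<dots> \<le> t\<^sup>2 * exp \<bar>t\<bar>" by (simp add: power2_eq_square mult_le_cancel_left1)
    finally show ?thesis .
  qed
  then show ?thesis using l by simp
qed

lemma has_derivative_quadratic_remainder:
  fixes f :: "'a::real_normed_vector \<Rightarrow> 'b::real_normed_vector"
  assumes "bounded_linear D" "0 < d" and "\<And>h. norm h < d \<Longrightarrow> norm (f (x + h) - f x - D h) \<le> K * (norm h)\<^sup>2"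
  shows "(f has_derivative D) (at x)"
  unfolding has_derivative_at_alt
proof (intro conjI allI impI)
  show "bounded_linear D" by fact
  fix e :: real assume "0 < e"
  define \<delta> where "\<delta> = min d (e / (\<bar>K\<bar> + 1))"
  have "0 < \<delta>" using \<open>0 < e\<close> \<open>0 < d\<close> by (simp add: \<delta>_def)
  moreover have "norm (f y - f x - D (y - x)) \<le> e * norm (y - x)" if "norm (y - x) < \<delta>" for y
  proof -
    have "norm (f (x + (y - x)) - f x - D (y - x)) \<le> K * (norm (y - x))\<^sup>2"
      using that by (intro assms(3)) (simp add: \<delta>_def)
    also have "\<dots> \<le> ((\<bar>K\<bar> + 1) * norm (y - x)) * norm (y - x)"
      by (simp add: power2_eq_square mult.assoc[symmetric] mult_right_mono)
    also have "\<dots> \<le> e * norm (y - x)"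
      using that by (intro mult_right_mono) (auto simp: \<delta>_def field_simps)
    finally show ?thesis by simp
  qed
  ultimately show "\<exists>d>0. \<forall>y. norm (y - x) < d \<longrightarrow> norm (f y - f x - D (y - x)) \<le> e * norm (y - x)" by blast
qed

locale exponential_family =
  fixes \<nu> :: "(real^'r) measure" and b :: "real^'r \<Rightarrow> real"
  assumes sets_\<nu>: "sets \<nu> = sets borel" and b_measurable [measurable]: "b \<in> borel_measurable borel"
begin

abbreviation weight :: "real^'r \<Rightarrow> real^'r \<Rightarrow> real" where
  "weight \<theta> y \<equiv> exp (y \<bullet> \<theta> + b y)"

abbreviation domain :: "(real^'r) set" where
  "domain \<equiv> interior (natural_parameter_space \<nu> b)"

text \<open>Left unnormalized, so that a derivative in \<open>\<theta>\<close> only multiplies the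
  integrand by a coordinate of \<open>y\<close>. The normalizer is itself the moment of the constant
  1.\<close>

definition moment :: "(real^'r \<Rightarrow> real) \<Rightarrow> real^'r \<Rightarrow> real" where
  "moment g \<theta> = (\<integral>y. g y * weight \<theta> y \<partial>\<nu>)"

lemma measurable_\<nu>: "f \<in> borel_measurable borel \<Longrightarrow> f \<in> borel_measurable \<nu>"
  using measurable_cong_sets[OF sets_\<nu> refl] by blast

lemma weight_measurable: "weight \<theta> \<in> borel_measurable \<nu>"
  by (rule measurable_\<nu>) measurable

lemma natural_parameter_spaceD:
  assumes "\<theta> \<in> natural_parameter_space \<nu> b"
  shows "0 < (\<integral>\<^sup>+ y. ennreal (weight \<theta> y) \<partial>\<nu>)"
    and "(\<integral>\<^sup>+ y. ennreal (weight \<theta> y) \<partial>\<nu>) < \<infinity>"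
  using assms[unfolded natural_parameter_space_def mem_Collect_eq] by (rule conjunct1, rule conjunct2)

lemma weight_integrable: "\<theta> \<in> natural_parameter_space \<nu> b \<Longrightarrow> integrable \<nu> (weight \<theta>)"
  by (rule integrableI_nonneg[OF weight_measurable _ natural_parameter_spaceD(2)]) (intro AE_I2 exp_ge_zero)

lemma weight_integral_pos:
  assumes "\<theta> \<in> natural_parameter_space \<nu> b"
  shows "0 < (\<integral>y. weight \<theta> y \<partial>\<nu>)"
proof -
  have "(\<integral>\<^sup>+ y. ennreal (weight \<theta> y) \<partial>\<nu>) = ennreal (\<integral>y. weight \<theta> y \<partial>\<nu>)"
    by (rule nn_integral_eq_integral[OF weight_integrable[OF assms]]) (intro AE_I2 exp_ge_zero)
  with natural_parameter_spaceD(1)[OF assms] show ?thesis by (simp only: ennreal_less_zero_iff)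
qed

lemma moment_one_pos: "\<theta> \<in> domain \<Longrightarrow> 0 < moment (\<lambda>_. 1) \<theta>"
  unfolding moment_def mult_1 by (rule weight_integral_pos[OF subsetD[OF interior_subset]])

lemma cumulant_eq: "cumulant \<nu> b \<theta> = ln (moment (\<lambda>_. 1) \<theta>)"
  by (simp add: cumulant_def moment_def)

text \<open>A closed ball of radius \<open>e\<close> about \<open>\<theta>\<close> lies in the
  parameter space, so shifting \<open>\<theta>\<close> by e or -e along an axis keeps the weight
  integrable. The norm of \<open>y\<close> is at most CARD('r) times its largest coordinate, hence
  the choice e / CARD('r): the exponential of the norm lies below the sum of these shifted
  weights.\<close>

lemma exponential_moment:
  assumes "\<theta> \<in> domain"
  obtains \<eta> where "0 < \<eta>" "integrable \<nu> (\<lambda>y. exp (\<eta> * norm y) * weight \<theta> y)"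
proof -
  obtain e where e: "0 < e" "cball \<theta> e \<subseteq> natural_parameter_space \<nu> b"
    using assms by (meson mem_interior_cball)
  define \<eta> where "\<eta> = e / CARD('r)"
  have "0 < \<eta>" using e by (simp add: \<eta>_def)
  have i: "integrable \<nu> (weight (\<theta> + s *\<^sub>R axis j 1))" if "\<bar>s\<bar> \<le> e" for s j
    using that by (intro weight_integrable subsetD[OF e(2)]) (simp add: dist_norm)
  let ?g = "\<lambda>y. \<Sum>j\<in>UNIV. weight (\<theta> + e *\<^sub>R axis j 1) y + weight (\<theta> + (- e) *\<^sub>R axis j 1) y"
  have "integrable \<nu> ?g"
    using e(1) by (intro Bochner_Integration.integrable_sum Bochner_Integration.integrable_add i) auto
  moreover
  have m: "(\<lambda>y. exp (\<eta> * norm y) * weight \<theta> y) \<in> borel_measurable \<nu>" by (rule measurable_\<nu>) measurable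
  have "exp (\<eta> * norm y) * weight \<theta> y \<le> ?g y" for y
  proof -
    obtain k where k: "\<bar>y $ j\<bar> \<le> \<bar>y $ k\<bar>" for j
    proof -
      have "Max (range (\<lambda>j. \<bar>y $ j\<bar>)) \<in> range (\<lambda>j. \<bar>y $ j\<bar>)" by (rule Max_in) auto
      then obtain k where "Max (range (\<lambda>j. \<bar>y $ j\<bar>)) = \<bar>y $ k\<bar>" by blast
      then show thesis using that[of k] Max_ge[of "range (\<lambda>j. \<bar>y $ j\<bar>)"] by (metis finite finite_imageI rangeI)
    qed
    have "norm y \<le> (\<Sum>j\<in>UNIV. \<bar>y $ j\<bar>)" by (rule norm_le_l1_cart)
    also have "\<dots> \<le> CARD('r) * \<bar>y $ k\<bar>" using sum_bounded_above[of UNIV "\<lambda>j. \<bar>y $ j\<bar>" "\<bar>y $ k\<bar>"] k by simp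
    finally have "\<eta> * norm y \<le> e * \<bar>y $ k\<bar>"
      using e(1) by (simp add: \<eta>_def field_simps)
    then have "exp (\<eta> * norm y) \<le> exp (e * \<bar>y $ k\<bar>)" by simp
    also have "\<dots> \<le> exp (e * y $ k) + exp (- e * y $ k)"
      by (cases "0 \<le> y $ k") auto
    finally have "exp (\<eta> * norm y) * weight \<theta> y \<le> (exp (e * y $ k) + exp (- e * y $ k)) * weight \<theta> y"
      by (rule mult_right_mono) simp
    also have "\<dots> = weight (\<theta> + e *\<^sub>R axis k 1) y + weight (\<theta> + (- e) *\<^sub>R axis k 1) y"
      by (simp add: inner_add_right inner_diff_right inner_axis' inner_axis exp_add[symmetric] distrib_right algebra_simps)
    also have "\<dots> \<le> ?g y" by (rule member_le_sum) auto
    finally show ?thesis .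
  qed
  then have "AE y in \<nu>. norm (exp (\<eta> * norm y) * weight \<theta> y) \<le> norm (?g y)"
    unfolding real_norm_def abs_mult abs_exp_cancel by (intro AE_I2 order_trans[OF _ abs_ge_self])
  ultimately have "integrable \<nu> (\<lambda>y. exp (\<eta> * norm y) * weight \<theta> y)"
    using Bochner_Integration.integrable_bound[of \<nu> ?g "\<lambda>y. exp (\<eta> * norm y) * weight \<theta> y"] m by blast
  with \<open>0 < \<eta>\<close> show thesis by (rule that)
qed

lemma moment_integrable:
  assumes "\<theta> \<in> domain" and g: "subexponential g"
  shows "integrable \<nu> (\<lambda>y. g y * weight \<theta> y)"
proof -
  obtain \<eta> where \<eta>: "0 < \<eta>" "integrable \<nu> (\<lambda>y. exp (\<eta> * norm y) * weight \<theta> y)"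
    using exponential_moment[OF assms(1)] by blast
  obtain C where C: "0 \<le> C" "\<And>y. \<bar>g y\<bar> \<le> C * exp (\<eta> * norm y)"
    using subexponentialE[OF g \<eta>(1)] by blast
  have "integrable \<nu> (\<lambda>y. C * (exp (\<eta> * norm y) * weight \<theta> y))" using \<eta>(2) by simp
  then show ?thesis
  proof (rule Bochner_Integration.integrable_bound)
    show "(\<lambda>y. g y * weight \<theta> y) \<in> borel_measurable \<nu>"
      by (intro borel_measurable_times measurable_\<nu>[OF subexponential_measurable[OF g]] weight_measurable)
    show "AE y in \<nu>. norm (g y * weight \<theta> y) \<le> norm (C * (exp (\<eta> * norm y) * weight \<theta> y))"
      using C by (auto intro!: AE_I2 mult_right_mono simp: abs_mult simp flip: mult.assoc)
  qed
qed

lemma moment_has_derivative: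
  assumes \<theta>: "\<theta> \<in> domain" and g: "subexponential g"
  shows "(moment g has_derivative (\<lambda>h. \<Sum>j\<in>UNIV. h $ j * moment (\<lambda>y. y $ j * g y) \<theta>)) (at \<theta>)"
proof -
  let ?D = "\<lambda>h. \<Sum>j\<in>UNIV. h $ j * moment (\<lambda>y. y $ j * g y) \<theta>"
  obtain \<eta> where \<eta>: "0 < \<eta>" "integrable \<nu> (\<lambda>y. exp (\<eta> * norm y) * weight \<theta> y)"
    using exponential_moment[OF assms(1)] by blast
  have "subexponential (\<lambda>y. norm y ^ 2 * g y)"
    using g by (auto simp: power2_eq_square mult.assoc intro!: subexponential_mult_norm_bounded)
  then obtain C where C: "0 \<le> C" "\<And>y. \<bar>norm y ^ 2 * g y\<bar> \<le> C * exp (\<eta> / 2 * norm y)"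
    using subexponentialE[of "\<lambda>y. norm y ^ 2 * g y" "\<eta> / 2"] \<eta> by auto
  define K where "K = C * (\<integral>y. exp (\<eta> * norm y) * weight \<theta> y \<partial>\<nu>)"
  obtain e where e: "0 < e" "ball \<theta> e \<subseteq> domain" using \<theta> by (meson open_interior openE)
  \<comment> \<open>\<open>e\<close> keeps \<open>\<theta> + h\<close> in the domain.
    \<open>\<eta> / 2\<close> bounds exp |y . h| by exp (\<eta>/2 |y|); the other half of the
    exponent is spent on |y|^2 |g y|, so the remainder is |h|^2 times an integrable
    function.\<close>
  define d where "d = min e (\<eta> / 2)"
  show ?thesis
  proof (rule has_derivative_quadratic_remainder)
    show "bounded_linear ?D"
      by (intro bounded_linear_intros bounded_linear_vec_nth)
    show "0 < d" using e \<eta> by (simp add: d_def)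
    fix h :: "real^'r" assume h: "norm h < d"
    have "\<theta> + h \<in> domain" using h e by (auto simp: d_def dist_norm subset_iff)
    note i1 = moment_integrable[OF this g]
    note i0 = moment_integrable[OF \<theta> g]
    note ij = moment_integrable[OF \<theta> subexponential_component[OF g]]
    have D: "?D h = (\<integral>y. (y \<bullet> h) * g y * weight \<theta> y \<partial>\<nu>)"
      and iD: "integrable \<nu> (\<lambda>y. (y \<bullet> h) * g y * weight \<theta> y)"
    proof -
      have *: "(\<lambda>y. (y \<bullet> h) * g y * weight \<theta> y) = (\<lambda>y. \<Sum>j\<in>UNIV. h $ j * (y $ j * g y * weight \<theta> y))"
        by (auto simp: inner_vec_def sum_distrib_left sum_distrib_right mult_ac)
      show "integrable \<nu> (\<lambda>y. (y \<bullet> h) * g y * weight \<theta> y)" unfolding *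
        by (intro Bochner_Integration.integrable_sum integrable_mult_right ij)
      show "?D h = (\<integral>y. (y \<bullet> h) * g y * weight \<theta> y \<partial>\<nu>)"
        unfolding * by (subst Bochner_Integration.integral_sum) (auto simp: moment_def intro!: integrable_mult_right ij)
    qed
    let ?r = "\<lambda>y. g y * weight (\<theta> + h) y - g y * weight \<theta> y - (y \<bullet> h) * g y * weight \<theta> y"
    have pw: "\<bar>?r y\<bar>
        \<le> (norm h)\<^sup>2 * (C * (exp (\<eta> * norm y) * weight \<theta> y))" for y
    proof -
      have ip: "\<bar>y \<bullet> h\<bar> \<le> norm y * norm h" by (rule Cauchy_Schwarz_ineq2)
      have "norm h \<le> \<eta> / 2" using h by (simp add: d_def)
      then have "norm y * norm h \<le> \<eta> / 2 * norm y" by (metis mult.commute mult_left_mono norm_ge_zero)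
      then have ex: "exp \<bar>y \<bullet> h\<bar> \<le> exp (\<eta> / 2 * norm y)" using ip by simp
      have "\<bar>exp (y \<bullet> h) - 1 - y \<bullet> h\<bar> \<le> (y \<bullet> h)\<^sup>2 * exp \<bar>y \<bullet> h\<bar>" by (rule exp_remainder_bound)
      also have "\<dots> \<le> (norm y * norm h)\<^sup>2 * exp (\<eta> / 2 * norm y)"
        using ex ip by (intro mult_mono) (auto simp: abs_le_square_iff[symmetric])
      finally have "\<bar>g y\<bar> * \<bar>exp (y \<bullet> h) - 1 - y \<bullet> h\<bar> \<le> \<bar>g y\<bar> * ((norm y * norm h)\<^sup>2 * exp (\<eta> / 2 * norm y))"
        by (rule mult_left_mono) simp
      also have "\<dots> = (norm h)\<^sup>2 * (\<bar>norm y ^ 2 * g y\<bar> * exp (\<eta> / 2 * norm y))"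
        by (simp add: power_mult_distrib abs_mult mult_ac)
      also have "\<dots> \<le> (norm h)\<^sup>2 * ((C * exp (\<eta> / 2 * norm y)) * exp (\<eta> / 2 * norm y))"
        by (intro mult_left_mono mult_right_mono C) auto
      also have "\<dots> = (norm h)\<^sup>2 * (C * exp (\<eta> * norm y))"
        by (simp add: exp_add[symmetric] mult.assoc)
      finally have "\<bar>g y\<bar> * \<bar>exp (y \<bullet> h) - 1 - y \<bullet> h\<bar> * weight \<theta> y \<le> (norm h)\<^sup>2 * (C * exp (\<eta> * norm y)) * weight \<theta> y"
        by (rule mult_right_mono) simp
      moreover have "?r y
        = g y * (exp (y \<bullet> h) - 1 - y \<bullet> h) * weight \<theta> y"
        by (simp add: inner_add_right exp_add algebra_simps)
      ultimately show ?thesis by (simp add: abs_mult mult.assoc)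
    qed
    have eq: "moment g (\<theta> + h) - moment g \<theta> - ?D h
      = (\<integral>y. ?r y \<partial>\<nu>)"
      unfolding D
      by (simp only: moment_def Bochner_Integration.integral_diff Bochner_Integration.integrable_diff i0 i1 iD)
    have "\<bar>\<integral>y. ?r y \<partial>\<nu>\<bar> \<le> (\<integral>y. (norm h)\<^sup>2 * (C * (exp (\<eta> * norm y) * weight \<theta> y)) \<partial>\<nu>)"
    proof (rule order.trans[OF integral_abs_bound integral_mono[OF _ _ pw]])
      show "integrable \<nu> (\<lambda>y. \<bar>?r y\<bar>)"
        by (intro integrable_abs Bochner_Integration.integrable_diff i0 i1 iD)
      show "integrable \<nu> (\<lambda>y. (norm h)\<^sup>2 * (C * (exp (\<eta> * norm y) * weight \<theta> y)))"
        by (intro integrable_mult_right \<eta>(2))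
    qed
    also have "\<dots> = K * (norm h)\<^sup>2" unfolding K_def integral_mult_right_zero by (rule mult.commute)
    finally show "norm (moment g (\<theta> + h) - moment g \<theta> - ?D h) \<le> K * (norm h)\<^sup>2"
      unfolding real_norm_def eq .
  qed
qed

lemma moment_continuous: "subexponential g \<Longrightarrow> continuous_on domain (moment g)"
  using moment_has_derivative has_derivative_continuous continuous_at_imp_continuous_on by blast

text \<open>The factor 1 is the function \<open>g\<close> of \<open>moment_has_derivative\<close>,
  kept visible so that its instance for the constant 1 matches literally; likewise in
  \<open>covariance\<close>.\<close>

definition mean :: "real^'r \<Rightarrow> real^'r" where
  "mean \<theta> = (\<chi> j. moment (\<lambda>y. y $ j * 1) \<theta> / moment (\<lambda>_. 1) \<theta>)"

definition covariance :: "real^'r \<Rightarrow> real^'r^'r" where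
  "covariance \<theta> = (\<chi> j k. moment (\<lambda>y. y $ k * (y $ j * 1)) \<theta> / moment (\<lambda>_. 1) \<theta> - mean \<theta> $ j * mean \<theta> $ k)"

lemma cumulant_has_derivative:
  assumes "\<theta> \<in> domain"
  shows "(cumulant \<nu> b has_derivative (\<lambda>h. mean \<theta> \<bullet> h)) (at \<theta>)"
proof -
  have "((\<lambda>\<theta>. ln (moment (\<lambda>_. 1) \<theta>)) has_derivative
      (\<lambda>h. (\<Sum>j\<in>UNIV. h $ j * moment (\<lambda>y. y $ j * 1) \<theta>) * inverse (moment (\<lambda>_. 1) \<theta>))) (at \<theta>)"
    by (rule has_derivative_ln[OF moment_one_pos[OF assms] moment_has_derivative[OF assms subexponential_const]])
  also have "(\<lambda>h. (\<Sum>j\<in>UNIV. h $ j * moment (\<lambda>y. y $ j * 1) \<theta>) * inverse (moment (\<lambda>_. 1) \<theta>)) = (\<lambda>h. mean \<theta> \<bullet> h)"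
    by (auto simp: mean_def inner_vec_def sum_distrib_right sum_distrib_left divide_inverse mult_ac)
  finally show ?thesis unfolding cumulant_eq[abs_def] .
qed

lemma gradient_cumulant: "\<theta> \<in> domain \<Longrightarrow> gradient (cumulant \<nu> b) \<theta> = mean \<theta>"
  unfolding gradient_def frechet_derivative_at[OF cumulant_has_derivative, symmetric]
  by (simp add: vec_eq_iff inner_axis)

lemma mean_has_derivative:
  assumes \<theta>: "\<theta> \<in> domain"
  shows "(mean has_derivative (\<lambda>h. covariance \<theta> *v h)) (at \<theta>)"
proof (rule has_derivative_componentwise_within[THEN iffD2, rule_format])
  fix i :: "real^'r" assume "i \<in> Basis"
  then obtain j where i: "i = axis j 1" by (auto simp: Basis_vec_def)
  let ?m = "moment (\<lambda>_. 1)"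
  have pos: "?m \<theta> \<noteq> 0" using moment_one_pos[OF \<theta>] by simp
  have "((\<lambda>\<theta>. moment (\<lambda>y. y $ j * 1) \<theta> / ?m \<theta>) has_derivative
     (\<lambda>h. - moment (\<lambda>y. y $ j * 1) \<theta> * (inverse (?m \<theta>) * (\<Sum>k\<in>UNIV. h $ k * moment (\<lambda>y. y $ k * 1) \<theta>) * inverse (?m \<theta>))
        + (\<Sum>k\<in>UNIV. h $ k * moment (\<lambda>y. y $ k * (y $ j * 1)) \<theta>) / ?m \<theta>)) (at \<theta>)"
    by (rule has_derivative_divide[OF moment_has_derivative[OF \<theta> subexponential_component[OF subexponential_const]]
          moment_has_derivative[OF \<theta> subexponential_const] pos])
  also have "(\<lambda>\<theta>. moment (\<lambda>y. y $ j * 1) \<theta> / ?m \<theta>) = (\<lambda>\<theta>. mean \<theta> \<bullet> i)"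
    by (simp add: mean_def i inner_axis)
  also have "(\<lambda>h. - moment (\<lambda>y. y $ j * 1) \<theta> * (inverse (?m \<theta>) * (\<Sum>k\<in>UNIV. h $ k * moment (\<lambda>y. y $ k * 1) \<theta>) * inverse (?m \<theta>))
        + (\<Sum>k\<in>UNIV. h $ k * moment (\<lambda>y. y $ k * (y $ j * 1)) \<theta>) / ?m \<theta>) = (\<lambda>h. (covariance \<theta> *v h) \<bullet> i)"
    by (simp add: covariance_def mean_def i inner_axis matrix_vector_mult_def left_diff_distrib right_diff_distrib sum_subtractf sum_negf
        sum_distrib_left sum_divide_distrib divide_inverse mult_ac)
  finally show "((\<lambda>\<theta>. mean \<theta> \<bullet> i) has_derivative (\<lambda>h. (covariance \<theta> *v h) \<bullet> i)) (at \<theta>)" .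
qed

text \<open>The gradient is identified with \<open>mean\<close> on \<open>domain\<close> only; since
  this set is open, the derivative of \<open>mean\<close> carries over at each of its
  points.\<close>

lemma hessian_cumulant:
  assumes "\<theta> \<in> domain"
  shows "hessian (cumulant \<nu> b) \<theta> = covariance \<theta>"
proof -
  have "(gradient (cumulant \<nu> b) has_derivative (\<lambda>h. covariance \<theta> *v h)) (at \<theta>)"
    by (rule has_derivative_transform_within_open[OF mean_has_derivative[OF assms] open_interior assms])
      (simp add: gradient_cumulant)
  then show ?thesis
    unfolding hessian_def jacobian_def by (simp add: frechet_derivative_at[symmetric])
qed

lemma mean_continuous: "continuous_on domain mean"
  using mean_has_derivative has_derivative_continuous continuous_at_imp_continuous_on by blast

lemma covariance_continuous: "continuous_on domain covariance"
proof -
  have "continuous_on domain (\<lambda>\<theta>. covariance \<theta> $ j $ k)" for j k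
  proof -
    have "continuous_on domain (\<lambda>\<theta>. mean \<theta> $ l)" for l
      using mean_continuous by (rule continuous_on_component)
    then show ?thesis
      unfolding covariance_def vec_lambda_beta
      using moment_one_pos
      by (intro continuous_on_diff continuous_on_mult continuous_on_divide moment_continuous
          subexponential_component subexponential_const) fastforce+
  qed
  then have "continuous_on domain (\<lambda>\<theta>. \<chi> j k. covariance \<theta> $ j $ k)"
    by (intro continuous_on_vec_lambda)
  then show ?thesis by simp
qed

section \<open>Expectations under a density of the family\<close>

lemma expectation_moment:
  assumes \<theta>: "\<theta> \<in> domain" and M: "prob_space M" and g: "subexponential g"
    and Y: "distributed M \<nu> Y (\<lambda>y. ennreal (expfam_density \<nu> b \<theta> y))"
  shows "integrable M (\<lambda>\<omega>. g (Y \<omega>))" and "(\<integral>\<omega>. g (Y \<omega>) \<partial>M) = moment g \<theta> / moment (\<lambda>_. 1) \<theta>"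
proof -
  have dens: "expfam_density \<nu> b \<theta> y = weight \<theta> y / moment (\<lambda>_. 1) \<theta>" for y
  proof -
    have "expfam_density \<nu> b \<theta> y = exp ((y \<bullet> \<theta> + b y) - ln (moment (\<lambda>_. 1) \<theta>))"
      by (simp add: expfam_density_def cumulant_eq algebra_simps)
    then show ?thesis by (simp only: exp_diff exp_ln[OF moment_one_pos[OF \<theta>]])
  qed
  have g': "g \<in> borel_measurable \<nu>"
    by (rule measurable_\<nu>[OF subexponential_measurable[OF g]])
  have nn: "\<And>y. 0 \<le> expfam_density \<nu> b \<theta> y" by (simp add: expfam_density_def)
  have *: "(\<lambda>y. expfam_density \<nu> b \<theta> y * g y) = (\<lambda>y. (g y * weight \<theta> y) / moment (\<lambda>_. 1) \<theta>)"
    by (simp add: dens mult.commute)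
  show "integrable M (\<lambda>\<omega>. g (Y \<omega>))"
    by (subst distributed_integrable[OF Y g' nn, symmetric], subst *)
      (intro Bochner_Integration.integrable_divide moment_integrable \<theta> g)
  show "(\<integral>\<omega>. g (Y \<omega>) \<partial>M) = moment g \<theta> / moment (\<lambda>_. 1) \<theta>"
    by (subst distributed_integral[OF Y g' nn, symmetric], subst *) (simp add: moment_def)
qed

lemma directional_moments:
  fixes v :: "real^'r"
  assumes \<theta>: "\<theta> \<in> domain" and M: "prob_space M"
    and Y: "distributed M \<nu> Y (\<lambda>y. ennreal (expfam_density \<nu> b \<theta> y))"
  shows "integrable M (\<lambda>\<omega>. (v \<bullet> (Y \<omega> - mean \<theta>))\<^sup>2)"
    and "(\<integral>\<omega>. v \<bullet> (Y \<omega> - mean \<theta>) \<partial>M) = 0"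
    and "(\<integral>\<omega>. (v \<bullet> (Y \<omega> - mean \<theta>))\<^sup>2 \<partial>M) = v \<bullet> (covariance \<theta> *v v)"
proof -
  interpret prob_space M by fact
  let ?m = "moment (\<lambda>_. 1) \<theta>"
  note E1 = expectation_moment[OF \<theta> M subexponential_component[OF subexponential_const] Y]
  note E2 = expectation_moment[OF \<theta> M subexponential_component[OF subexponential_component[OF subexponential_const]] Y]
  define D where "D j \<omega> = Y \<omega> $ j - mean \<theta> $ j" for j \<omega>
  have i1: "integrable M (\<lambda>\<omega>. Y \<omega> $ j)" and e1: "(\<integral>\<omega>. Y \<omega> $ j \<partial>M) = mean \<theta> $ j" for j
    using E1[of j 1] by (simp_all add: mean_def)
  have i2: "integrable M (\<lambda>\<omega>. Y \<omega> $ k * Y \<omega> $ j)"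
    and e2: "(\<integral>\<omega>. Y \<omega> $ k * Y \<omega> $ j \<partial>M) = covariance \<theta> $ j $ k + mean \<theta> $ j * mean \<theta> $ k" for j k
    using E2[of k j 1] by (simp_all add: covariance_def)
  have iD: "integrable M (D j)" and eD: "(\<integral>\<omega>. D j \<omega> \<partial>M) = 0" for j
    unfolding D_def using i1 e1 by (simp_all add: prob_space)
  have DD: "D k \<omega> * D j \<omega> = Y \<omega> $ k * Y \<omega> $ j - mean \<theta> $ k * Y \<omega> $ j - mean \<theta> $ j * Y \<omega> $ k + mean \<theta> $ k * mean \<theta> $ j" for j k \<omega>
    by (simp add: D_def algebra_simps)
  have iDD: "integrable M (\<lambda>\<omega>. D k \<omega> * D j \<omega>)" and eDD: "(\<integral>\<omega>. D k \<omega> * D j \<omega> \<partial>M) = covariance \<theta> $ j $ k" for j k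
    unfolding DD using i1 e1 i2 e2 by (simp_all add: prob_space mult.commute[of "mean \<theta> $ k"])
  have v: "v \<bullet> (Y \<omega> - mean \<theta>) = (\<Sum>j\<in>UNIV. v $ j * D j \<omega>)" for \<omega> by (simp add: inner_vec_def D_def)
  have v2: "(v \<bullet> (Y \<omega> - mean \<theta>))\<^sup>2 = (\<Sum>j\<in>UNIV. \<Sum>k\<in>UNIV. v $ j * v $ k * (D k \<omega> * D j \<omega>))" for \<omega>
    by (simp add: v power2_eq_square sum_product mult_ac)
  show "(\<integral>\<omega>. v \<bullet> (Y \<omega> - mean \<theta>) \<partial>M) = 0"
    unfolding v by (subst Bochner_Integration.integral_sum) (auto simp: iD eD)
  show "integrable M (\<lambda>\<omega>. (v \<bullet> (Y \<omega> - mean \<theta>))\<^sup>2)"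
    unfolding v2 by (intro Bochner_Integration.integrable_sum integrable_mult_right iDD)
  have "(\<integral>\<omega>. (v \<bullet> (Y \<omega> - mean \<theta>))\<^sup>2 \<partial>M) = (\<Sum>j\<in>UNIV. \<Sum>k\<in>UNIV. v $ j * v $ k * covariance \<theta> $ j $ k)"
    unfolding v2 by (simp only: Bochner_Integration.integral_sum Bochner_Integration.integrable_sum integrable_mult_right iDD integral_mult_right_zero eDD)
  also have "\<dots> = v \<bullet> (covariance \<theta> *v v)"
    by (simp add: inner_vec_def matrix_vector_mult_def sum_distrib_left mult_ac)
  finally show "(\<integral>\<omega>. (v \<bullet> (Y \<omega> - mean \<theta>))\<^sup>2 \<partial>M) = v \<bullet> (covariance \<theta> *v v)" .
qed

text \<open>The 8 is 2 cubed: a difference is at most twice the larger of the two norms, and the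
  cube of a maximum is at most the sum of the cubes.\<close>

lemma directional_third_moment:
  fixes v :: "real^'r"
  assumes \<theta>: "\<theta> \<in> domain" and M: "prob_space M"
    and Y: "distributed M \<nu> Y (\<lambda>y. ennreal (expfam_density \<nu> b \<theta> y))"
  shows "integrable M (\<lambda>\<omega>. \<bar>v \<bullet> (Y \<omega> - mean \<theta>)\<bar> ^ 3)"
    and "(\<integral>\<omega>. \<bar>v \<bullet> (Y \<omega> - mean \<theta>)\<bar> ^ 3 \<partial>M)
      \<le> 8 * norm v ^ 3 * (moment (\<lambda>y. norm y ^ 3) \<theta> / moment (\<lambda>_. 1) \<theta> + norm (mean \<theta>) ^ 3)"
proof -
  interpret prob_space M by fact
  note E = expectation_moment[OF \<theta> M subexponential_norm_power[of 3] Y]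
  have "Y \<in> M \<rightarrow>\<^sub>M \<nu>" by (rule distributed_measurable[OF Y])
  then have [measurable]: "Y \<in> borel_measurable M" using measurable_cong_sets[OF refl sets_\<nu>] by blast
  have le: "\<bar>v \<bullet> (Y \<omega> - mean \<theta>)\<bar> ^ 3 \<le> 8 * norm v ^ 3 * (norm (Y \<omega>) ^ 3 + norm (mean \<theta>) ^ 3)" for \<omega>
  proof -
    let ?a = "norm (Y \<omega>)" and ?b = "norm (mean \<theta>)"
    have "\<bar>v \<bullet> (Y \<omega> - mean \<theta>)\<bar> \<le> norm v * norm (Y \<omega> - mean \<theta>)" by (rule Cauchy_Schwarz_ineq2)
    also have "\<dots> \<le> norm v * (2 * max ?a ?b)"
      by (intro mult_left_mono order.trans[OF norm_triangle_ineq4]) auto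
    finally have "\<bar>v \<bullet> (Y \<omega> - mean \<theta>)\<bar> ^ 3 \<le> (norm v * (2 * max ?a ?b)) ^ 3" by (rule power_mono) simp
    also have "\<dots> = 8 * norm v ^ 3 * (max ?a ?b) ^ 3" by (simp add: power_mult_distrib)
    also have "\<dots> \<le> 8 * norm v ^ 3 * (?a ^ 3 + ?b ^ 3)"
      by (intro mult_left_mono) (auto simp: max_def)
    finally show ?thesis .
  qed
  have iR: "integrable M (\<lambda>\<omega>. 8 * norm v ^ 3 * (norm (Y \<omega>) ^ 3 + norm (mean \<theta>) ^ 3))"
    using E(1) by simp
  show iL: "integrable M (\<lambda>\<omega>. \<bar>v \<bullet> (Y \<omega> - mean \<theta>)\<bar> ^ 3)"
  proof (rule Bochner_Integration.integrable_bound[OF iR])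
    have "norm (\<bar>v \<bullet> (Y \<omega> - mean \<theta>)\<bar> ^ 3) = \<bar>v \<bullet> (Y \<omega> - mean \<theta>)\<bar> ^ 3" for \<omega> by simp
    then show "AE \<omega> in M. norm (\<bar>v \<bullet> (Y \<omega> - mean \<theta>)\<bar> ^ 3)
        \<le> norm (8 * norm v ^ 3 * (norm (Y \<omega>) ^ 3 + norm (mean \<theta>) ^ 3))"
      by (simp only: real_norm_def) (intro AE_I2 order.trans[OF le abs_ge_self])
  qed measurable
  have "(\<integral>\<omega>. \<bar>v \<bullet> (Y \<omega> - mean \<theta>)\<bar> ^ 3 \<partial>M) \<le> (\<integral>\<omega>. 8 * norm v ^ 3 * (norm (Y \<omega>) ^ 3 + norm (mean \<theta>) ^ 3) \<partial>M)"
    by (rule integral_mono[OF iL iR le])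
  also have "\<dots> = 8 * norm v ^ 3 * (moment (\<lambda>y. norm y ^ 3) \<theta> / moment (\<lambda>_. 1) \<theta> + norm (mean \<theta>) ^ 3)"
    using E by (simp add: prob_space)
  finally show "(\<integral>\<omega>. \<bar>v \<bullet> (Y \<omega> - mean \<theta>)\<bar> ^ 3 \<partial>M)
      \<le> 8 * norm v ^ 3 * (moment (\<lambda>y. norm y ^ 3) \<theta> / moment (\<lambda>_. 1) \<theta> + norm (mean \<theta>) ^ 3)" .
qed

text \<open>Compactness of the design enters the central limit theorem here: continuity of the
  moments bounds them over all predictors at the true parameter, which gives one third-moment bound
  for all summands.\<close>

lemma third_moment_bounded:
  assumes "compact K" "K \<subseteq> domain"
  obtains C where "\<And>\<theta>. \<theta> \<in> K \<Longrightarrow> moment (\<lambda>y. norm y ^ 3) \<theta> / moment (\<lambda>_. 1) \<theta> + norm (mean \<theta>) ^ 3 \<le> C"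
proof -
  have nz: "\<forall>\<theta>\<in>domain. moment (\<lambda>_. 1) \<theta> \<noteq> 0"
    using moment_one_pos by (metis less_irrefl)
  have "continuous_on domain (\<lambda>\<theta>. moment (\<lambda>y. norm y ^ 3) \<theta> / moment (\<lambda>_. 1) \<theta> + norm (mean \<theta>) ^ 3)"
    by (intro continuous_on_add continuous_on_divide continuous_on_power continuous_on_norm moment_continuous
        mean_continuous subexponential_norm_power subexponential_const nz)
  then have "compact ((\<lambda>\<theta>. moment (\<lambda>y. norm y ^ 3) \<theta> / moment (\<lambda>_. 1) \<theta> + norm (mean \<theta>) ^ 3) ` K)"
    by (rule compact_continuous_image[OF continuous_on_subset[OF _ assms(2)] assms(1)])
  then obtain C where C: "\<forall>z\<in>(\<lambda>\<theta>. moment (\<lambda>y. norm y ^ 3) \<theta> / moment (\<lambda>_. 1) \<theta> + norm (mean \<theta>) ^ 3) ` K. norm z \<le> C"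
    using compact_imp_bounded bounded_iff by blast
  show thesis
    by (rule that[of C]) (use C in force)
qed

end

section \<open>Central limit theorem for independent summands\<close>

text \<open>The sharp remainder is the mean of a minimum of a quadratic and a cubic term. The cubic
  one is kept, because the order |t|^3 survives multiplication of n factors at t = 1 / sqrt
  n.\<close>

lemma (in prob_space) char_third_moment:
  fixes X :: "'a \<Rightarrow> real"
  assumes rv: "random_variable borel X" and sq: "integrable M (\<lambda>\<omega>. (X \<omega>)\<^sup>2)" and mean: "expectation X = 0"
    and third: "integrable M (\<lambda>\<omega>. \<bar>X \<omega>\<bar> ^ 3)" "expectation (\<lambda>\<omega>. \<bar>X \<omega>\<bar> ^ 3) \<le> C"
  shows "cmod (char (distr M borel X) t - (1 - t\<^sup>2 * expectation (\<lambda>\<omega>. (X \<omega>)\<^sup>2) / 2)) \<le> \<bar>t\<bar> ^ 3 * C"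
proof -
  have i: "integrable M X" by (rule square_integrable_imp_integrable[OF rv sq])
  have "cmod (char (distr M borel X) t - (1 - t\<^sup>2 * expectation (\<lambda>\<omega>. (X \<omega>)\<^sup>2) / 2))
      \<le> (t\<^sup>2 / 6) * expectation (\<lambda>\<omega>. min (6 * (X \<omega>)\<^sup>2) (\<bar>t\<bar> * \<bar>X \<omega>\<bar> ^ 3))"
    by (rule char_approx3'[OF rv i sq mean _ refl]) (simp add: mean)
  also have "expectation (\<lambda>\<omega>. min (6 * (X \<omega>)\<^sup>2) (\<bar>t\<bar> * \<bar>X \<omega>\<bar> ^ 3)) \<le> expectation (\<lambda>\<omega>. \<bar>t\<bar> * \<bar>X \<omega>\<bar> ^ 3)"
    using sq third by (intro integral_mono) auto
  also have "expectation (\<lambda>\<omega>. \<bar>t\<bar> * \<bar>X \<omega>\<bar> ^ 3) \<le> \<bar>t\<bar> * C"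
    using third(2) by (simp add: mult_left_mono)
  also have "t\<^sup>2 / 6 * (\<bar>t\<bar> * C) \<le> \<bar>t\<bar> ^ 3 * C"
  proof -
    have "0 \<le> C" by (rule order.trans[OF Bochner_Integration.integral_nonneg third(2)]) simp
    moreover have "t\<^sup>2 = \<bar>t\<bar>\<^sup>2" by simp
    then have "t\<^sup>2 / 6 * (\<bar>t\<bar> * C) = (\<bar>t\<bar> ^ 3 * C) / 6"
      by (simp only: power3_eq_cube power2_eq_square) simp
    moreover have "0 \<le> \<bar>t\<bar> ^ 3 * C" using \<open>0 \<le> C\<close> by simp
    ultimately show ?thesis by linarith
  qed
  finally show ?thesis by (simp add: mult_left_mono)
qed

text \<open>A theorem of Lyapunov type. All factors lie in the unit disc, so two products differ by
  at most the sum of the factorwise differences, and each factor is compared with the Gaussian one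
  of the same variance. Only the averages of the variances converge; the frequency is absorbed in
  \<open>X\<close>.\<close>

theorem (in prob_space) normalized_sum_characteristic_limit:
  fixes X :: "nat \<Rightarrow> 'a \<Rightarrow> real"
  assumes indep: "indep_vars (\<lambda>_. borel) X UNIV"
    and sq: "\<And>i. integrable M (\<lambda>\<omega>. (X i \<omega>)\<^sup>2)" and mean: "\<And>i. expectation (X i) = 0"
    and third: "\<And>i. integrable M (\<lambda>\<omega>. \<bar>X i \<omega>\<bar> ^ 3)" "\<And>i. expectation (\<lambda>\<omega>. \<bar>X i \<omega>\<bar> ^ 3) \<le> C"
    and lim: "(\<lambda>n. (\<Sum>i<n. expectation (\<lambda>\<omega>. (X i \<omega>)\<^sup>2)) / real n) \<longlonglongrightarrow> s"
  shows "(\<lambda>n. \<integral>\<omega>. cis ((\<Sum>i<n. X i \<omega>) / sqrt (real n)) \<partial>M) \<longlonglongrightarrow> complex_of_real (exp (- s / 2))"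
proof -
  define \<sigma> where "\<sigma> i = expectation (\<lambda>\<omega>. (X i \<omega>)\<^sup>2)" for i
  \<comment> \<open>Bounds all variances, because x^2 <= 1 + |x|^3.\<close>
  define S where "S = 1 + C"
  have rv[measurable]: "random_variable borel (X i)" for i using indep by (simp add: indep_vars_def)
  have C: "0 \<le> C" by (rule order.trans[OF Bochner_Integration.integral_nonneg third(2)]) simp
  have \<sigma>0: "0 \<le> \<sigma> i" for i by (simp add: \<sigma>_def)
  have \<sigma>S: "\<sigma> i \<le> S" for i
  proof -
    have "(X i \<omega>)\<^sup>2 \<le> 1 + \<bar>X i \<omega>\<bar> ^ 3" for \<omega>
    proof (cases "\<bar>X i \<omega>\<bar> \<le> 1")
      case True
      then have "(X i \<omega>)\<^sup>2 \<le> 1" by (simp add: abs_square_le_1)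
      then show ?thesis by (simp add: add_increasing2)
    next
      case False
      then have "\<bar>X i \<omega>\<bar> ^ 2 \<le> \<bar>X i \<omega>\<bar> ^ 3" by (intro power_increasing) auto
      then show ?thesis by simp
    qed
    then have "\<sigma> i \<le> expectation (\<lambda>\<omega>. 1 + \<bar>X i \<omega>\<bar> ^ 3)"
      unfolding \<sigma>_def using sq third by (intro integral_mono) auto
    then show ?thesis using third(1)[of i] third(2)[of i] by (simp add: prob_space S_def)
  qed
  define \<phi> where "\<phi> n i = char (distr M borel (X i)) (1 / sqrt (real n))" for n i
  define \<psi> where "\<psi> n i = complex_of_real (exp (- \<sigma> i / (2 * real n)))" for n i
  \<comment> \<open>\<open>R n / n\<close> bounds the error of one factor: C n^(-3/2) from the third
    moment, plus the error of replacing 1 - x by exp (-x) at x = \<sigma> / (2n). The n errors add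
    up to \<open>R n\<close>, which tends to 0.\<close>
  define R where "R n = C / sqrt (real n) + S\<^sup>2 * exp S / real n" for n
  have prod: "(\<integral>\<omega>. cis ((\<Sum>i<n. X i \<omega>) / sqrt (real n)) \<partial>M) = (\<Prod>i<n. \<phi> n i)" for n
  proof -
    have "char (distr M borel (\<lambda>\<omega>. \<Sum>i<n. X i \<omega>)) (1 / sqrt (real n)) = (\<Prod>i<n. \<phi> n i)"
      unfolding \<phi>_def by (rule char_distr_sum[OF indep_vars_subset[OF indep]]) simp
    then show ?thesis by (simp add: char_def integral_distr cis_conv_exp)
  qed
  have step: "cmod (\<phi> n i - \<psi> n i) \<le> R n / real n" if "1 \<le> n" for n i
  proof -
    let ?t = "1 / sqrt (real n)"
    have t2: "?t\<^sup>2 = 1 / real n" by (simp add: power_divide)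
    have "cmod (\<phi> n i - (1 - ?t\<^sup>2 * \<sigma> i / 2)) \<le> \<bar>?t\<bar> ^ 3 * C"
      unfolding \<phi>_def \<sigma>_def by (rule char_third_moment[OF rv sq mean third])
    also have "\<bar>?t\<bar> ^ 3 * C = (C / sqrt (real n)) / real n"
    proof -
      have "\<bar>?t\<bar> ^ 3 = ?t\<^sup>2 * ?t" by (simp add: power3_eq_cube power2_eq_square)
      then show ?thesis by (simp only: t2) simp
    qed
    finally have 1: "cmod (\<phi> n i - (1 - \<sigma> i / (2 * real n))) \<le> (C / sqrt (real n)) / real n"
      by (simp only: t2) (simp add: mult.commute)
    let ?x = "\<sigma> i / (2 * real n)"
    have x: "0 \<le> ?x" "?x \<le> S / real n" "?x \<le> S"
    proof -
      show "0 \<le> ?x" using \<sigma>0 by simp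
      have "?x \<le> \<sigma> i / real n" using \<sigma>0 that by (intro divide_left_mono) auto
      also have "\<dots> \<le> S / real n" using \<sigma>S by (intro divide_right_mono) auto
      finally show "?x \<le> S / real n" .
      also have "\<dots> \<le> S" using that C divide_left_mono[of 1 "real n" S] by (simp add: S_def)
      finally show "?x \<le> S" .
    qed
    have "\<bar>exp (- ?x) - 1 - (- ?x)\<bar> \<le> (- ?x)\<^sup>2 * exp \<bar>- ?x\<bar>" by (rule exp_remainder_bound)
    also have "\<dots> \<le> (S / real n)\<^sup>2 * exp S"
      using x by (intro mult_mono) (auto simp: power2_le_iff_abs_le)
    also have "\<dots> = (S\<^sup>2 * exp S / real n) / real n" by (simp add: power2_eq_square)
    finally have 2: "cmod ((1 - \<sigma> i / (2 * real n)) - \<psi> n i) \<le> (S\<^sup>2 * exp S / real n) / real n"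
    proof -
      assume le: "\<bar>exp (- ?x) - 1 - (- ?x)\<bar> \<le> (S\<^sup>2 * exp S / real n) / real n"
      have "(1 - \<sigma> i / (2 * real n)) - \<psi> n i = complex_of_real (- (exp (- ?x) - 1 - (- ?x)))"
        by (simp add: \<psi>_def)
      then show ?thesis using le by (simp only: norm_of_real abs_minus_cancel)
    qed
    show ?thesis
      using norm_triangle_ineq[of "\<phi> n i - (1 - \<sigma> i / (2 * real n))" "(1 - \<sigma> i / (2 * real n)) - \<psi> n i"] 1 2
      by (simp add: R_def add_divide_distrib)
  qed
  have bound: "cmod ((\<Prod>i<n. \<phi> n i) - (\<Prod>i<n. \<psi> n i)) \<le> R n" if "1 \<le> n" for n
  proof -
    have "cmod ((\<Prod>i<n. \<phi> n i) - (\<Prod>i<n. \<psi> n i)) \<le> (\<Sum>i<n. cmod (\<phi> n i - \<psi> n i))"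
    proof (rule norm_prod_diff)
      show "cmod (\<phi> n i) \<le> 1" for i
        unfolding \<phi>_def by (intro real_distribution.cmod_char_le_1 real_distribution_distr rv)
      show "cmod (\<psi> n i) \<le> 1" for i using \<sigma>0 by (simp add: \<psi>_def)
    qed
    also have "\<dots> \<le> (\<Sum>i<n. R n / real n)" by (intro sum_mono step that)
    also have "\<dots> = R n" using that by simp
    finally show ?thesis .
  qed
  have R0: "R \<longlonglongrightarrow> 0"
  proof -
    have "(\<lambda>n. 1 / sqrt (real n)) \<longlonglongrightarrow> 0" "(\<lambda>n. 1 / real n) \<longlonglongrightarrow> 0" by real_asymp+
    from tendsto_add[OF tendsto_mult_right_zero[OF this(1), of C] tendsto_mult_right_zero[OF this(2), of "S\<^sup>2 * exp S"]]
    show ?thesis by (simp add: R_def[abs_def])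
  qed
  have diff: "(\<lambda>n. (\<Prod>i<n. \<phi> n i) - (\<Prod>i<n. \<psi> n i)) \<longlonglongrightarrow> 0"
    by (rule Lim_null_comparison[OF eventually_sequentiallyI R0]) (rule bound)
  have "(\<Prod>i<n. \<psi> n i) = complex_of_real (exp (- ((\<Sum>i<n. \<sigma> i) / real n) / 2))" for n
    by (simp add: \<psi>_def exp_sum[symmetric] sum_negf sum_divide_distrib mult.commute flip: of_real_prod)
  moreover have "(\<lambda>n. complex_of_real (exp (- ((\<Sum>i<n. \<sigma> i) / real n) / 2))) \<longlonglongrightarrow> complex_of_real (exp (- s / 2))"
    using lim unfolding \<sigma>_def by (intro tendsto_intros) auto
  ultimately have "(\<lambda>n. \<Prod>i<n. \<psi> n i) \<longlonglongrightarrow> complex_of_real (exp (- s / 2))" by simp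
  from tendsto_add[OF diff this] show ?thesis by (simp add: prod)
qed

lemma (in prob_space) second_moment_sum:
  fixes X :: "nat \<Rightarrow> 'a \<Rightarrow> real"
  assumes indep: "indep_vars (\<lambda>_. borel) X UNIV"
    and sq: "\<And>i. integrable M (\<lambda>\<omega>. (X i \<omega>)\<^sup>2)" and mean: "\<And>i. expectation (X i) = 0"
  shows "integrable M (\<lambda>\<omega>. (\<Sum>i<n. X i \<omega>)\<^sup>2) \<and>
    expectation (\<lambda>\<omega>. (\<Sum>i<n. X i \<omega>)\<^sup>2) = (\<Sum>i<n. expectation (\<lambda>\<omega>. (X i \<omega>)\<^sup>2))"
proof (induction n)
  case (Suc n)
  have rv[measurable]: "random_variable borel (X i)" for i using indep by (simp add: indep_vars_def)
  have i: "integrable M (X i)" for i by (rule square_integrable_imp_integrable[OF rv sq])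
  have iS: "integrable M (\<lambda>\<omega>. \<Sum>i<n. X i \<omega>)" using i by simp
  have iv: "indep_var borel (X n) borel (\<lambda>\<omega>. \<Sum>i<n. X i \<omega>)"
    by (rule indep_vars_sum) (auto intro: indep_vars_subset[OF indep])
  note cross = indep_var_integrable[OF iv i iS] indep_var_lebesgue_integral[OF iv i iS]
  have eq: "(\<Sum>i<Suc n. X i \<omega>)\<^sup>2 = (\<Sum>i<n. X i \<omega>)\<^sup>2 + 2 * (X n \<omega> * (\<Sum>i<n. X i \<omega>)) + (X n \<omega>)\<^sup>2" for \<omega>
    by (simp add: power2_eq_square algebra_simps)
  show ?case unfolding eq using Suc.IH cross sq[of n] mean by simp
qed (simp)

section \<open>Orthonormal bases and Gaussian vectors\<close>

text \<open>Stated for a form \<open>Q\<close> because orthogonality is later taken with respect to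
  the information matrix. The new vectors are labelled by the old ones, so coordinate axes produce a
  family indexed by coordinates.\<close>

lemma gram_schmidt_bilinear:
  fixes Q :: "'a::real_vector \<Rightarrow> 'a \<Rightarrow> real"
  assumes bil: "bilinear Q" and sym: "\<And>x y. Q x y = Q y x" and pos: "\<And>x. x \<noteq> 0 \<Longrightarrow> 0 < Q x x"
    and "finite C" "independent C"
  shows "\<exists>w. (\<forall>c\<in>C. \<forall>d\<in>C. Q (w c) (w d) = (if c = d then 1 else 0)) \<and> span (w ` C) = span C"
  using \<open>finite C\<close> \<open>independent C\<close>
proof (induction C rule: finite_induct)
  case (insert v C)
  interpret Q1: linear "\<lambda>x. Q x y" for y using bil by (simp add: bilinear_def)
  interpret Q2: linear "Q x" for x using bil by (simp add: bilinear_def)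
  have C: "independent C" and v: "v \<notin> span C" using insert.prems insert.hyps by (auto simp: independent_insert)
  obtain w where w: "\<And>c d. c \<in> C \<Longrightarrow> d \<in> C \<Longrightarrow> Q (w c) (w d) = (if c = d then 1 else 0)" "span (w ` C) = span C"
    using insert.IH[OF C] by blast
  define p where "p = (\<Sum>c\<in>C. Q v (w c) *\<^sub>R w c)"
  have p: "p \<in> span C" unfolding p_def w(2)[symmetric] by (intro span_sum span_scale span_base) auto
  define v' where "v' = v - p"
  have "v' \<noteq> 0" using p v by (auto simp: v'_def)
  define e where "e = v' /\<^sub>R sqrt (Q v' v')"
  have Qpos: "0 < Q v' v'" using pos[OF \<open>v' \<noteq> 0\<close>] .
  have ee: "Q e e = 1"
    using Qpos by (simp add: e_def Q1.scale Q2.scale) (simp add: field_simps)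
  have orth: "Q e (w d) = 0" if "d \<in> C" for d
  proof -
    have "Q p (w d) = (\<Sum>c\<in>C. Q v (w c) * Q (w c) (w d))" by (simp add: p_def Q1.sum Q1.scale)
    also have "\<dots> = (\<Sum>c\<in>C. if c = d then Q v (w c) else 0)" using w(1) that by (intro sum.cong) auto
    also have "\<dots> = Q v (w d)" using that insert.hyps by simp
    finally show ?thesis by (simp add: e_def v'_def Q1.scale Q1.diff)
  qed
  then have orth': "Q (w d) e = 0" if "d \<in> C" for d using that sym by metis
  have "v = sqrt (Q v' v') *\<^sub>R e + p" using Qpos by (simp add: e_def v'_def)
  then have span: "span (insert e (w ` C)) = span (insert v C)"
  proof -
    assume veq: "v = sqrt (Q v' v') *\<^sub>R e + p"
    have "e \<in> span (insert v C)"
    proof -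
      have "p \<in> span (insert v C)" using p span_mono[of C "insert v C"] by blast
      then show ?thesis unfolding e_def v'_def by (intro span_scale span_diff) (auto intro: span_base)
    qed
    moreover have "w ` C \<subseteq> span (insert v C)"
      using w(2) span_superset[of "w ` C"] span_mono[of C "insert v C"] by auto
    moreover have "v \<in> span (insert e (w ` C))"
    proof -
      have "p \<in> span (insert e (w ` C))" using p w(2) span_mono[of "w ` C" "insert e (w ` C)"] by auto
      then have "sqrt (Q v' v') *\<^sub>R e + p \<in> span (insert e (w ` C))"
        by (intro span_add span_scale) (auto intro: span_base)
      with veq show ?thesis by simp
    qed
    moreover have "C \<subseteq> span (insert e (w ` C))"
      using w(2) span_superset[of C] span_mono[of "w ` C" "insert e (w ` C)"] by auto
    ultimately show ?thesis by (simp add: span_eq)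
  qed
  have im: "(w(v := e)) ` insert v C = insert e (w ` C)" using insert.hyps by auto
  show ?case
  proof (intro exI[of _ "w(v := e)"] conjI ballI)
    fix c d assume "c \<in> insert v C" "d \<in> insert v C"
    then show "Q ((w(v := e)) c) ((w(v := e)) d) = (if c = d then 1 else 0)"
      using w(1) ee orth orth' insert.hyps by auto
  qed (simp only: im span)
qed simp

text \<open>The difference of the two sides lies in the span and is \<open>Q\<close>-orthogonal to
  the whole span, hence to itself, and definiteness makes it zero.\<close>

lemma orthonormal_expansion:
  fixes Q :: "'a::real_vector \<Rightarrow> 'a \<Rightarrow> real"
  assumes bil: "bilinear Q" and pos: "\<And>x. x \<noteq> 0 \<Longrightarrow> 0 < Q x x"
    and "finite I" and on: "\<And>i j. i \<in> I \<Longrightarrow> j \<in> I \<Longrightarrow> Q (w i) (w j) = (if i = j then 1 else 0)"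
    and u: "u \<in> span (w ` I)"
  shows "u = (\<Sum>i\<in>I. Q u (w i) *\<^sub>R w i)"
proof -
  interpret Q1: linear "\<lambda>x. Q x y" for y using bil by (simp add: bilinear_def)
  interpret Q2: linear "Q x" for x using bil by (simp add: bilinear_def)
  define d where "d = u - (\<Sum>i\<in>I. Q u (w i) *\<^sub>R w i)"
  have "d \<in> span (w ` I)" unfolding d_def by (intro span_diff u span_sum span_scale span_base) auto
  moreover have Qw: "Q d (w j) = 0" if "j \<in> I" for j
  proof -
    have "(\<Sum>i\<in>I. Q u (w i) * Q (w i) (w j)) = (\<Sum>i\<in>I. if i = j then Q u (w i) else 0)"
      using on that by (intro sum.cong) auto
    then show ?thesis using that \<open>finite I\<close> by (simp add: d_def Q1.diff Q1.sum Q1.scale)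
  qed
  moreover have "Q d x = 0" if "x \<in> span (w ` I)" for x
    using that by (induction rule: span_induct_alt) (auto simp: Q2.zero Q2.add Q2.scale Qw)
  ultimately have "Q d d = 0" by simp
  then have "d = 0" using pos[of d] by force
  then show ?thesis by (simp add: d_def)
qed

text \<open>The flag separates the data (\<open>True\<close>) from the copy (\<open>False\<close>);
  a single product measure makes all coordinates of both halves independent.\<close>

definition gaussian_space :: "('p::finite \<times> bool \<Rightarrow> real) measure" where
  "gaussian_space = Pi\<^sub>M UNIV (\<lambda>_. std_normal_distribution)"

lemma prob_space_gaussian_space: "prob_space gaussian_space"
  unfolding gaussian_space_def
  by (intro prob_space_PiM real_distribution.axioms(1) real_dist_normal_dist)

lemma gaussian_space_measurable [measurable]: "(\<lambda>\<omega>. \<omega> k) \<in> borel_measurable gaussian_space"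
  unfolding gaussian_space_def
  using measurable_component_singleton[of k UNIV "\<lambda>_. std_normal_distribution"] by simp

lemma gaussian_integral_prod:
  fixes f :: "'p::finite \<times> bool \<Rightarrow> real \<Rightarrow> 'b::{real_normed_field,banach,second_countable_topology}"
  assumes "\<And>k. integrable std_normal_distribution (f k)"
  shows "(\<integral>\<omega>. (\<Prod>k\<in>UNIV. f k (\<omega> k)) \<partial>gaussian_space) = (\<Prod>k\<in>UNIV. \<integral>x. f k x \<partial>std_normal_distribution)"
    and "integrable gaussian_space (\<lambda>\<omega>. \<Prod>k\<in>UNIV. f k (\<omega> k))"
proof -
  interpret N: product_sigma_finite "\<lambda>_ :: 'p \<times> bool. std_normal_distribution"
    unfolding product_sigma_finite_def
    using prob_space_imp_sigma_finite[OF real_distribution.axioms(1)[OF real_dist_normal_dist]] by blast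
  show "(\<integral>\<omega>. (\<Prod>k\<in>UNIV. f k (\<omega> k)) \<partial>gaussian_space) = (\<Prod>k\<in>UNIV. \<integral>x. f k x \<partial>std_normal_distribution)"
    unfolding gaussian_space_def by (rule N.product_integral_prod) (simp_all only: finite assms)
  show "integrable gaussian_space (\<lambda>\<omega>. \<Prod>k\<in>UNIV. f k (\<omega> k))"
    unfolding gaussian_space_def by (rule N.product_integrable_prod) (simp_all only: finite assms)
qed

lemma gaussian_moments:
  fixes k l :: "'p::finite \<times> bool"
  shows "integrable gaussian_space (\<lambda>\<omega>. \<omega> k * \<omega> l)"
    and "(\<integral>\<omega>. \<omega> k * \<omega> l \<partial>gaussian_space) = (if k = l then 1 else 0)"
    and "integrable gaussian_space (\<lambda>\<omega>. \<omega> k)"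
    and "(\<integral>\<omega>. \<omega> k \<partial>gaussian_space) = 0"
proof -
  have pow: "integrable std_normal_distribution (\<lambda>x. x ^ n)" for n
    by (rule integrable_std_normal_distribution_moment)
  have i1: "integrable std_normal_distribution (\<lambda>x. x)" and i2: "integrable std_normal_distribution (\<lambda>x. x * x)"
    and i0: "integrable std_normal_distribution (\<lambda>x. 1 :: real)"
    using pow[of 1] pow[of 2] pow[of 0] by (simp_all only: power_one_right power2_eq_square power_0)
  have e1: "(\<integral>x. x \<partial>std_normal_distribution) = 0"
    using integral_std_normal_distribution_moment_odd[OF odd_one] unfolding power_one_right .
  have e2: "(\<integral>x. x * x \<partial>std_normal_distribution) = 1"
    using std_normal_distribution_even_moments[of 1] by (simp add: power2_eq_square fact_2)
  have e0: "(\<integral>x. 1 \<partial>std_normal_distribution) = (1 :: real)"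
    using std_normal_distribution_even_moments[of 0] by simp
  \<comment> \<open>One factor per index, so that the product over all indices is
    \<open>\<omega> k * \<omega> l\<close> even for k = l, where both conditions meet in the same
    factor and produce the square.\<close>
  define f where "f m x = (if m = k then x else 1) * (if m = l then x else (1::real))" for m :: "'p \<times> bool" and x
  have fi: "integrable std_normal_distribution (f m)" for m
    unfolding f_def using i0 i1 i2 by (cases "m = k"; cases "m = l") simp_all
  have fe: "(\<integral>x. f m x \<partial>std_normal_distribution) = (if m = k \<and> m \<noteq> l \<or> m = l \<and> m \<noteq> k then 0 else 1)" for m
    unfolding f_def using e0 e1 e2 by (cases "m = k"; cases "m = l") simp_all
  have fp: "(\<Prod>m\<in>UNIV. f m (\<omega> m)) = \<omega> k * \<omega> l" for \<omega>
    by (simp add: f_def prod.distrib)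
  show "integrable gaussian_space (\<lambda>\<omega>. \<omega> k * \<omega> l)" using gaussian_integral_prod(2)[of f, OF fi] by (simp only: fp)
  have "(\<Prod>m\<in>UNIV. \<integral>x. f m x \<partial>std_normal_distribution) = (if k = l then 1 else (0::real))"
  proof (cases "k = l")
    case False
    then have "(\<integral>x. f k x \<partial>std_normal_distribution) = 0" by (simp add: fe)
    then have "(\<Prod>m\<in>UNIV. \<integral>x. f m x \<partial>std_normal_distribution) = 0" by (intro prod_zero) (auto simp del: split_paired_Ex)
    with False show ?thesis by simp
  qed (simp add: fe)
  then show "(\<integral>\<omega>. \<omega> k * \<omega> l \<partial>gaussian_space) = (if k = l then 1 else 0)"
    using gaussian_integral_prod(1)[of f, OF fi] by (simp only: fp)
  define g where "g m x = (if m = k then x else (1::real))" for m :: "'p \<times> bool" and x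
  have gi: "integrable std_normal_distribution (g m)" for m
    unfolding g_def using i0 i1 by (cases "m = k") simp_all
  have gp: "(\<Prod>m\<in>UNIV. g m (\<omega> m)) = \<omega> k" for \<omega>
    by (simp add: g_def)
  show "integrable gaussian_space (\<lambda>\<omega>. \<omega> k)" using gaussian_integral_prod(2)[of g, OF gi] by (simp only: gp)
  have "(\<integral>x. g k x \<partial>std_normal_distribution) = 0" using e1 by (simp add: g_def)
  then have "(\<Prod>m\<in>UNIV. \<integral>x. g m x \<partial>std_normal_distribution) = 0" by (intro prod_zero) (auto simp del: split_paired_Ex)
  then show "(\<integral>\<omega>. \<omega> k \<partial>gaussian_space) = 0" 
    using gaussian_integral_prod(1)[of g, OF gi] by (simp only: gp)
qed

lemma gaussian_characteristic:
  fixes c :: "'p::finite \<times> bool \<Rightarrow> real"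
  shows "(\<integral>\<omega>. cis (\<Sum>k\<in>UNIV. c k * \<omega> k) \<partial>gaussian_space) = complex_of_real (exp (- (\<Sum>k\<in>UNIV. (c k)\<^sup>2) / 2))"
proof -
  have i: "integrable std_normal_distribution (\<lambda>x. cis (c k * x))" for k
    by (rule integrable_bounded_continuous[of _ _ 1])
      (auto intro!: continuous_intros prob_space.finite_measure real_distribution.axioms(1)[OF real_dist_normal_dist])
  have e: "(\<integral>x. cis (c k * x) \<partial>std_normal_distribution) = complex_of_real (exp (- (c k)\<^sup>2 / 2))" for k
    using fun_cong[OF char_std_normal_distribution, of "c k"] by (simp add: char_def cis_conv_exp)
  have p: "cis (\<Sum>k\<in>UNIV. c k * \<omega> k) = (\<Prod>k\<in>UNIV. cis (c k * \<omega> k))" for \<omega> :: "'p \<times> bool \<Rightarrow> real"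
    by (simp add: cis_conv_exp sum_distrib_left exp_sum)
  have "(\<integral>\<omega>. cis (\<Sum>k\<in>UNIV. c k * \<omega> k) \<partial>gaussian_space) = (\<Prod>k\<in>UNIV. complex_of_real (exp (- (c k)\<^sup>2 / 2)))"
    unfolding p gaussian_integral_prod(1)[of "\<lambda>k x. cis (c k * x)", OF i] e ..
  also have "\<dots> = complex_of_real (exp (- (\<Sum>k\<in>UNIV. (c k)\<^sup>2) / 2))"
    by (simp add: exp_sum[symmetric] sum_negf sum_divide_distrib flip: of_real_prod)
  finally show ?thesis .
qed

text \<open>The bound is given for all large \<open>R\<close>, so that the radius can also be made
  to satisfy other requirements.\<close>

lemma prob_measure_tight:
  fixes \<rho> :: "'a::euclidean_space measure"
  assumes "prob_space \<rho>" "sets \<rho> = sets borel" "0 < e"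
  shows "\<exists>R0. \<forall>R\<ge>R0. measure \<rho> {x. R < norm x} \<le> e"
proof -
  interpret prob_space \<rho> by fact
  have [measurable]: "{x. r < norm x} \<in> sets \<rho>" for r unfolding assms(2) by measurable
  have "(\<lambda>n. measure \<rho> {x. real n < norm x}) \<longlonglongrightarrow> measure \<rho> (\<Inter>n. {x. real n < norm x})"
    by (intro finite_Lim_measure_decseq) (auto simp: decseq_def)
  moreover have "(\<Inter>n. {x::'a. real n < norm x}) = {}"
    by auto (meson less_le_not_le reals_Archimedean2 less_imp_le)
  ultimately have "(\<lambda>n. measure \<rho> {x. real n < norm x}) \<longlonglongrightarrow> 0" by simp
  then have "\<forall>\<^sub>F n in sequentially. measure \<rho> {x. real n < norm x} < e"
    using \<open>0 < e\<close> by (rule order_tendstoD)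
  then obtain n where n: "measure \<rho> {x. real n < norm x} < e"
    by (auto simp: eventually_sequentially)
  have "measure \<rho> {x. R < norm x} \<le> e" if "real n \<le> R" for R
    using finite_measure_mono[of "{x. R < norm x}" "{x. real n < norm x}"] that n by fastforce
  then show ?thesis by blast
qed

section \<open>Penalized quadratic minimization\<close>

text \<open>|y|^(gamma - 1) is the slope of the chord from the origin to (|y|, |y|^gamma). The
  concave power lies above this chord on [0, |y|] and keeps increasing beyond |y|, so the bound is
  global in \<open>x\<close>, unlike one from a Taylor expansion.\<close>

lemma powr_penalty_lower_bound:
  fixes x y :: real
  assumes "y \<noteq> 0" "0 < \<gamma>" "\<gamma> < 1"
  shows "- (\<bar>y\<bar> powr (\<gamma> - 1) * \<bar>x - y\<bar>) \<le> \<bar>x\<bar> powr \<gamma> - \<bar>y\<bar> powr \<gamma>"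
proof (cases "\<bar>x\<bar> \<le> \<bar>y\<bar>")
  case True
  have py: "\<bar>y\<bar> powr \<gamma> = \<bar>y\<bar> powr (\<gamma> - 1) * \<bar>y\<bar>" using assms(1) powr_mult_base[of "\<bar>y\<bar>" "\<gamma> - 1"] by (simp add: mult.commute)
  have "\<bar>y\<bar> powr (\<gamma> - 1) * \<bar>x\<bar> \<le> \<bar>x\<bar> powr \<gamma>"
  proof (cases "x = 0")
    case False
    then have "\<bar>x\<bar> powr \<gamma> = \<bar>x\<bar> powr (\<gamma> - 1) * \<bar>x\<bar>" using powr_mult_base[of "\<bar>x\<bar>" "\<gamma> - 1"] by (simp add: mult.commute)
    moreover have "\<bar>y\<bar> powr (\<gamma> - 1) \<le> \<bar>x\<bar> powr (\<gamma> - 1)" using False True assms by (intro powr_mono2') auto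
    ultimately show ?thesis by (simp add: mult_right_mono)
  qed simp
  moreover have "\<bar>y\<bar> powr (\<gamma> - 1) * (\<bar>y\<bar> - \<bar>x\<bar>) \<le> \<bar>y\<bar> powr (\<gamma> - 1) * \<bar>x - y\<bar>"
    by (intro mult_left_mono) auto
  ultimately show ?thesis unfolding py by (simp add: right_diff_distrib)
next
  case False
  then have "\<bar>y\<bar> powr \<gamma> \<le> \<bar>x\<bar> powr \<gamma>" using assms by (intro powr_mono2) auto
  moreover have "0 \<le> \<bar>y\<bar> powr (\<gamma> - 1) * \<bar>x - y\<bar>" by simp
  ultimately show ?thesis by linarith
qed

lemma powr_penalty_derivative:
  fixes y :: real
  assumes "y \<noteq> 0"
  shows "((\<lambda>x. \<bar>x\<bar> powr \<gamma>) has_real_derivative \<gamma> * sgn y * \<bar>y\<bar> powr (\<gamma> - 1)) (at y)"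
proof -
  have der: "((\<lambda>x. (sgn y * x) powr \<gamma>) has_real_derivative \<gamma> * sgn y * \<bar>y\<bar> powr (\<gamma> - 1)) (at y)"
    using assms by (auto intro!: derivative_eq_intros simp: sgn_if mult.commute)
  have ev: "\<forall>\<^sub>F x in nhds y. (sgn y * x) powr \<gamma> = \<bar>x\<bar> powr \<gamma>"
  proof -
    have "\<forall>\<^sub>F x in nhds y. dist x y < \<bar>y\<bar>" unfolding eventually_nhds_metric using assms by (intro exI[of _ "\<bar>y\<bar>"]) auto
    then show ?thesis
      by eventually_elim (use assms in \<open>auto simp: dist_real_def sgn_if abs_if split: if_splits\<close>)
  qed
  show ?thesis by (rule iffD1[OF DERIV_cong_ev[OF refl ev refl] der])
qed

text \<open>Prolong the segment from \<open>u\<close> to \<open>v\<close> by length \<open>R\<close>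
  to a point \<open>z\<close> of the larger ball. Then \<open>v\<close> is a convex combination of
  \<open>u\<close> and \<open>z\<close> with weight d / (R + d) <= d / R on \<open>z\<close>, and
  \<open>f\<close> varies by at most 2M between them.\<close>

lemma convex_lipschitz_step:
  fixes f :: "'a::real_normed_vector \<Rightarrow> real"
  assumes f: "convex_on (cball 0 (2 * R)) f" and M: "\<And>x. norm x \<le> 2 * R \<Longrightarrow> \<bar>f x\<bar> \<le> M" and "0 < R"
    and u: "norm u \<le> R" and v: "norm v \<le> R"
  shows "f v - f u \<le> 2 * M / R * norm (v - u)"
proof (cases "v = u")
  case False
  define d where "d = norm (v - u)"
  have d: "0 < d" using False by (simp add: d_def)
  define z where "z = v + (R / d) *\<^sub>R (v - u)"
  have nz: "norm ((R / d) *\<^sub>R (v - u)) = R" using d \<open>0 < R\<close> by (simp add: d_def)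
  have z: "norm z \<le> 2 * R" using norm_triangle_ineq[of v "(R / d) *\<^sub>R (v - u)"] nz v by (simp add: z_def)
  define t where "t = d / (R + d)"
  have t: "0 \<le> t" "t \<le> 1" using d \<open>0 < R\<close> by (auto simp: t_def)
  have "v = (1 - t) *\<^sub>R u + t *\<^sub>R z"
  proof -
    have "1 + R / d = (R + d) / d" using d by (simp add: field_simps)
    then have "t * (1 + R / d) = 1" unfolding t_def using d \<open>0 < R\<close> by simp
    moreover have "(1 - t) *\<^sub>R u + t *\<^sub>R z = u + (t * (1 + R / d)) *\<^sub>R (v - u)"
      by (simp add: z_def algebra_simps)
    ultimately show ?thesis by simp
  qed
  then have "f v \<le> (1 - t) * f u + t * f z"
    using convex_onD[OF f t, of u z] u z \<open>0 < R\<close> by simp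
  then have "f v - f u \<le> t * (f z - f u)" by (simp add: algebra_simps)
  also have "\<dots> \<le> t * (2 * M)"
    using M[OF z] M[of u] u \<open>0 < R\<close> t by (intro mult_left_mono) (auto simp: abs_le_iff)
  also have "\<dots> \<le> (d / R) * (2 * M)"
  proof -
    have "0 \<le> M" using M[of u] u \<open>0 < R\<close> by fastforce
    moreover have "t \<le> d / R" unfolding t_def using d \<open>0 < R\<close> by (intro divide_left_mono) auto
    ultimately show ?thesis by (intro mult_right_mono) auto
  qed
  finally show ?thesis by (simp add: d_def mult.commute)
qed simp

text \<open>Purely deterministic: \<open>D n\<close> stands for the negative log-likelihood ratio
  without its linear part, and the score becomes a free vector \<open>s\<close>. Conclusions uniform
  over bounded \<open>s\<close> can then be applied to a random score pointwise on an event.\<close>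

locale penalized_quadratic =
  fixes b0 :: "real^'p" and B :: "(real^'p) set" and J :: "real^'p^'p" and D :: "nat \<Rightarrow> real^'p \<Rightarrow> real"
    and \<gamma> \<gamma>\<^sub>0 lam c :: real
  assumes open_B: "open B" and convex_B: "convex B" and b0: "b0 \<in> B"
    and c: "0 < c" and J_ge: "\<And>u. c * (norm u)\<^sup>2 \<le> u \<bullet> (J *v u)" and J_sym: "transpose J = J"
    and D_b0: "\<And>n. D n b0 = 0" and D_convex: "\<And>n. convex_on B (D n)" and D_cont: "\<And>n. continuous_on B (D n)"
    and D_quadratic: "\<And>R e. 0 < e \<Longrightarrow> \<forall>\<^sub>F n in sequentially. \<forall>u. norm u \<le> R \<longrightarrow>
          \<bar>D n (b0 + (1 / sqrt (real n)) *\<^sub>R u) - u \<bullet> (J *v u) / 2\<bar> \<le> e"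
    and \<gamma>: "0 < \<gamma>" "\<gamma> < 1" "\<gamma> < \<gamma>\<^sub>0" "\<gamma>\<^sub>0 \<le> 1" and lam: "0 < lam"
begin

definition scaled :: "nat \<Rightarrow> real^'p \<Rightarrow> real^'p" where
  "scaled n u = b0 + (1 / sqrt (real n)) *\<^sub>R u"

text \<open>The prefactor is n times the tuning parameter, as n n^((gamma0 - 2)/2) = n^(gamma0/2).
  Subtracting the value at \<open>b0\<close> makes the objective vanish there and leaves the
  minimizers unchanged.\<close>

definition penalty :: "nat \<Rightarrow> real^'p \<Rightarrow> real" where
  "penalty n \<beta> = real n powr (\<gamma>\<^sub>0 / 2) * lam * (\<Sum>j\<in>UNIV. \<bar>\<beta> $ j\<bar> powr \<gamma> - \<bar>b0 $ j\<bar> powr \<gamma>)"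

definition objective :: "nat \<Rightarrow> real^'p \<Rightarrow> real^'p \<Rightarrow> real" where
  "objective n s \<beta> = - (s \<bullet> (sqrt (real n) *\<^sub>R (\<beta> - b0))) + D n \<beta> + penalty n \<beta>"

text \<open>The slope of the rescaled penalty at the limit; it survives only in the critical case
  \<open>\<gamma>\<^sub>0 = 1\<close>, where it shifts the limit of the estimator without affecting the expectation of the bias.\<close>

definition shift :: "real^'p" where
  "shift = (\<chi> j. if b0 $ j \<noteq> 0 \<and> \<gamma>\<^sub>0 = 1 then lam * (\<gamma> * sgn (b0 $ j) * \<bar>b0 $ j\<bar> powr (\<gamma> - 1)) else 0)"

definition supported :: "real^'p \<Rightarrow> bool" where
  "supported u \<longleftrightarrow> (\<forall>j. b0 $ j = 0 \<longrightarrow> u $ j = 0)"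

lemma objective_b0: "objective n s b0 = 0"
  by (simp add: objective_def penalty_def D_b0)

lemma scaled_inverse: "1 \<le> n \<Longrightarrow> scaled n (sqrt (real n) *\<^sub>R (\<beta> - b0)) = \<beta>"
  by (simp add: scaled_def)

lemma objective_scaled:
  "1 \<le> n \<Longrightarrow> objective n s (scaled n u) = - (s \<bullet> u) + D n (scaled n u) + penalty n (scaled n u)"
  by (simp add: objective_def scaled_def)

section \<open>Localization of the minimizer near the true parameter\<close>

lemma scaled_in_B: "\<forall>\<^sub>F n in sequentially. \<forall>u. norm u \<le> R \<longrightarrow> scaled n u \<in> B"
proof -
  obtain d where d: "0 < d" "ball b0 d \<subseteq> B" using open_B b0 openE by blast
  have "(\<lambda>n. \<bar>R\<bar> / sqrt (real n)) \<longlonglongrightarrow> 0" by real_asymp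
  then have "\<forall>\<^sub>F n in sequentially. \<bar>R\<bar> / sqrt (real n) < d" using d(1) by (rule order_tendstoD)
  then show ?thesis
  proof eventually_elim
    case (elim n)
    have "norm u / sqrt (real n) < d" if "norm u \<le> R" for u :: "real^'p"
    proof -
      have "norm u / sqrt (real n) \<le> \<bar>R\<bar> / sqrt (real n)" using that by (intro divide_right_mono) auto
      with elim show ?thesis by linarith
    qed
    then show ?case using d(2) by (auto simp: scaled_def dist_norm subset_iff)
  qed
qed

text \<open>The quotient is n^((gamma0 - 1)/2), the weight of a first-order change of an active
  coordinate on the scale 1 / sqrt n.\<close>

lemma rate_le_one: "1 \<le> n \<Longrightarrow> real n powr (\<gamma>\<^sub>0 / 2) / sqrt (real n) \<le> 1"
proof -
  assume "1 \<le> n"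
  then have "real n powr (\<gamma>\<^sub>0 / 2) \<le> real n powr (1 / 2)" using \<gamma> by (intro powr_mono) auto
  then show ?thesis using \<open>1 \<le> n\<close> by (simp add: powr_half_sqrt)
qed

lemma rate_limit: "(\<lambda>n. real n powr (\<gamma>\<^sub>0 / 2) / sqrt (real n)) \<longlonglongrightarrow> (if \<gamma>\<^sub>0 = 1 then 1 else 0)"
proof (cases "\<gamma>\<^sub>0 = 1")
  case True
  have "\<forall>\<^sub>F n in sequentially. real n powr (\<gamma>\<^sub>0 / 2) / sqrt (real n) = 1"
    using eventually_gt_at_top[of 0] by eventually_elim (simp add: True powr_half_sqrt)
  then show ?thesis using True by (simp add: tendsto_eventually)
next
  case False
  then have "(\<gamma>\<^sub>0 - 1) / 2 < 0" using \<gamma> by simp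
  then have "(\<lambda>n. real n powr ((\<gamma>\<^sub>0 - 1) / 2)) \<longlonglongrightarrow> 0"
    by (intro tendsto_neg_powr filterlim_real_sequentially)
  moreover have "\<forall>\<^sub>F n in sequentially. real n powr ((\<gamma>\<^sub>0 - 1) / 2) = real n powr (\<gamma>\<^sub>0 / 2) / sqrt (real n)"
    using eventually_gt_at_top[of 0] by eventually_elim (simp add: powr_half_sqrt[symmetric] powr_diff[symmetric] diff_divide_distrib)
  ultimately show ?thesis using False by (auto intro: Lim_transform_eventually)
qed

definition penalty_slope :: real where
  "penalty_slope = lam * (\<Sum>j\<in>UNIV. if b0 $ j = 0 then 0 else \<bar>b0 $ j\<bar> powr (\<gamma> - 1))"

text \<open>Inactive coordinates can only raise the penalty. An active one lowers it by at most its
  chord slope times the displacement |u| / sqrt n, and the rate bound removes the dependence on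
  \<open>n\<close>.\<close>

lemma penalty_lower_bound:
  assumes "1 \<le> n"
  shows "- (penalty_slope * norm u) \<le> penalty n (scaled n u)"
proof -
  let ?r = "real n powr (\<gamma>\<^sub>0 / 2)"
  let ?m = "\<lambda>j. if b0 $ j = 0 then 0 else \<bar>b0 $ j\<bar> powr (\<gamma> - 1)"
  have tm: "- (?m j * (norm u / sqrt (real n))) \<le> \<bar>scaled n u $ j\<bar> powr \<gamma> - \<bar>b0 $ j\<bar> powr \<gamma>" for j
  proof (cases "b0 $ j = 0")
    case False
    have "\<bar>scaled n u $ j - b0 $ j\<bar> \<le> norm u / sqrt (real n)"
      using component_le_norm_cart[of u j] by (simp add: scaled_def abs_mult divide_right_mono)
    then have "\<bar>b0 $ j\<bar> powr (\<gamma> - 1) * \<bar>scaled n u $ j - b0 $ j\<bar> \<le> \<bar>b0 $ j\<bar> powr (\<gamma> - 1) * (norm u / sqrt (real n))"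
      by (rule mult_left_mono) simp
    with powr_penalty_lower_bound[OF False \<gamma>(1,2), of "scaled n u $ j"] False show ?thesis by simp
  qed simp
  have "penalty_slope * norm u * (?r / sqrt (real n)) \<le> penalty_slope * norm u * 1"
    using rate_le_one[OF assms] lam by (intro mult_left_mono) (auto simp: penalty_slope_def intro!: mult_nonneg_nonneg sum_nonneg)
  then have "- (penalty_slope * norm u) \<le> - (penalty_slope * norm u * (?r / sqrt (real n)))" by simp
  also have "\<dots> = ?r * lam * (\<Sum>j\<in>UNIV. - (?m j * (norm u / sqrt (real n))))"
  proof -
    have "(\<Sum>j\<in>UNIV. - (?m j * (norm u / sqrt (real n)))) = - ((\<Sum>j\<in>UNIV. ?m j) * (norm u / sqrt (real n)))"
      by (simp only: sum_negf sum_distrib_right)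
    then show ?thesis unfolding penalty_slope_def by (simp only: mult_minus_right times_divide_eq_right times_divide_eq_left mult_ac)
  qed
  also have "\<dots> \<le> penalty n (scaled n u)"
    unfolding penalty_def using lam by (intro mult_left_mono sum_mono tm) auto
  finally show ?thesis .
qed

text \<open>\<open>D n\<close> is convex and vanishes at \<open>b0\<close>, so its quadratic lower
  bound on the sphere of radius \<open>R\<close> propagates along rays to a bound linear in |u|. Its
  slope exceeds those of the score term and of the penalty together.\<close>

lemma objective_positive_outside:
  "\<exists>R\<ge>1. \<forall>\<^sub>F n in sequentially. \<forall>s u. norm s \<le> K \<longrightarrow> R \<le> norm u \<longrightarrow> scaled n u \<in> B \<longrightarrow> 0 < objective n s (scaled n u)"
proof -
  \<comment> \<open>Makes c R / 2 at least |K| + penalty_slope + 1. The surplus 1 covers the 1/2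
    lost in the quadratic approximation; the last summand gives R >= 1.\<close>
  define R where "R = 2 / c * (\<bar>K\<bar> + penalty_slope + 1) + 1"
  have ps: "0 \<le> penalty_slope" using lam by (auto simp: penalty_slope_def intro!: mult_nonneg_nonneg sum_nonneg)
  have R1: "1 \<le> R" using c ps by (simp add: R_def)
  have Rc: "\<bar>K\<bar> + penalty_slope + 1 \<le> c * R / 2" using c by (simp add: R_def field_simps)
  have "\<forall>\<^sub>F n in sequentially. \<forall>u. norm u \<le> R \<longrightarrow>
          \<bar>D n (b0 + (1 / sqrt (real n)) *\<^sub>R u) - u \<bullet> (J *v u) / 2\<bar> \<le> 1 / 2"
    by (rule D_quadratic) simp
  then have "\<forall>\<^sub>F n in sequentially. \<forall>s u. norm s \<le> K \<longrightarrow> R \<le> norm u \<longrightarrow> scaled n u \<in> B \<longrightarrow> 0 < objective n s (scaled n u)"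
    using eventually_ge_at_top[of 1]
  proof eventually_elim
    case (elim n)
    show ?case
    proof (intro allI impI)
      fix s u :: "real^'p"
      assume s: "norm s \<le> K" and u: "R \<le> norm u" and uB: "scaled n u \<in> B"
      define t where "t = R / norm u"
      have nu: "0 < norm u" using u R1 by linarith
      have t: "0 < t" "t \<le> 1" using u R1 nu by (auto simp: t_def)
      have "norm (t *\<^sub>R u) = R" using nu R1 by (simp add: t_def)
      then have "(t *\<^sub>R u) \<bullet> (J *v (t *\<^sub>R u)) / 2 - 1 / 2 \<le> D n (scaled n (t *\<^sub>R u))"
        using elim(1)[rule_format, OF eq_refl[OF \<open>norm (t *\<^sub>R u) = R\<close>]] unfolding scaled_def by linarith
      moreover have "c * R\<^sup>2 \<le> (t *\<^sub>R u) \<bullet> (J *v (t *\<^sub>R u))"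
        using J_ge[of "t *\<^sub>R u"] \<open>norm (t *\<^sub>R u) = R\<close> by simp
      ultimately have "c * R\<^sup>2 / 2 - 1 / 2 \<le> D n (scaled n (t *\<^sub>R u))" by linarith
      also have "scaled n (t *\<^sub>R u) = (1 - t) *\<^sub>R b0 + t *\<^sub>R scaled n u"
        by (simp add: scaled_def algebra_simps)
      also have "D n \<dots> \<le> (1 - t) * D n b0 + t * D n (scaled n u)"
        using convex_onD[OF D_convex, of t b0 "scaled n u"] t b0 uB by simp
      finally have "c * R\<^sup>2 / 2 - 1 / 2 \<le> R / norm u * D n (scaled n u)" by (simp add: D_b0 t_def)
      then have "norm u * (c * R\<^sup>2 / 2 - 1 / 2) \<le> R * D n (scaled n u)"
        using nu by (simp add: field_simps)
      moreover have "R * (norm u * (c * R / 2 - 1 / 2)) \<le> norm u * (c * R\<^sup>2 / 2 - 1 / 2)"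
      proof -
        have "R * (c * R / 2 - 1 / 2) \<le> c * R\<^sup>2 / 2 - 1 / 2" using R1 by (simp add: power2_eq_square algebra_simps)
        then have "norm u * (R * (c * R / 2 - 1 / 2)) \<le> norm u * (c * R\<^sup>2 / 2 - 1 / 2)" by (rule mult_left_mono) simp
        then show ?thesis by (simp add: mult.left_commute)
      qed
      ultimately have "R * (norm u * (c * R / 2 - 1 / 2)) \<le> R * D n (scaled n u)" by linarith
      then have D: "norm u * (c * R / 2 - 1 / 2) \<le> D n (scaled n u)" using R1 by (subst (asm) mult_le_cancel_left_pos) auto
      have "s \<bullet> u \<le> norm s * norm u" by (rule norm_cauchy_schwarz)
      also have "\<dots> \<le> \<bar>K\<bar> * norm u" using s by (intro mult_right_mono) auto
      finally have su: "s \<bullet> u \<le> \<bar>K\<bar> * norm u" .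
      have "0 < norm u * (c * R / 2 - 1 / 2 - \<bar>K\<bar> - penalty_slope)"
        using nu Rc by (intro mult_pos_pos) auto
      also have "\<dots> \<le> objective n s (scaled n u)"
        unfolding objective_scaled[OF elim(2)] using D su penalty_lower_bound[OF elim(2), of u]
        by (simp add: algebra_simps)
      finally show "0 < objective n s (scaled n u)" .
    qed
  qed
  with R1 show ?thesis by blast
qed

text \<open>On \<open>supported\<close> vectors the inactive coordinates contribute nothing, and
  every active one starts at a point where the power is differentiable.\<close>

lemma penalty_expansion:
  assumes "0 < e"
  shows "\<forall>\<^sub>F n in sequentially. \<forall>u. norm u \<le> R \<longrightarrow> supported u \<longrightarrow> \<bar>penalty n (scaled n u) - shift \<bullet> u\<bar> \<le> e"
proof -
  define e' where "e' = e / CARD('p)"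
  have e': "0 < e'" using assms by (simp add: e'_def)
  define T where "T n j x = real n powr (\<gamma>\<^sub>0 / 2) * lam * (\<bar>b0 $ j + x / sqrt (real n)\<bar> powr \<gamma> - \<bar>b0 $ j\<bar> powr \<gamma>)" for n j x
  have comp: "\<forall>\<^sub>F n in sequentially. \<forall>x. \<bar>x\<bar> \<le> R \<longrightarrow> \<bar>T n j x - shift $ j * x\<bar> \<le> e'" if bj: "b0 $ j \<noteq> 0" for j
  proof -
    let ?f = "\<lambda>x::real. \<bar>x\<bar> powr \<gamma>"
    define f' where "f' = \<gamma> * sgn (b0 $ j) * \<bar>b0 $ j\<bar> powr (\<gamma> - 1)"
    define k where "k n = real n powr (\<gamma>\<^sub>0 / 2) / sqrt (real n)" for n
    define k0 where "k0 = (if \<gamma>\<^sub>0 = 1 then 1 else 0 :: real)"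
    \<comment> \<open>The error allowed to the linear approximation of the power. Multiplied by
      \<open>lam\<close> and by |R| + 1 it uses up half of \<open>e'\<close>; the summand 1 keeps
      the denominator positive.\<close>
    define \<eta> where "\<eta> = e' / (2 * lam * (\<bar>R\<bar> + 1))"
    have \<eta>: "0 < \<eta>" using e' lam by (simp add: \<eta>_def)
    have sh: "shift $ j = lam * f' * k0" using bj by (simp add: shift_def f'_def k0_def)
    have "(?f has_derivative (*) f') (at (b0 $ j))"
      using powr_penalty_derivative[OF bj] unfolding has_field_derivative_def f'_def .
    then obtain \<delta> where \<delta>: "0 < \<delta>" "\<And>y. \<bar>y - b0 $ j\<bar> < \<delta> \<Longrightarrow> \<bar>?f y - ?f (b0 $ j) - f' * (y - b0 $ j)\<bar> \<le> \<eta> * \<bar>y - b0 $ j\<bar>"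
      using \<eta> unfolding has_derivative_at_alt real_norm_def by blast
    have "(\<lambda>n. \<bar>R\<bar> / sqrt (real n)) \<longlonglongrightarrow> 0" by real_asymp
    then have "\<forall>\<^sub>F n in sequentially. \<bar>R\<bar> / sqrt (real n) < \<delta>" using \<delta>(1) by (rule order_tendstoD)
    moreover have "(\<lambda>n. \<bar>k n - k0\<bar> * (lam * \<bar>f'\<bar> * \<bar>R\<bar>)) \<longlonglongrightarrow> \<bar>k0 - k0\<bar> * (lam * \<bar>f'\<bar> * \<bar>R\<bar>)"
      using rate_limit unfolding k_def k0_def by (intro tendsto_intros)
    then have "\<forall>\<^sub>F n in sequentially. \<bar>k n - k0\<bar> * (lam * \<bar>f'\<bar> * \<bar>R\<bar>) < e' / 2"
      using e' by (intro order_tendstoD(2)) auto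
    ultimately show ?thesis using eventually_ge_at_top[of 1]
    proof eventually_elim
      case (elim n)
      show ?case
      proof (intro allI impI)
        fix x :: real assume x: "\<bar>x\<bar> \<le> R"
        let ?h = "x / sqrt (real n)"
        have ah: "\<bar>?h\<bar> = \<bar>x\<bar> / sqrt (real n)" by simp
        have "\<bar>x\<bar> / sqrt (real n) \<le> \<bar>R\<bar> / sqrt (real n)" using x by (intro divide_right_mono) auto
        then have "\<bar>?h\<bar> < \<delta>" using elim(1) ah by linarith
        then have d: "\<bar>?f (b0 $ j + ?h) - ?f (b0 $ j) - f' * ?h\<bar> \<le> \<eta> * \<bar>?h\<bar>" using \<delta>(2)[of "b0 $ j + ?h"] by simp
        have k1: "0 \<le> k n" "k n \<le> 1" using rate_le_one[OF elim(3)] by (auto simp: k_def)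
        have rk: "real n powr (\<gamma>\<^sub>0 / 2) * ?h = k n * x" by (simp add: k_def)
        let ?T = "real n powr (\<gamma>\<^sub>0 / 2) * lam * (?f (b0 $ j + ?h) - ?f (b0 $ j) - f' * ?h)"
        \<comment> \<open>The first term is the linearization error, the second the deviation of the
          rate \<open>k n\<close> from its limit \<open>k0\<close>.\<close>
        have split: "T n j x - shift $ j * x = ?T + (k n - k0) * (lam * f' * x)"
        proof -
          have "real n powr (\<gamma>\<^sub>0 / 2) * lam * (f' * ?h) = lam * f' * (real n powr (\<gamma>\<^sub>0 / 2) * ?h)" by (simp add: mult_ac)
          then show ?thesis unfolding rk by (simp add: T_def sh algebra_simps)
        qed
        have "\<bar>?T\<bar> \<le> real n powr (\<gamma>\<^sub>0 / 2) * lam * (\<eta> * \<bar>?h\<bar>)"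
        proof -
          have nn: "0 \<le> real n powr (\<gamma>\<^sub>0 / 2) * lam" using lam by simp
          show ?thesis unfolding abs_mult[of "real n powr (\<gamma>\<^sub>0 / 2) * lam"] abs_of_nonneg[OF nn] by (rule mult_left_mono[OF d nn])
        qed
        also have "\<dots> = lam * \<eta> * \<bar>real n powr (\<gamma>\<^sub>0 / 2) * ?h\<bar>" by (simp add: abs_mult)
        also have "\<dots> = lam * \<eta> * (k n * \<bar>x\<bar>)" unfolding rk using k1 by (simp add: abs_mult)
        also have "\<dots> \<le> lam * \<eta> * (1 * (\<bar>R\<bar> + 1))" using k1 x lam \<eta> by (intro mult_left_mono mult_mono) auto
        also have "\<dots> = e' / 2"
        proof -
          have "lam * (e' / (2 * lam * r)) * (1 * r) = e' / 2" if "0 < r" for r using lam that by simp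
          then show ?thesis unfolding \<eta>_def by simp
        qed
        finally have p1: "\<bar>?T\<bar> \<le> e' / 2" .
        have "\<bar>(k n - k0) * (lam * f' * x)\<bar> = \<bar>k n - k0\<bar> * (lam * \<bar>f'\<bar> * \<bar>x\<bar>)" using lam by (simp add: abs_mult)
        also have "\<dots> \<le> \<bar>k n - k0\<bar> * (lam * \<bar>f'\<bar> * \<bar>R\<bar>)" using x lam by (intro mult_left_mono) auto
        finally have p2: "\<bar>(k n - k0) * (lam * f' * x)\<bar> \<le> e' / 2" using elim(2) by (rule order.trans[OF _ less_imp_le])
        show "\<bar>T n j x - shift $ j * x\<bar> \<le> e'"
          unfolding split using order.trans[OF abs_triangle_ineq add_mono[OF p1 p2]] by (simp only: field_sum_of_halves)
      qed
    qed
  qed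
  have "\<forall>\<^sub>F n in sequentially. \<forall>j. b0 $ j \<noteq> 0 \<longrightarrow> (\<forall>x. \<bar>x\<bar> \<le> R \<longrightarrow> \<bar>T n j x - shift $ j * x\<bar> \<le> e')"
  proof (rule eventually_all_finite)
    show "\<forall>\<^sub>F n in sequentially. b0 $ j \<noteq> 0 \<longrightarrow> (\<forall>x. \<bar>x\<bar> \<le> R \<longrightarrow> \<bar>T n j x - shift $ j * x\<bar> \<le> e')" for j
      using comp[of j] by (cases "b0 $ j = 0") simp_all
  qed
  then show ?thesis
  proof eventually_elim
    case (elim n)
    show ?case
    proof (intro allI impI)
      fix u assume u: "norm u \<le> R" and su: "supported u"
      have "\<bar>T n j (u $ j) - shift $ j * u $ j\<bar> \<le> e'" for j
      proof (cases "b0 $ j = 0")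
        case True
        then have "u $ j = 0" using su by (simp add: supported_def)
        then show ?thesis using e' True \<gamma>(1) by (simp add: T_def)
      next
        case False
        have "\<bar>u $ j\<bar> \<le> R" using component_le_norm_cart[of u j] u by linarith
        with False elim show ?thesis by blast
      qed
      then have "(\<Sum>j\<in>UNIV. \<bar>T n j (u $ j) - shift $ j * u $ j\<bar>) \<le> (\<Sum>j\<in>(UNIV :: 'p set). e')" by (intro sum_mono)
      also have "\<dots> = e" by (simp add: e'_def)
      finally have "\<bar>\<Sum>j\<in>UNIV. T n j (u $ j) - shift $ j * u $ j\<bar> \<le> e"
        using sum_abs[of "\<lambda>j. T n j (u $ j) - shift $ j * u $ j" UNIV] by linarith
      moreover have "(\<Sum>j\<in>UNIV. T n j (u $ j) - shift $ j * u $ j) = penalty n (scaled n u) - shift \<bullet> u"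
        by (simp add: T_def penalty_def scaled_def inner_vec_def sum_subtractf sum_distrib_left[symmetric])
      ultimately show "\<bar>penalty n (scaled n u) - shift \<bullet> u\<bar> \<le> e" by simp
    qed
  qed
qed

text \<open>Compare \<open>u\<close> with the vector obtained by deleting its inactive coordinates.
  For |x| <= R one has |x|^gamma >= R^(gamma - 1) |x|, so the saved penalty is at least a diverging
  multiple of the l1 distance, while the remaining terms change by at most \<open>L\<close> times
  it. Both sides are linear in the distance, which is why it is exactly zero and not merely
  small.\<close>

lemma inactive_vanish:
  assumes "1 \<le> R"
  shows "\<forall>\<^sub>F n in sequentially. \<forall>s u. norm s \<le> K \<longrightarrow> norm u \<le> R \<longrightarrow>
    (\<forall>v. norm v \<le> R \<longrightarrow> objective n s (scaled n u) \<le> objective n s (scaled n v)) \<longrightarrow> supported u"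
proof -
  have R: "0 < R" using assms by simp
  obtain K0 where K0: "\<And>x. norm (J *v x) \<le> norm x * K0" "0 < K0"
    using bounded_linear.pos_bounded[OF matrix_vector_mul_bounded_linear[of J]] by blast
  \<comment> \<open>\<open>M\<close> bounds \<open>D n\<close> on the ball of radius 2R, as the
    Lipschitz estimate on radius \<open>R\<close> requires; \<open>L\<close> adds the slope of the
    score term to the resulting constant.\<close>
  define M where "M = (2 * R)\<^sup>2 * K0 / 2 + 1"
  define L where "L = \<bar>K\<bar> + 2 * M / R"
  have J_le: "\<bar>x \<bullet> (J *v x)\<bar> \<le> (2 * R)\<^sup>2 * K0" if "norm x \<le> 2 * R" for x
  proof -
    have "\<bar>x \<bullet> (J *v x)\<bar> \<le> norm x * norm (J *v x)" by (rule Cauchy_Schwarz_ineq2)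
    also have "\<dots> \<le> norm x * (norm x * K0)" by (intro mult_left_mono K0) simp
    also have "\<dots> = (norm x)\<^sup>2 * K0" by (simp add: power2_eq_square)
    also have "\<dots> \<le> (2 * R)\<^sup>2 * K0" using that K0(2) by (intro mult_right_mono power_mono) auto
    finally show ?thesis .
  qed
  have "filterlim (\<lambda>n. real n powr ((\<gamma>\<^sub>0 - \<gamma>) / 2)) at_top sequentially"
  proof -
    have "0 < (\<gamma>\<^sub>0 - \<gamma>) / 2" using \<gamma> by simp
    then show ?thesis by real_asymp
  qed
  then have "\<forall>\<^sub>F n in sequentially. L / (lam * R powr (\<gamma> - 1)) < real n powr ((\<gamma>\<^sub>0 - \<gamma>) / 2)"
    by (simp add: filterlim_at_top_dense)
  moreover have "\<forall>\<^sub>F n in sequentially. \<forall>u. norm u \<le> 2 * R \<longrightarrow>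
          \<bar>D n (b0 + (1 / sqrt (real n)) *\<^sub>R u) - u \<bullet> (J *v u) / 2\<bar> \<le> 1"
    by (rule D_quadratic) simp
  ultimately show ?thesis using scaled_in_B[of "2 * R"] eventually_ge_at_top[of 1]
  proof eventually_elim
    case (elim n)
    let ?f = "\<lambda>u. D n (scaled n u)"
    have cvx: "convex_on (cball 0 (2 * R)) ?f"
    proof (rule convex_onI)
      fix t :: real and x y :: "real^'p" assume t: "0 < t" "t < 1" and xy: "x \<in> cball 0 (2 * R)" "y \<in> cball 0 (2 * R)"
      have "scaled n ((1 - t) *\<^sub>R x + t *\<^sub>R y) = (1 - t) *\<^sub>R scaled n x + t *\<^sub>R scaled n y"
        by (simp add: vec_eq_iff scaled_def algebra_simps add_divide_distrib diff_divide_distrib)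
      then show "?f ((1 - t) *\<^sub>R x + t *\<^sub>R y) \<le> (1 - t) * ?f x + t * ?f y"
        using convex_onD[OF D_convex, of t "scaled n x" "scaled n y"] elim(3) xy t by simp
    qed simp
    have bnd: "\<bar>?f x\<bar> \<le> M" if "norm x \<le> 2 * R" for x
      using elim(2)[rule_format, OF that] J_le[OF that] unfolding M_def scaled_def by linarith
    show ?case
    proof (intro allI impI)
      fix s u :: "real^'p" assume s: "norm s \<le> K" and u: "norm u \<le> R"
        and opt: "\<forall>v. norm v \<le> R \<longrightarrow> objective n s (scaled n u) \<le> objective n s (scaled n v)"
      define v where "v = (\<chi> j. if b0 $ j = 0 then 0 else u $ j)"
      have "norm v \<le> norm u" by (intro norm_le_componentwise_cart) (simp add: v_def)
      then have v: "norm v \<le> R" using u by linarith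
      let ?g = "real n powr ((\<gamma>\<^sub>0 - \<gamma>) / 2)"
      let ?l = "\<Sum>j\<in>UNIV. \<bar>u $ j - v $ j\<bar>"
      have tm: "R powr (\<gamma> - 1) * \<bar>u $ j - v $ j\<bar> * ?g \<le> real n powr (\<gamma>\<^sub>0 / 2) * (\<bar>scaled n u $ j\<bar> powr \<gamma> - \<bar>scaled n v $ j\<bar> powr \<gamma>)" for j
      proof (cases "b0 $ j = 0 \<and> u $ j \<noteq> 0")
        case True
        let ?x = "\<bar>u $ j\<bar>"
        have x: "0 < ?x" "?x \<le> R" using True component_le_norm_cart[of u j] u by auto
        have "R powr (\<gamma> - 1) \<le> ?x powr (\<gamma> - 1)" using x \<gamma> by (intro powr_mono2') auto
        then have "R powr (\<gamma> - 1) * ?x \<le> ?x powr (\<gamma> - 1) * ?x" by (rule mult_right_mono) simp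
        also have "\<dots> = ?x powr \<gamma>" using powr_mult_base[of ?x "\<gamma> - 1"] x by (simp add: mult.commute)
        finally have "R powr (\<gamma> - 1) * ?x * ?g \<le> ?x powr \<gamma> * ?g" by (rule mult_right_mono) simp
        \<comment> \<open>The scale 1 / sqrt n enters here: n^(gamma0/2) (x / sqrt n)^gamma =
          n^((gamma0 - gamma)/2) x^gamma.\<close>
        also have "\<dots> = real n powr (\<gamma>\<^sub>0 / 2) * (?x / sqrt (real n)) powr \<gamma>"
          using elim(4) x by (simp add: powr_divide powr_half_sqrt[symmetric] powr_powr powr_diff diff_divide_distrib)
        also have "(?x / sqrt (real n)) = \<bar>scaled n u $ j\<bar>" using True by (simp add: scaled_def)
        finally show ?thesis using True \<gamma>(1) by (simp add: v_def scaled_def)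
      next
        case False
        then have "u $ j = v $ j" by (auto simp: v_def)
        then show ?thesis by (simp add: scaled_def)
      qed
      have "lam * R powr (\<gamma> - 1) * ?g * ?l = lam * (\<Sum>j\<in>UNIV. R powr (\<gamma> - 1) * \<bar>u $ j - v $ j\<bar> * ?g)"
        by (simp add: sum_distrib_left mult_ac)
      also have "\<dots> \<le> lam * (\<Sum>j\<in>UNIV. real n powr (\<gamma>\<^sub>0 / 2) * (\<bar>scaled n u $ j\<bar> powr \<gamma> - \<bar>scaled n v $ j\<bar> powr \<gamma>))"
        using lam by (intro mult_left_mono sum_mono tm) auto
      also have "\<dots> = penalty n (scaled n u) - penalty n (scaled n v)"
        by (simp add: penalty_def sum_subtractf sum_distrib_left[symmetric] right_diff_distrib mult_ac)
      also have "\<dots> \<le> s \<bullet> (u - v) + (?f v - ?f u)"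
        using opt[rule_format, OF v] unfolding objective_scaled[OF elim(4)] by (simp add: inner_diff_right)
      also have "\<dots> \<le> L * norm (u - v)"
      proof -
        have "s \<bullet> (u - v) \<le> norm s * norm (u - v)" by (rule norm_cauchy_schwarz)
        also have "\<dots> \<le> \<bar>K\<bar> * norm (u - v)" using s by (intro mult_right_mono) auto
        finally show ?thesis
          using convex_lipschitz_step[OF cvx bnd R u v] by (simp add: L_def distrib_right norm_minus_commute)
      qed
      also have "\<dots> \<le> L * ?l"
      proof -
        have "0 \<le> M" using K0(2) by (simp add: M_def)
        then have "0 \<le> L" using R by (simp add: L_def)
        then show ?thesis using norm_le_l1_cart[of "u - v"] by (intro mult_left_mono) auto
      qed
      finally have le: "lam * R powr (\<gamma> - 1) * ?g * ?l \<le> L * ?l" .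
      have pos: "0 < lam * R powr (\<gamma> - 1)" using lam R by simp
      have "L < lam * R powr (\<gamma> - 1) * ?g" using elim(1) pos by (simp add: pos_divide_less_eq mult.commute)
      then have "\<not> 0 < ?l" using le by (metis mult_le_cancel_right_pos not_le)
      moreover have "0 \<le> ?l" by (simp add: sum_nonneg)
      ultimately have "?l = 0" by linarith
      then have "u $ j = v $ j" for j by (simp add: sum_nonneg_eq_0_iff)
      then have "u $ j = (if b0 $ j = 0 then 0 else u $ j)" for j unfolding v_def vec_lambda_beta .
      then show "supported u" unfolding supported_def by presburger
    qed
  qed
qed

text \<open>The second assumption is the normal equation for minimizing u . Ju / 2 - u . (s - shift)
  over supported vectors. Testing it with \<open>w\<close> itself gives the bound.\<close>

lemma restricted_minimizer_norm:
  assumes "supported w" "\<And>x. supported x \<Longrightarrow> x \<bullet> (s - shift) = w \<bullet> (J *v x)"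
  shows "norm w \<le> norm (s - shift) / c"
proof -
  have "c * (norm w)\<^sup>2 \<le> w \<bullet> (s - shift)" using J_ge[of w] assms by simp
  also have "\<dots> \<le> norm w * norm (s - shift)" by (rule norm_cauchy_schwarz)
  finally have "norm w * (c * norm w) \<le> norm w * norm (s - shift)" by (simp add: power2_eq_square mult_ac)
  then have "c * norm w \<le> norm (s - shift)"
    by (cases "norm w = 0") (simp_all add: mult_le_cancel_left_pos)
  then show ?thesis using c by (simp add: field_simps)
qed

text \<open>The limit \<open>w s\<close> enters through its normal equation alone. Strong convexity
  of the quadratic turns nearly equal values into nearby points.\<close>

theorem minimizer_asymptotics:
  assumes "0 < e"
    and w: "\<And>s. supported (w s)" "\<And>s x. supported x \<Longrightarrow> x \<bullet> (s - shift) = w s \<bullet> (J *v x)"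
  shows "\<forall>\<^sub>F n in sequentially. \<forall>s. norm s \<le> K \<longrightarrow>
    (\<exists>\<beta>. is_arg_min (objective n s) (\<lambda>\<beta>. \<beta> \<in> B) \<beta>) \<and>
    (\<forall>\<beta>. is_arg_min (objective n s) (\<lambda>\<beta>. \<beta> \<in> B) \<beta> \<longrightarrow>
      active_set \<beta> = active_set b0 \<and> norm (sqrt (real n) *\<^sub>R (\<beta> - b0) - w s) \<le> e)"
proof -
  obtain R1 where R1: "1 \<le> R1" and outside: "\<forall>\<^sub>F n in sequentially. \<forall>s u. norm s \<le> K \<longrightarrow> R1 \<le> norm u \<longrightarrow>
      scaled n u \<in> B \<longrightarrow> 0 < objective n s (scaled n u)"
    using objective_positive_outside by blast
  define R where "R = max R1 ((\<bar>K\<bar> + norm shift) / c)"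
  have R: "1 \<le> R" "R1 \<le> R" using R1 by (auto simp: R_def)
  \<comment> \<open>The approximations of \<open>D n\<close> and of the penalty are each used at
    \<open>u\<close> and at \<open>w s\<close>, so the values differ by at most 4 \<epsilon>. Strong
    convexity bounds c/2 times the squared distance by 4 \<epsilon>, that is the distance by
    \<open>e\<close>.\<close>
  define \<epsilon> where "\<epsilon> = c * e\<^sup>2 / 8"
  have \<epsilon>: "0 < \<epsilon>" using c \<open>0 < e\<close> by (simp add: \<epsilon>_def)
  have w_norm: "norm (w s) \<le> R" if "norm s \<le> K" for s
  proof -
    have "norm (w s) \<le> norm (s - shift) / c" by (rule restricted_minimizer_norm[OF w])
    also have "\<dots> \<le> (\<bar>K\<bar> + norm shift) / c"
      using c norm_triangle_ineq4[of s shift] that by (intro divide_right_mono) auto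
    finally show ?thesis by (simp add: R_def)
  qed
  \<comment> \<open>Active coordinates move by at most R / sqrt n and thus cannot reach
    zero.\<close>
  have "\<forall>\<^sub>F n in sequentially. \<forall>j. b0 $ j \<noteq> 0 \<longrightarrow> R / sqrt (real n) < \<bar>b0 $ j\<bar>"
  proof (rule eventually_all_finite)
    fix j
    have "(\<lambda>n. R / sqrt (real n)) \<longlonglongrightarrow> 0" by real_asymp
    then have "\<forall>\<^sub>F n in sequentially. R / sqrt (real n) < \<bar>b0 $ j\<bar>" if "b0 $ j \<noteq> 0"
      using that by (intro order_tendstoD(2)) auto
    then show "\<forall>\<^sub>F n in sequentially. b0 $ j \<noteq> 0 \<longrightarrow> R / sqrt (real n) < \<bar>b0 $ j\<bar>"
      by (cases "b0 $ j = 0") simp_all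
  qed
  with outside inactive_vanish[OF R(1), of K] D_quadratic[OF \<epsilon>, of R] penalty_expansion[OF \<epsilon>, of R]
    scaled_in_B[of R] eventually_ge_at_top[of 1]
  show ?thesis
  proof eventually_elim
    case (elim n)
    note out = elim(1) and vanish = elim(2) and quad = elim(3) and pen = elim(4) and inB = elim(5) and n = elim(6) and act = elim(7)
    show ?case
    proof (intro allI impI)
      fix s :: "real^'p" assume s: "norm s \<le> K"
      have cont: "continuous_on (cball 0 R) (\<lambda>u. objective n s (scaled n u))"
      proof -
        have sc: "continuous_on (cball 0 R) (scaled n)" unfolding scaled_def by (intro continuous_intros)
        have "continuous_on (cball 0 R) (\<lambda>u. D n (scaled n u))"
          by (rule continuous_on_compose2[OF D_cont sc]) (use inB in auto)
        moreover have "continuous_on (cball 0 R) (\<lambda>u. penalty n (scaled n u))"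
          unfolding penalty_def
          by (intro continuous_on_mult_left continuous_on_sum continuous_on_diff continuous_on_const
              continuous_on_powr' continuous_on_rabs continuous_on_component sc) (use \<gamma>(1) in auto)
        ultimately show ?thesis
          unfolding objective_scaled[OF n] by (intro continuous_intros)
      qed
      obtain u0 where u0: "norm u0 \<le> R" "\<And>v. norm v \<le> R \<Longrightarrow> objective n s (scaled n u0) \<le> objective n s (scaled n v)"
        using continuous_attains_inf[OF compact_cball _ cont] R(1) by (auto simp: Ball_def)
      have far: "0 < objective n s \<beta>" if "\<beta> \<in> B" "R < norm (sqrt (real n) *\<^sub>R (\<beta> - b0))" for \<beta>
        using out[rule_format, OF s, of "sqrt (real n) *\<^sub>R (\<beta> - b0)"] that R(2) unfolding scaled_inverse[OF n] by linarith
      \<comment> \<open>Zero is the value at \<open>b0\<close>, and the objective is positive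
        outside the ball. So the minimum over the compact ball is a minimum over all of
        \<open>B\<close>.\<close>
      have "objective n s (scaled n u0) \<le> 0"
        using u0(2)[of 0] R(1) objective_b0[of n s] by (simp add: scaled_def)
      then have glob: "objective n s (scaled n u0) \<le> objective n s \<beta>" if "\<beta> \<in> B" for \<beta>
        using far[OF that] u0(2)[of "sqrt (real n) *\<^sub>R (\<beta> - b0)"] unfolding scaled_inverse[OF n] by linarith
      have ex: "is_arg_min (objective n s) (\<lambda>\<beta>. \<beta> \<in> B) (scaled n u0)"
        using glob inB u0(1) unfolding is_arg_min_def by (meson not_le)
      have "active_set \<beta> = active_set b0 \<and> norm (sqrt (real n) *\<^sub>R (\<beta> - b0) - w s) \<le> e"
        if \<beta>: "is_arg_min (objective n s) (\<lambda>\<beta>. \<beta> \<in> B) \<beta>" for \<beta>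
      proof -
        have \<beta>B: "\<beta> \<in> B" and opt: "\<And>\<beta>'. \<beta>' \<in> B \<Longrightarrow> objective n s \<beta> \<le> objective n s \<beta>'"
          using \<beta> unfolding is_arg_min_def by (auto simp: not_less)
        define u where "u = sqrt (real n) *\<^sub>R (\<beta> - b0)"
        have \<beta>u: "\<beta> = scaled n u" unfolding u_def scaled_inverse[OF n] ..
        have "objective n s \<beta> \<le> 0" using opt[OF b0] objective_b0 by simp
        then have u: "norm u \<le> R" using far[OF \<beta>B] unfolding u_def by linarith
        have optu: "objective n s (scaled n u) \<le> objective n s (scaled n v)" if "norm v \<le> R" for v
          using opt[of "scaled n v"] inB that \<beta>u by blast
        have su: "supported u" using vanish[rule_format, OF s u] optu by blast
        have "active_set \<beta> = active_set b0"
        proof -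
          have "\<beta> $ j \<noteq> 0 \<longleftrightarrow> b0 $ j \<noteq> 0" for j
          proof (cases "b0 $ j = 0")
            case True
            then show ?thesis using su by (simp add: \<beta>u scaled_def supported_def)
          next
            case False
            have "\<bar>u $ j / sqrt (real n)\<bar> \<le> R / sqrt (real n)"
              using component_le_norm_cart[of u j] u by (simp add: divide_right_mono)
            then have "\<bar>u $ j / sqrt (real n)\<bar> < \<bar>b0 $ j\<bar>" using act False by fastforce
            then have "b0 $ j + u $ j / sqrt (real n) \<noteq> 0" by linarith
            then show ?thesis using False by (simp add: \<beta>u scaled_def)
          qed
          then show ?thesis by (simp add: active_set_def)
        qed
        moreover have "norm (u - w s) \<le> e"
        proof -
          let ?w = "w s"
          let ?Q = "\<lambda>x. x \<bullet> (J *v x) / 2"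
          have wR: "norm ?w \<le> R" by (rule w_norm[OF s])
          have "- (s \<bullet> u) + ?Q u + shift \<bullet> u - 2 * \<epsilon> \<le> objective n s (scaled n u)"
            using quad[rule_format, OF u] pen[rule_format, OF u su] unfolding objective_scaled[OF n]
            unfolding scaled_def by linarith
          also have "\<dots> \<le> objective n s (scaled n ?w)" by (rule optu[OF wR])
          also have "\<dots> \<le> - (s \<bullet> ?w) + ?Q ?w + shift \<bullet> ?w + 2 * \<epsilon>"
            using quad[rule_format, OF wR] pen[rule_format, OF wR w(1)] unfolding objective_scaled[OF n]
            unfolding scaled_def by linarith
          finally have le: "?Q u - u \<bullet> (s - shift) \<le> ?Q ?w - ?w \<bullet> (s - shift) + 4 * \<epsilon>"
            by (simp add: inner_diff_right inner_commute)
          have sym: "?w \<bullet> (J *v u) = u \<bullet> (J *v ?w)"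
            by (metis J_sym dot_lmul_matrix inner_commute transpose_matrix_vector)
          \<comment> \<open>The normal equation, tested with \<open>u\<close> and with
            \<open>w s\<close>, replaces both linear terms, so the excess value is exactly half the
            quadratic form of the difference.\<close>
          have "(u - ?w) \<bullet> (J *v (u - ?w)) / 2 = (?Q u - u \<bullet> (s - shift)) - (?Q ?w - ?w \<bullet> (s - shift))"
          proof -
            have "(u - ?w) \<bullet> (J *v (u - ?w)) = u \<bullet> (J *v u) - 2 * (?w \<bullet> (J *v u)) + ?w \<bullet> (J *v ?w)"
              by (simp add: matrix_vector_mult_diff_distrib inner_diff_left inner_diff_right sym)
            then show ?thesis unfolding w(2)[OF su] w(2)[OF w(1)] by simp
          qed
          then have "c * (norm (u - ?w))\<^sup>2 \<le> 8 * \<epsilon>" using le J_ge[of "u - ?w"] by linarith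
          then have "(norm (u - ?w))\<^sup>2 \<le> e\<^sup>2" using c by (simp add: \<epsilon>_def)
          then show ?thesis by (rule power2_le_imp_le[OF _ less_imp_le[OF \<open>0 < e\<close>]])
        qed
        ultimately show ?thesis by (simp add: u_def)
      qed
      with ex show "(\<exists>\<beta>. is_arg_min (objective n s) (\<lambda>\<beta>. \<beta> \<in> B) \<beta>) \<and>
        (\<forall>\<beta>. is_arg_min (objective n s) (\<lambda>\<beta>. \<beta> \<in> B) \<beta> \<longrightarrow>
          active_set \<beta> = active_set b0 \<and> norm (sqrt (real n) *\<^sub>R (\<beta> - b0) - w s) \<le> e)"
        by blast
    qed
  qed
qed

end

section \<open>Quadratic approximation of the log-likelihood\<close>

text \<open>The norm of this matrix type is the Frobenius norm; the estimate is Cauchy-Schwarz in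
  each row.\<close>

lemma norm_matrix_vector_le: "norm (A *v x) \<le> norm A * norm x" for A :: "real^'n^'m"
proof -
  have "norm (A *v x) = L2_set (\<lambda>i. norm (A $ i \<bullet> x)) UNIV"
    by (simp add: norm_vec_def matrix_vector_mul_component)
  also have "\<dots> \<le> L2_set (\<lambda>i. norm (A $ i) * norm x) UNIV"
    by (intro L2_set_mono) (auto simp: Cauchy_Schwarz_ineq2)
  also have "\<dots> = norm A * norm x"
    by (simp add: norm_vec_def[of A] L2_set_left_distrib)
  finally show ?thesis .
qed

lemma inner_matrix_vector_le: "\<bar>x \<bullet> (A *v x)\<bar> \<le> norm A * (norm x)\<^sup>2" for A :: "real^'n^'n"
proof -
  have "\<bar>x \<bullet> (A *v x)\<bar> \<le> norm x * norm (A *v x)" by (rule Cauchy_Schwarz_ineq2)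
  also have "\<dots> \<le> norm x * (norm A * norm x)" by (intro mult_left_mono norm_matrix_vector_le) simp
  finally show ?thesis by (simp add: power2_eq_square mult_ac)
qed

lemma inner_transpose_matrix_vector: "u \<bullet> (transpose A *v w) = (A *v u) \<bullet> w" for A :: "real^'n^'m"
  by (metis dot_lmul_matrix inner_commute transpose_matrix_vector)

text \<open>By homogeneity the constant is the minimum of the form on the compact unit
  sphere.\<close>

lemma positive_definite_lower_bound:
  fixes A :: "real^'n^'n"
  assumes "positive_definite A"
  obtains c where "0 < c" "\<And>u. c * (norm u)\<^sup>2 \<le> u \<bullet> (A *v u)"
proof -
  let ?S = "sphere 0 1 :: (real^'n) set"
  have "axis undefined 1 \<in> ?S" by simp
  moreover have "continuous_on ?S (\<lambda>u. u \<bullet> (A *v u))"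
    by (intro continuous_intros linear_continuous_on matrix_vector_mul_bounded_linear)
  ultimately obtain v where v: "v \<in> ?S" "\<And>u. u \<in> ?S \<Longrightarrow> v \<bullet> (A *v v) \<le> u \<bullet> (A *v u)"
    using continuous_attains_inf[of ?S "\<lambda>u. u \<bullet> (A *v u)"] by (metis compact_sphere empty_iff)
  have "v \<noteq> 0" using v(1) by auto
  then have pos: "0 < v \<bullet> (A *v v)" using assms unfolding positive_definite_def by blast
  have "v \<bullet> (A *v v) * (norm u)\<^sup>2 \<le> u \<bullet> (A *v u)" for u
  proof (cases "u = 0")
    case False
    let ?e = "(1 / norm u) *\<^sub>R u"
    have "v \<bullet> (A *v v) \<le> ?e \<bullet> (A *v ?e)" using False by (intro v(2)) simp
    also have "\<dots> = (u \<bullet> (A *v u)) / (norm u)\<^sup>2"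
      by (simp add: matrix_vector_mult_scaleR power2_eq_square)
    finally show ?thesis using False by (simp add: pos_le_divide_eq)
  qed simp
  with pos show thesis by (rule that)
qed

locale regression_design = exponential_family \<nu> b for \<nu> :: "(real^'r) measure" and b +
  fixes \<X> :: "(real^'p^'r) set" and X :: "nat \<Rightarrow> real^'p^'r" and B :: "(real^'p) set"
    and b0 :: "real^'p" and J :: "real^'p^'p"
  assumes open_B: "open B" and convex_B: "convex B" and b0: "b0 \<in> B" and X: "\<And>i. X i \<in> \<X>"
    and compact_\<X>: "compact \<X>" and in_domain: "\<And>X \<beta>. X \<in> \<X> \<Longrightarrow> \<beta> \<in> B \<Longrightarrow> X *v \<beta> \<in> domain"
    and covariance_nonneg: "\<And>\<theta> v. \<theta> \<in> domain \<Longrightarrow> 0 \<le> v \<bullet> (covariance \<theta> *v v)"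
    and information_limit: "(\<lambda>n. (1 / real n) *\<^sub>R (\<Sum>i<n. information \<nu> b b0 (X i))) \<longlonglongrightarrow> J"
begin

text \<open>A sum of Bregman divergences of the cumulant function between the predictors at
  \<open>\<beta>\<close> and at \<open>b0\<close>. The observations appear only in the linear part
  of the log-likelihood ratio, hence not here.\<close>

definition D :: "nat \<Rightarrow> real^'p \<Rightarrow> real" where
  "D n \<beta> = (\<Sum>i<n. cumulant \<nu> b (X i *v \<beta>) - cumulant \<nu> b (X i *v b0) - mean (X i *v b0) \<bullet> (X i *v (\<beta> - b0)))"

definition avg_information :: "nat \<Rightarrow> real^'p^'p" where
  "avg_information n = (1 / real n) *\<^sub>R (\<Sum>i<n. information \<nu> b b0 (X i))"

lemma information_quadratic_form:
  "u \<bullet> (information \<nu> b b0 (X i) *v v) = (X i *v u) \<bullet> (covariance (X i *v b0) *v (X i *v v))"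
proof -
  have "information \<nu> b b0 (X i) *v v = transpose (X i) *v (covariance (X i *v b0) *v (X i *v v))"
    using hessian_cumulant[OF in_domain[OF X b0]]
    by (simp add: information_def matrix_vector_mul_assoc matrix_mul_assoc)
  also have "u \<bullet> \<dots> = (X i *v u) \<bullet> (covariance (X i *v b0) *v (X i *v v))"
    by (rule inner_transpose_matrix_vector)
  finally show ?thesis .
qed

lemma avg_information_quadratic_form:
  "v \<bullet> (avg_information n *v v) = (\<Sum>i<n. (X i *v v) \<bullet> (covariance (X i *v b0) *v (X i *v v))) / real n"
proof -
  have "(\<Sum>i<n. information \<nu> b b0 (X i)) *v v = (\<Sum>i<n. information \<nu> b b0 (X i) *v v)"
    by (induction n) (simp_all add: matrix_vector_mult_add_rdistrib)
  then have "avg_information n *v v = (1 / real n) *\<^sub>R (\<Sum>i<n. information \<nu> b b0 (X i) *v v)"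
    by (simp add: avg_information_def scaleR_matrix_vector_assoc[symmetric])
  then show ?thesis by (simp add: inner_sum_right information_quadratic_form)
qed

section \<open>Taylor expansion and convexity of the cumulant function along segments\<close>

lemma line_derivatives:
  assumes "\<theta> + t *\<^sub>R v \<in> domain"
  shows "((\<lambda>t. cumulant \<nu> b (\<theta> + t *\<^sub>R v)) has_real_derivative mean (\<theta> + t *\<^sub>R v) \<bullet> v) (at t)"
    and "((\<lambda>t. mean (\<theta> + t *\<^sub>R v) \<bullet> v) has_real_derivative v \<bullet> (covariance (\<theta> + t *\<^sub>R v) *v v)) (at t)"
proof -
  have line: "((\<lambda>t. \<theta> + t *\<^sub>R v) has_derivative (\<lambda>h. h *\<^sub>R v)) (at t)"
    by (auto intro!: derivative_eq_intros)
  have "((\<lambda>t. cumulant \<nu> b (\<theta> + t *\<^sub>R v)) has_derivative (\<lambda>h. mean (\<theta> + t *\<^sub>R v) \<bullet> (h *\<^sub>R v))) (at t)"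
    using has_derivative_compose[OF line cumulant_has_derivative[OF assms]] .
  then show "((\<lambda>t. cumulant \<nu> b (\<theta> + t *\<^sub>R v)) has_real_derivative mean (\<theta> + t *\<^sub>R v) \<bullet> v) (at t)"
    by (simp add: has_field_derivative_def mult_commute_abs)
  have "((\<lambda>t. mean (\<theta> + t *\<^sub>R v)) has_derivative (\<lambda>h. covariance (\<theta> + t *\<^sub>R v) *v (h *\<^sub>R v))) (at t)"
    using has_derivative_compose[OF line mean_has_derivative[OF assms]] .
  then have "((\<lambda>t. mean (\<theta> + t *\<^sub>R v) \<bullet> v) has_derivative (\<lambda>h. (covariance (\<theta> + t *\<^sub>R v) *v (h *\<^sub>R v)) \<bullet> v)) (at t)"
    by (rule has_derivative_inner_left)
  then show "((\<lambda>t. mean (\<theta> + t *\<^sub>R v) \<bullet> v) has_real_derivative v \<bullet> (covariance (\<theta> + t *\<^sub>R v) *v v)) (at t)"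
    by (simp add: has_field_derivative_def matrix_vector_mult_scaleR inner_commute mult_commute_abs)
qed

text \<open>The Lagrange remainder keeps the second derivative at an intermediate point, so uniform
  continuity of \<open>covariance\<close> on a compact set controls the error.\<close>

lemma cumulant_taylor:
  assumes seg: "\<And>t. 0 \<le> t \<Longrightarrow> t \<le> 1 \<Longrightarrow> \<theta> + t *\<^sub>R v \<in> domain"
  obtains t where "0 < t" "t < 1"
    "cumulant \<nu> b (\<theta> + v) = cumulant \<nu> b \<theta> + mean \<theta> \<bullet> v + v \<bullet> (covariance (\<theta> + t *\<^sub>R v) *v v) / 2"
proof -
  define diff where "diff m t = (if m = 0 then cumulant \<nu> b (\<theta> + t *\<^sub>R v) else if m = 1 then mean (\<theta> + t *\<^sub>R v) \<bullet> v
     else v \<bullet> (covariance (\<theta> + t *\<^sub>R v) *v v))" for m :: nat and t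
  have "\<exists>t::real. 0 < t \<and> t < 1 \<and> diff 0 1 = (\<Sum>m<2. (diff m 0 / fact m) * 1 ^ m) + (diff 2 t / fact 2) * 1 ^ 2"
  proof (rule Maclaurin[of _ _ diff])
    show "\<forall>m t. m < 2 \<and> 0 \<le> t \<and> t \<le> 1 \<longrightarrow> DERIV (diff m) t :> diff (Suc m) t"
    proof (intro allI impI, elim conjE)
      fix m :: nat and t :: real assume "m < 2" "0 \<le> t" "t \<le> 1"
      then consider "m = 0" | "m = 1" by linarith
      then show "DERIV (diff m) t :> diff (Suc m) t"
        using line_derivatives[OF seg[OF \<open>0 \<le> t\<close> \<open>t \<le> 1\<close>]] by cases (simp_all add: diff_def[abs_def])
    qed
  qed simp_all
  then show thesis using that by (auto simp: diff_def numeral_2_eq_2)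
qed

lemma cumulant_convex: "convex_on B (\<lambda>\<beta>. cumulant \<nu> b (X i *v \<beta>))"
proof (rule convex_onI)
  fix t :: real and x y :: "real^'p" assume t: "0 < t" "t < 1" and x: "x \<in> B" and y: "y \<in> B"
  let ?\<theta> = "X i *v x" and ?v = "X i *v (y - x)"
  have line: "?\<theta> + s *\<^sub>R ?v = X i *v ((1 - s) *\<^sub>R x + s *\<^sub>R y)" for s
    by (simp add: matrix_vector_right_distrib matrix_vector_mult_diff_distrib matrix_vector_mult_scaleR algebra_simps)
  have dom: "?\<theta> + s *\<^sub>R ?v \<in> domain" if "s \<in> {0..1}" for s
    unfolding line using that x y by (intro in_domain X convexD[OF convex_B]) auto
  have "convex_on {0..1} (\<lambda>s. cumulant \<nu> b (?\<theta> + s *\<^sub>R ?v))"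
    by (rule f''_ge0_imp_convex[OF _ line_derivatives[OF dom] covariance_nonneg[OF dom]]) auto
  from convex_onD[OF this, of t 0 1] t
  show "cumulant \<nu> b (X i *v ((1 - t) *\<^sub>R x + t *\<^sub>R y)) \<le> (1 - t) * cumulant \<nu> b (X i *v x) + t * cumulant \<nu> b (X i *v y)"
    unfolding line by simp
qed (rule convex_B)

lemma D_b0: "D n b0 = 0"
  by (simp add: D_def)

lemma D_convex: "convex_on B (D n)"
proof (rule convex_onI)
  fix t :: real and x y :: "real^'p" assume t: "0 < t" "t < 1" and x: "x \<in> B" and y: "y \<in> B"
  let ?d = "\<lambda>i \<beta>. cumulant \<nu> b (X i *v \<beta>) - cumulant \<nu> b (X i *v b0) - mean (X i *v b0) \<bullet> (X i *v (\<beta> - b0))"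
  have "?d i ((1 - t) *\<^sub>R x + t *\<^sub>R y) \<le> (1 - t) * ?d i x + t * ?d i y" for i
    using convex_onD[OF cumulant_convex[of i], of t x y] t x y
    by (simp add: matrix_vector_right_distrib matrix_vector_mult_diff_distrib matrix_vector_mult_scaleR
        inner_diff_right inner_add_right algebra_simps)
  then show "D n ((1 - t) *\<^sub>R x + t *\<^sub>R y) \<le> (1 - t) * D n x + t * D n y"
    unfolding D_def sum_distrib_left sum.distrib[symmetric] by (rule sum_mono)
qed (rule convex_B)

lemma D_continuous: "continuous_on B (D n)"
proof -
  have cum: "continuous_on domain (cumulant \<nu> b)"
    using cumulant_has_derivative has_derivative_continuous continuous_at_imp_continuous_on by blast
  have lin: "continuous_on B (\<lambda>\<beta>. X i *v (f \<beta>))" if "continuous_on B f" for i and f :: "real^'p \<Rightarrow> real^'p"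
    by (rule bounded_linear.continuous_on[OF matrix_vector_mul_bounded_linear that])
  have "continuous_on B (\<lambda>\<beta>. cumulant \<nu> b (X i *v \<beta>))" for i
    by (rule continuous_on_compose2[OF cum lin[OF continuous_on_id]]) (use in_domain X in auto)
  then show ?thesis unfolding D_def by (intro continuous_intros lin)
qed

lemma design_bounded: obtains C where "0 \<le> C" "\<And>i u. norm (X i *v u) \<le> C * norm u"
proof -
  obtain C where C: "\<forall>A\<in>\<X>. norm A \<le> C" using compact_imp_bounded[OF compact_\<X>] bounded_iff by blast
  have "0 \<le> C" using C X norm_ge_zero order.trans by blast
  moreover have "norm (X i *v u) \<le> C * norm u" for i u
    by (rule order.trans[OF norm_matrix_vector_le]) (use C X in \<open>auto intro: mult_right_mono\<close>)
  ultimately show thesis by (rule that)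
qed

lemma design_image_compact: "compact ((\<lambda>A. A *v b0) ` \<X>)" "(\<lambda>A. A *v b0) ` \<X> \<subseteq> domain"
proof -
  have "continuous_on \<X> (\<lambda>A. A *v b0)"
    by (auto intro!: continuous_intros simp: matrix_vector_mult_def)
  then show "compact ((\<lambda>A. A *v b0) ` \<X>)" "(\<lambda>A. A *v b0) ` \<X> \<subseteq> domain"
    using compact_\<X> in_domain b0 by (auto intro: compact_continuous_image)
qed

text \<open>Two errors receive e/2 each: the covariance at an intermediate point against the one at
  the true predictor, uniform in \<open>i\<close> by compactness of the design, and the averaged
  information against its limit \<open>J\<close>.\<close>

lemma D_quadratic:
  assumes "0 < e"
  shows "\<forall>\<^sub>F n in sequentially. \<forall>u. norm u \<le> R \<longrightarrow>
    \<bar>D n (b0 + (1 / sqrt (real n)) *\<^sub>R u) - u \<bullet> (J *v u) / 2\<bar> \<le> e"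
proof -
  obtain C where C: "0 \<le> C" "\<And>i u. norm (X i *v u) \<le> C * norm u" using design_bounded by blast
  let ?K = "(\<lambda>A. A *v b0) ` \<X>"
  note K = design_image_compact
  obtain \<delta> where \<delta>: "0 < \<delta>" "\<And>x y :: real^'r. x \<in> ?K \<Longrightarrow> norm y \<le> \<delta> \<Longrightarrow> x + y \<in> domain"
  proof (cases "domain = UNIV")
    case False
    have "\<exists>d>0. \<forall>x\<in>?K. \<forall>y\<in>- domain. d \<le> dist x y"
      by (rule separate_compact_closed) (use K in auto)
    then obtain d where d: "0 < d" "\<And>x y. x \<in> ?K \<Longrightarrow> y \<notin> domain \<Longrightarrow> d \<le> dist x y" by auto
    show thesis
    proof (rule that[of "d / 2"])
      fix x y :: "real^'r" assume "x \<in> ?K" "norm y \<le> d / 2"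
      then show "x + y \<in> domain" using d(1) d(2)[of x "x + y"] by (fastforce simp: dist_norm)
    qed (use d in auto)
  qed (use that[of 1] in auto)
  \<comment> \<open>A compact neighbourhood, inside the domain, of the predictors at
    \<open>b0\<close>. It contains the intermediate points for large \<open>n\<close>, so one
    modulus of continuity serves all \<open>i\<close>.\<close>
  let ?K' = "{x + y |x y. x \<in> ?K \<and> y \<in> cball 0 \<delta>}"
  have K': "compact ?K'" by (rule compact_sums[OF K(1) compact_cball])
  have K'd: "?K' \<subseteq> domain" using \<delta>(2) by auto
  have uc: "uniformly_continuous_on ?K' covariance"
    by (rule compact_uniformly_continuous[OF continuous_on_subset[OF covariance_continuous K'd] K'])
  \<comment> \<open>One summand errs by at most \<eta> (C |R|)^2 / (2n), so n of them by at most
    e/2; the summand 1 avoids division by zero.\<close>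
  define \<eta> where "\<eta> = e / (C * \<bar>R\<bar> + 1)\<^sup>2"
  have CR: "0 < (C * \<bar>R\<bar> + 1)\<^sup>2" using C(1) by (intro zero_less_power add_nonneg_pos) auto
  have \<eta>: "0 < \<eta>" using \<open>0 < e\<close> CR by (simp add: \<eta>_def)
  obtain \<delta>' where \<delta>': "0 < \<delta>'" "\<And>x y. x \<in> ?K' \<Longrightarrow> y \<in> ?K' \<Longrightarrow> norm (y - x) < \<delta>' \<Longrightarrow> norm (covariance y - covariance x) < \<eta>"
  proof -
    obtain d where "0 < d" "\<forall>x\<in>?K'. \<forall>x'\<in>?K'. dist x' x < d \<longrightarrow> dist (covariance x') (covariance x) < \<eta>"
      using uc[unfolded uniformly_continuous_on_def, rule_format, OF \<eta>] by blast
    then show thesis unfolding dist_norm by (intro that[of d]) blast+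
  qed
  have "(\<lambda>n. C * \<bar>R\<bar> / sqrt (real n)) \<longlonglongrightarrow> 0" by real_asymp
  then have ev1: "\<forall>\<^sub>F n in sequentially. C * \<bar>R\<bar> / sqrt (real n) < min \<delta> \<delta>'"
    using \<delta>(1) \<delta>'(1) by (intro order_tendstoD(2)) auto
  have "(\<lambda>n. norm (avg_information n - J) * R\<^sup>2) \<longlonglongrightarrow> norm (J - J) * R\<^sup>2"
    using information_limit unfolding avg_information_def by (intro tendsto_intros)
  then have ev2: "\<forall>\<^sub>F n in sequentially. norm (avg_information n - J) * R\<^sup>2 < e"
    using \<open>0 < e\<close> by (intro order_tendstoD(2)) auto
  show ?thesis using ev1 ev2 eventually_ge_at_top[of 1]
  proof eventually_elim
    case (elim n)
    show ?case
    proof (intro allI impI)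
      fix u :: "real^'p" assume u: "norm u \<le> R"
      define v where "v = (1 / sqrt (real n)) *\<^sub>R u"
      have nv: "norm (X i *v v) \<le> C * \<bar>R\<bar> / sqrt (real n)" for i
      proof -
        have "norm (X i *v v) \<le> C * norm v" by (rule C(2))
        also have "\<dots> = C * norm u / sqrt (real n)" by (simp add: v_def)
        also have "\<dots> \<le> C * \<bar>R\<bar> / sqrt (real n)" using u C(1) by (intro divide_right_mono mult_left_mono) auto
        finally show ?thesis .
      qed
      let ?q = "\<lambda>i. (X i *v v) \<bullet> (covariance (X i *v b0) *v (X i *v v)) / 2"
      let ?d = "\<lambda>i. cumulant \<nu> b (X i *v (b0 + v)) - cumulant \<nu> b (X i *v b0) - mean (X i *v b0) \<bullet> (X i *v (b0 + v - b0))"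
      have tm: "\<bar>?d i - ?q i\<bar> \<le> e / 2 / real n" for i
      proof -
        let ?\<theta> = "X i *v b0" and ?x = "X i *v v"
        have \<theta>: "?\<theta> \<in> ?K" using X by auto
        have small: "norm (t *\<^sub>R ?x) < min \<delta> \<delta>'" if "0 \<le> t" "t \<le> 1" for t
        proof -
          have "norm (t *\<^sub>R ?x) \<le> norm ?x" using that by (simp add: mult_left_le_one_le)
          then show ?thesis using nv[of i] elim(1) by linarith
        qed
        have dom: "?\<theta> + t *\<^sub>R ?x \<in> domain" if "0 \<le> t" "t \<le> 1" for t
          using \<delta>(2)[OF \<theta>] small[OF that] by simp
        obtain t where t: "0 < t" "t < 1" "cumulant \<nu> b (?\<theta> + ?x) = cumulant \<nu> b ?\<theta> + mean ?\<theta> \<bullet> ?x + ?x \<bullet> (covariance (?\<theta> + t *\<^sub>R ?x) *v ?x) / 2"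
          using cumulant_taylor[OF dom] by blast
        have st: "norm (t *\<^sub>R ?x) < min \<delta> \<delta>'" using t by (intro small) auto
        have "?\<theta> + t *\<^sub>R ?x \<in> ?K'" using \<theta> st by (intro CollectI exI[of _ ?\<theta>] exI[of _ "t *\<^sub>R ?x"]) auto
        moreover have "?\<theta> \<in> ?K'" using \<theta> \<delta>(1) by (intro CollectI exI[of _ ?\<theta>] exI[of _ 0]) auto
        ultimately have cv: "norm (covariance (?\<theta> + t *\<^sub>R ?x) - covariance ?\<theta>) < \<eta>"
          using st by (intro \<delta>'(2)) auto
        have "?d i - ?q i = ?x \<bullet> ((covariance (?\<theta> + t *\<^sub>R ?x) - covariance ?\<theta>) *v ?x) / 2"
          using t(3) by (simp add: matrix_vector_right_distrib matrix_vector_mult_diff_rdistrib inner_diff_right)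
        also have "\<bar>\<dots>\<bar> \<le> norm (covariance (?\<theta> + t *\<^sub>R ?x) - covariance ?\<theta>) * (norm ?x)\<^sup>2 / 2"
          using inner_matrix_vector_le by simp
        also have "\<dots> \<le> \<eta> * (C * \<bar>R\<bar> / sqrt (real n))\<^sup>2 / 2"
          using cv nv[of i] \<eta> by (intro divide_right_mono mult_mono power_mono) auto
        also have "\<dots> = \<eta> * (C * \<bar>R\<bar>)\<^sup>2 / 2 / real n" by (simp add: power_divide)
        also have "\<dots> \<le> \<eta> * (C * \<bar>R\<bar> + 1)\<^sup>2 / 2 / real n"
          using \<eta> C(1) by (intro divide_right_mono mult_left_mono power_mono) auto
        also have "\<eta> * (C * \<bar>R\<bar> + 1)\<^sup>2 = e" using CR by (simp add: \<eta>_def)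
        finally show ?thesis .
      qed
      have "\<bar>D n (b0 + v) - (\<Sum>i<n. ?q i)\<bar> \<le> (\<Sum>i<n. \<bar>?d i - ?q i\<bar>)"
        unfolding D_def sum_subtractf[symmetric] by (rule sum_abs)
      also have "\<dots> \<le> (\<Sum>i<n. e / 2 / real n)" by (intro sum_mono tm)
      also have "\<dots> = e / 2" using elim(3) by simp
      finally have 1: "\<bar>D n (b0 + v) - (\<Sum>i<n. ?q i)\<bar> \<le> e / 2" .
      have "(\<Sum>i<n. ?q i) = u \<bullet> (avg_information n *v u) / 2"
        using elim(3) unfolding avg_information_quadratic_form
        by (simp add: v_def matrix_vector_mult_scaleR sum_divide_distrib mult.commute)
      moreover have "\<bar>u \<bullet> (avg_information n *v u) / 2 - u \<bullet> (J *v u) / 2\<bar> \<le> e / 2"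
      proof -
        have "\<bar>u \<bullet> ((avg_information n - J) *v u)\<bar> \<le> norm (avg_information n - J) * (norm u)\<^sup>2"
          by (rule inner_matrix_vector_le)
        also have "\<dots> \<le> norm (avg_information n - J) * R\<^sup>2" using u by (intro mult_left_mono power_mono) auto
        finally have "\<bar>u \<bullet> ((avg_information n - J) *v u)\<bar> \<le> e" using elim(2) by linarith
        then show ?thesis by (simp add: matrix_vector_mult_diff_rdistrib inner_diff_right diff_divide_distrib[symmetric])
      qed
      ultimately show "\<bar>D n (b0 + (1 / sqrt (real n)) *\<^sub>R u) - u \<bullet> (J *v u) / 2\<bar> \<le> e"
        using 1 unfolding v_def by linarith
    qed
  qed
qed

end

section \<open>Score vectors\<close>

locale random_regression = regression_design \<nu> b \<X> X B b0 J + prob_space M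
  for \<nu> :: "(real^'r) measure" and b and \<X> :: "(real^'p^'r) set" and X B b0 J and M :: "'w measure" +
  fixes Y Y' :: "nat \<Rightarrow> 'w \<Rightarrow> real^'r"
  assumes J: "positive_definite J"
    and indep_Y: "indep_vars (\<lambda>_. borel) Y UNIV"
    and distributed_Y: "\<And>i. distributed M \<nu> (Y i) (\<lambda>y. ennreal (expfam_density \<nu> b (X i *v b0) y))"
    and measurable_Y': "\<And>i. Y' i \<in> borel_measurable M"
    and copy_distr: "\<And>n. distr M (Pi\<^sub>M {..<n} (\<lambda>_. borel)) (\<lambda>\<omega>. \<lambda>i\<in>{..<n}. Y' i \<omega>) =
             distr M (Pi\<^sub>M {..<n} (\<lambda>_. borel)) (\<lambda>\<omega>. \<lambda>i\<in>{..<n}. Y i \<omega>)"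
    and copy_indep: "\<And>n. indep_var
             (Pi\<^sub>M {..<n} (\<lambda>_. borel)) (\<lambda>\<omega>. \<lambda>i\<in>{..<n}. Y i \<omega>)
             (Pi\<^sub>M {..<n} (\<lambda>_. borel)) (\<lambda>\<omega>. \<lambda>i\<in>{..<n}. Y' i \<omega>)"
begin

text \<open>A function of a plain sequence, measurable on the finite product space, so that
  independence and equality in law of data and copy pass to their scores by composition.\<close>

definition score :: "nat \<Rightarrow> (nat \<Rightarrow> real^'r) \<Rightarrow> real^'p" where
  "score n y = (1 / sqrt (real n)) *\<^sub>R (\<Sum>i<n. transpose (X i) *v (y i - mean (X i *v b0)))"

definition S :: "nat \<Rightarrow> 'w \<Rightarrow> real^'p" where "S n \<omega> = score n (\<lambda>i. Y i \<omega>)"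
definition S' :: "nat \<Rightarrow> 'w \<Rightarrow> real^'p" where "S' n \<omega> = score n (\<lambda>i. Y' i \<omega>)"

lemma inner_score: "v \<bullet> score n y = (\<Sum>i<n. (X i *v v) \<bullet> (y i - mean (X i *v b0))) / sqrt (real n)"
  by (simp add: score_def inner_sum_right inner_transpose_matrix_vector del: transpose_matrix_vector)

lemma score_restrict: "score n (\<lambda>i\<in>{..<n}. y i) = score n y"
  by (simp add: score_def)

lemma measurable_matrix_vector [measurable (raw)]:
  fixes A :: "real^'n^'m"
  assumes "f \<in> borel_measurable N"
  shows "(\<lambda>x. A *v f x) \<in> borel_measurable N"
  by (rule borel_measurable_continuous_on[OF linear_continuous_on[OF matrix_vector_mul_bounded_linear] assms])

lemma measurable_Y: "Y i \<in> borel_measurable M"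
  using indep_Y by (simp add: indep_vars_def)

lemma score_measurable: "score n \<in> borel_measurable (Pi\<^sub>M {..<n} (\<lambda>_. borel))"
proof -
  have "(\<lambda>y. y i) \<in> borel_measurable (Pi\<^sub>M {..<n} (\<lambda>_. borel :: (real^'r) measure))" if "i < n" for i
    using measurable_component_singleton[of i "{..<n}" "\<lambda>_. borel"] that by simp
  then have "(\<lambda>y. \<Sum>i<n. transpose (X i) *v (y i - mean (X i *v b0))) \<in> borel_measurable (Pi\<^sub>M {..<n} (\<lambda>_. borel))"
    by (intro borel_measurable_sum measurable_matrix_vector borel_measurable_diff borel_measurable_const) auto
  then show ?thesis unfolding score_def[abs_def] by (intro borel_measurable_scaleR borel_measurable_const)
qed

section \<open>Independence and equality in law of the two scores\<close>

lemma S_eq: "S n = score n \<circ> (\<lambda>\<omega>. \<lambda>i\<in>{..<n}. Y i \<omega>)" and S'_eq: "S' n = score n \<circ> (\<lambda>\<omega>. \<lambda>i\<in>{..<n}. Y' i \<omega>)"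
  by (auto simp: S_def S'_def score_restrict)

lemma S_indep: "indep_var borel (S n) borel (S' n)"
  unfolding S_eq S'_eq by (rule indep_var_compose[OF copy_indep score_measurable score_measurable])

lemma S_measurable [measurable]: "S n \<in> borel_measurable M" and S'_measurable [measurable]: "S' n \<in> borel_measurable M"
  using S_indep[of n] by (auto dest: indep_var_rv1 indep_var_rv2)

lemma S'_distr: "distr M borel (S' n) = distr M borel (S n)"
proof -
  have "(\<lambda>\<omega>. \<lambda>i\<in>{..<n}. Y i \<omega>) \<in> M \<rightarrow>\<^sub>M Pi\<^sub>M {..<n} (\<lambda>_. borel)" "(\<lambda>\<omega>. \<lambda>i\<in>{..<n}. Y' i \<omega>) \<in> M \<rightarrow>\<^sub>M Pi\<^sub>M {..<n} (\<lambda>_. borel)"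
    using measurable_Y measurable_Y' by (auto intro!: measurable_restrict)
  then show ?thesis
    unfolding S_eq S'_eq using copy_distr[of n] distr_distr[OF score_measurable[of n]] by metis
qed

text \<open>The Cramer-Wold device: in a direction \<open>v\<close> the score is a normalized sum of
  independent real variables.\<close>

definition residual :: "real^'p \<Rightarrow> nat \<Rightarrow> 'w \<Rightarrow> real" where
  "residual v i \<omega> = (X i *v v) \<bullet> (Y i \<omega> - mean (X i *v b0))"

lemma residual_indep: "indep_vars (\<lambda>_. borel) (residual v) UNIV"
  unfolding residual_def[abs_def]
  by (rule indep_vars_compose2[OF indep_Y, of "\<lambda>i y. (X i *v v) \<bullet> (y - mean (X i *v b0))"]) measurable

lemmas residual_moments = directional_moments[OF in_domain[OF X b0] prob_space_axioms distributed_Y,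
    of "X i *v v" i for i v, folded residual_def]

lemma inner_S: "v \<bullet> S n \<omega> = (\<Sum>i<n. residual v i \<omega>) / sqrt (real n)"
  by (simp add: S_def inner_score residual_def)

lemma residual_third_moment:
  obtains C where "\<And>i. integrable M (\<lambda>\<omega>. \<bar>residual v i \<omega>\<bar> ^ 3)" "\<And>i. expectation (\<lambda>\<omega>. \<bar>residual v i \<omega>\<bar> ^ 3) \<le> C"
proof -
  obtain A where A: "0 \<le> A" "\<And>i u. norm (X i *v u) \<le> A * norm u" using design_bounded by blast
  obtain C where C: "\<And>\<theta>. \<theta> \<in> (\<lambda>A. A *v b0) ` \<X> \<Longrightarrow> moment (\<lambda>y. norm y ^ 3) \<theta> / moment (\<lambda>_. 1) \<theta> + norm (mean \<theta>) ^ 3 \<le> C"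
    using third_moment_bounded[OF design_image_compact] by blast
  have T: "integrable M (\<lambda>\<omega>. \<bar>residual v i \<omega>\<bar> ^ 3)" 
    "expectation (\<lambda>\<omega>. \<bar>residual v i \<omega>\<bar> ^ 3) \<le> 8 * norm (X i *v v) ^ 3 *
       (moment (\<lambda>y. norm y ^ 3) (X i *v b0) / moment (\<lambda>_. 1) (X i *v b0) + norm (mean (X i *v b0)) ^ 3)" for i
    unfolding residual_def
    by (rule directional_third_moment[OF in_domain[OF X b0] prob_space_axioms distributed_Y])+
  have "expectation (\<lambda>\<omega>. \<bar>residual v i \<omega>\<bar> ^ 3) \<le> 8 * (A * norm v) ^ 3 * \<bar>C\<bar>" for i
  proof (rule order.trans[OF T(2)])
    have "moment (\<lambda>y. norm y ^ 3) (X i *v b0) / moment (\<lambda>_. 1) (X i *v b0) + norm (mean (X i *v b0)) ^ 3 \<le> \<bar>C\<bar>"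
      using C[of "X i *v b0"] X by fastforce
    moreover have "norm (X i *v v) ^ 3 \<le> (A * norm v) ^ 3" by (intro power_mono A) simp
    ultimately show "8 * norm (X i *v v) ^ 3 *
       (moment (\<lambda>y. norm y ^ 3) (X i *v b0) / moment (\<lambda>_. 1) (X i *v b0) + norm (mean (X i *v b0)) ^ 3) \<le> 8 * (A * norm v) ^ 3 * \<bar>C\<bar>"
      using A(1) by (intro order.trans[OF mult_left_mono mult_right_mono]) auto
  qed
  with T(1) show thesis by (rule that)
qed

lemma residual_variance_sum:
  "(\<Sum>i<n. expectation (\<lambda>\<omega>. (residual v i \<omega>)\<^sup>2)) / real n = v \<bullet> (avg_information n *v v)"
  by (simp add: residual_moments(3) avg_information_quadratic_form)

lemma avg_information_converges: "(\<lambda>n. v \<bullet> (avg_information n *v v)) \<longlonglongrightarrow> v \<bullet> (J *v v)"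
proof -
  have "(\<lambda>n. v \<bullet> (avg_information n *v v)) = (\<lambda>n. \<Sum>i\<in>UNIV. v $ i * (\<Sum>j\<in>UNIV. avg_information n $ i $ j * v $ j))"
    by (simp add: inner_vec_def matrix_vector_mult_def)
  moreover have "avg_information \<longlonglongrightarrow> J" using information_limit by (simp add: avg_information_def[abs_def])
  ultimately show ?thesis
    by (auto simp: inner_vec_def matrix_vector_mult_def intro!: tendsto_intros)
qed

lemma S_characteristic: "(\<lambda>n. \<integral>\<omega>. cis (v \<bullet> S n \<omega>) \<partial>M) \<longlonglongrightarrow> complex_of_real (exp (- (v \<bullet> (J *v v)) / 2))"
proof -
  obtain C where C: "\<And>i. integrable M (\<lambda>\<omega>. \<bar>residual v i \<omega>\<bar> ^ 3)" "\<And>i. expectation (\<lambda>\<omega>. \<bar>residual v i \<omega>\<bar> ^ 3) \<le> C"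
    using residual_third_moment by blast
  show ?thesis
    unfolding inner_S
    by (rule normalized_sum_characteristic_limit[OF residual_indep residual_moments(1,2) C])
      (simp add: residual_variance_sum avg_information_converges)
qed

lemma S_second_moment:
  "integrable M (\<lambda>\<omega>. (v \<bullet> S n \<omega>)\<^sup>2)" "expectation (\<lambda>\<omega>. (v \<bullet> S n \<omega>)\<^sup>2) = v \<bullet> (avg_information n *v v)"
proof -
  note m = second_moment_sum[OF residual_indep residual_moments(1,2), of v n]
  have eq: "(v \<bullet> S n \<omega>)\<^sup>2 = (\<Sum>i<n. residual v i \<omega>)\<^sup>2 / real n" for \<omega>
    by (simp add: inner_S power_divide)
  show "integrable M (\<lambda>\<omega>. (v \<bullet> S n \<omega>)\<^sup>2)" unfolding eq using m by simp
  show "expectation (\<lambda>\<omega>. (v \<bullet> S n \<omega>)\<^sup>2) = v \<bullet> (avg_information n *v v)"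
    unfolding eq residual_variance_sum[symmetric] using m by simp
qed

text \<open>Markov's inequality for the squared norm, whose mean is the trace of the averaged
  information; this is bounded because it converges. The copy has the same law.\<close>

lemma S_tight:
  assumes "0 < e"
  obtains K where "0 < K" "\<And>n. prob {\<omega> \<in> space M. K < norm (S n \<omega>)} \<le> e" "\<And>n. prob {\<omega> \<in> space M. K < norm (S' n \<omega>)} \<le> e"
proof -
  have "\<exists>C. \<forall>n. (\<Sum>j\<in>UNIV. axis j 1 \<bullet> (avg_information n *v axis j 1)) \<le> C"
  proof -
    have "(\<lambda>n. \<Sum>j\<in>UNIV. axis j 1 \<bullet> (avg_information n *v axis j 1)) \<longlonglongrightarrow> (\<Sum>j\<in>UNIV. axis j 1 \<bullet> (J *v axis j 1))"
      by (intro tendsto_sum avg_information_converges)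
    then obtain C where "\<And>n. norm (\<Sum>j\<in>UNIV. axis j 1 \<bullet> (avg_information n *v axis j 1)) \<le> C"
      using BseqE[OF convergent_imp_Bseq[OF convergentI]] by blast
    then show ?thesis unfolding real_norm_def using abs_le_D1 by blast
  qed
  then obtain C where C: "\<And>n. (\<Sum>j\<in>UNIV. axis j 1 \<bullet> (avg_information n *v axis j 1)) \<le> C" by blast
  \<comment> \<open>Ensures |C| / K^2 <= e; the summand 1 keeps \<open>K\<close> positive when
    \<open>C\<close> is 0.\<close>
  define K where "K = sqrt (\<bar>C\<bar> / e) + 1"
  have K: "0 < K" using \<open>0 < e\<close> by (simp add: K_def add_nonneg_pos)
  have "\<bar>C\<bar> / e \<le> K\<^sup>2"
  proof -
    have "(sqrt (\<bar>C\<bar> / e))\<^sup>2 \<le> K\<^sup>2" unfolding K_def using \<open>0 < e\<close> by (intro power_mono) auto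
    then show ?thesis using \<open>0 < e\<close> by simp
  qed
  then have CK: "\<bar>C\<bar> / K\<^sup>2 \<le> e" using \<open>0 < e\<close> K by (simp add: pos_divide_le_eq mult.commute)
  have b1: "prob {\<omega> \<in> space M. K < norm (S n \<omega>)} \<le> e" for n
  proof -
    have sq: "(norm (S n \<omega>))\<^sup>2 = (\<Sum>j\<in>UNIV. (axis j 1 \<bullet> S n \<omega>)\<^sup>2)" for \<omega>
      unfolding power2_norm_eq_inner inner_vec_def[of "S n \<omega>" "S n \<omega>"]
      by (simp add: inner_axis' power2_eq_square)
    have i: "integrable M (\<lambda>\<omega>. (norm (S n \<omega>))\<^sup>2)" unfolding sq by (intro Bochner_Integration.integrable_sum S_second_moment)
    have "expectation (\<lambda>\<omega>. (norm (S n \<omega>))\<^sup>2) = (\<Sum>j\<in>UNIV. axis j 1 \<bullet> (avg_information n *v axis j 1))"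
      unfolding sq by (subst Bochner_Integration.integral_sum) (simp_all only: S_second_moment)
    then have E: "expectation (\<lambda>\<omega>. (norm (S n \<omega>))\<^sup>2) \<le> \<bar>C\<bar>" using C[of n] by linarith
    have "prob {\<omega> \<in> space M. K < norm (S n \<omega>)} \<le> prob {\<omega> \<in> space M. K\<^sup>2 \<le> (norm (S n \<omega>))\<^sup>2}"
      using K by (intro finite_measure_mono) (auto intro: power_mono less_imp_le)
    also have "\<dots> \<le> expectation (\<lambda>\<omega>. (norm (S n \<omega>))\<^sup>2) / K\<^sup>2"
      by (rule integral_Markov_inequality_measure[OF i, of "{}"]) (use K in auto)
    also have "\<dots> \<le> \<bar>C\<bar> / K\<^sup>2" using E by (intro divide_right_mono) auto
    finally show ?thesis using CK by linarith
  qed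
  have same: "prob {\<omega> \<in> space M. K < norm (S' n \<omega>)} = prob {\<omega> \<in> space M. K < norm (S n \<omega>)}" for n
  proof -
    have "measure (distr M borel (S' n)) {x. K < norm x} = measure (distr M borel (S n)) {x. K < norm x}"
      by (simp only: S'_distr)
    then show ?thesis by (simp add: measure_distr vimage_def Int_def conj_commute)
  qed
  show thesis by (rule that[OF K b1]) (simp only: same b1)
qed

end

text \<open>Gram-Schmidt for the form of \<open>J\<close>, applied to the axes in \<open>A\<close>;
  it preserves their span, which consists of the vectors vanishing off \<open>A\<close>. Extension
  by zero to the other labels lets the coordinates form a vector of type
  \<open>real^'p\<close>.\<close>

lemma orthonormal_coordinate_basis:
  fixes J :: "real^'p^'p"
  assumes J: "positive_definite J"
  obtains w :: "'p \<Rightarrow> real^'p" where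
    "\<And>j. j \<notin> A \<Longrightarrow> w j = 0"
    "\<And>j k. j \<in> A \<Longrightarrow> k \<in> A \<Longrightarrow> w j \<bullet> (J *v w k) = (if j = k then 1 else 0)"
    "\<And>j k. k \<notin> A \<Longrightarrow> w j $ k = 0"
    "\<And>u. (\<And>k. k \<notin> A \<Longrightarrow> u $ k = 0) \<Longrightarrow> u = (\<Sum>j\<in>A. (u \<bullet> (J *v w j)) *\<^sub>R w j)"
proof -
  define Q where "Q x y = x \<bullet> (J *v y)" for x y
  have bil: "bilinear Q"
    unfolding bilinear_def Q_def
    by (auto intro!: linearI simp: inner_add_left inner_add_right matrix_vector_right_distrib matrix_vector_mult_scaleR)
  have JT: "transpose J = J" using J by (simp add: positive_definite_def)
  have sym: "Q x y = Q y x" for x y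
    using inner_transpose_matrix_vector[of x J y] unfolding JT Q_def by (simp add: inner_commute)
  have pos: "x \<noteq> 0 \<Longrightarrow> 0 < Q x x" for x using J by (simp add: positive_definite_def Q_def)
  let ?e = "\<lambda>j::'p. axis j (1::real)"
  let ?C = "?e ` A"
  have "independent ?C"
    by (rule independent_mono[OF independent_Basis]) (auto simp: Basis_vec_def)
  then obtain w' where w': "\<And>c d. c \<in> ?C \<Longrightarrow> d \<in> ?C \<Longrightarrow> Q (w' c) (w' d) = (if c = d then 1 else 0)" "span (w' ` ?C) = span ?C"
    using gram_schmidt_bilinear[OF bil sym pos, of ?C] by auto
  define w where "w j = (if j \<in> A then w' (?e j) else 0)" for j
  have im: "w ` A = w' ` ?C" by (auto simp: w_def)
  have span_A: "span ?C = {u. \<forall>k. k \<notin> A \<longrightarrow> u $ k = 0}"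
  proof
    have "subspace {u :: real^'p. \<forall>k. k \<notin> A \<longrightarrow> u $ k = 0}" by (auto simp: subspace_def)
    moreover have "?C \<subseteq> {u. \<forall>k. k \<notin> A \<longrightarrow> u $ k = 0}" by (auto simp: axis_def)
    ultimately show "span ?C \<subseteq> {u. \<forall>k. k \<notin> A \<longrightarrow> u $ k = 0}" by (rule span_minimal[rotated])
    show "{u. \<forall>k. k \<notin> A \<longrightarrow> u $ k = 0} \<subseteq> span ?C"
    proof
      fix u :: "real^'p" assume u: "u \<in> {u. \<forall>k. k \<notin> A \<longrightarrow> u $ k = 0}"
      have "u = (\<Sum>j\<in>A. u $ j *\<^sub>R ?e j)"
        using u by (auto simp: vec_eq_iff axis_def if_distrib cong: if_cong)
      also have "\<dots> \<in> span ?C" by (intro span_sum span_scale span_base) auto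
      finally show "u \<in> span ?C" .
    qed
  qed
  show thesis
  proof (rule that[of w])
    show "w j = 0" if "j \<notin> A" for j using that by (simp add: w_def)
    show on: "w j \<bullet> (J *v w k) = (if j = k then 1 else 0)" if "j \<in> A" "k \<in> A" for j k
      using w'(1)[of "?e j" "?e k"] that by (simp add: w_def Q_def axis_eq_axis)
    show "w j $ k = 0" if "k \<notin> A" for j k
    proof (cases "j \<in> A")
      case True
      then have "w j \<in> span (w ` A)" by (intro span_base) auto
      then show ?thesis using that unfolding im w'(2) span_A by blast
    qed (simp add: w_def)
    fix u :: "real^'p" assume "\<And>k. k \<notin> A \<Longrightarrow> u $ k = 0"
    then have "u \<in> span (w ` A)" unfolding im w'(2) span_A by blast
    then have "u = (\<Sum>j\<in>A. Q u (w j) *\<^sub>R w j)"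
      using on by (intro orthonormal_expansion[OF bil pos]) (auto simp: Q_def)
    then show "u = (\<Sum>j\<in>A. (u \<bullet> (J *v w j)) *\<^sub>R w j)" by (simp add: Q_def)
  qed
qed

section \<open>Joint Gaussian limit of the scores\<close>

lemma cmod_cis_diff: "cmod (cis x - cis y) \<le> \<bar>x - y\<bar>"
proof -
  have "cis x - cis y = cis y * (cis (x - y) - 1)" by (simp add: cis_mult right_diff_distrib)
  then have "cmod (cis x - cis y) = cmod (iexp (x - y) - 1)" by (simp add: norm_mult cis_conv_exp)
  also have "\<dots> \<le> \<bar>x - y\<bar>" using iexp_approx1[of "x - y" 0] by simp
  finally show ?thesis .
qed

text \<open>The weak limit theorem has real test functions, so complex waves are split into cosine
  and sine.\<close>

lemma (in prob_space) expectation_cis: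
  assumes "f \<in> borel_measurable M"
  shows "(\<integral>\<omega>. cis (f \<omega>) \<partial>M) = complex_of_real (expectation (\<lambda>\<omega>. cos (f \<omega>))) + \<i> * complex_of_real (expectation (\<lambda>\<omega>. sin (f \<omega>)))"
proof -
  have i: "integrable M (\<lambda>\<omega>. cos (f \<omega>))" "integrable M (\<lambda>\<omega>. sin (f \<omega>))"
    using assms by (auto intro!: integrable_const_bound[of _ 1] borel_measurable_continuous_on[of cos] borel_measurable_continuous_on[of sin]
        continuous_intros)
  have "(\<lambda>\<omega>. cis (f \<omega>)) = (\<lambda>\<omega>. complex_of_real (cos (f \<omega>)) + \<i> * complex_of_real (sin (f \<omega>)))"
    by (auto simp: complex_eq_iff)
  then show ?thesis using i by simp
qed

lemma (in prob_space) integrable_cis: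
  assumes "f \<in> borel_measurable M"
  shows "integrable M (\<lambda>\<omega>. cis (f \<omega>))"
proof (rule integrable_const_bound[of _ 1])
  show "(\<lambda>\<omega>. cis (f \<omega>)) \<in> borel_measurable M"
    by (rule borel_measurable_continuous_on[OF _ assms]) (intro continuous_intros)
qed simp

lemma measurable_vec_lambda:
  fixes f :: "'n::finite \<Rightarrow> 'a \<Rightarrow> real"
  assumes "\<And>j. f j \<in> borel_measurable N"
  shows "(\<lambda>x. \<chi> j. f j x) \<in> borel_measurable N"
proof -
  have "(\<lambda>x. \<chi> j. f j x) = (\<lambda>x. \<Sum>j\<in>UNIV. f j x *\<^sub>R axis j 1)"
    by (auto simp: vec_eq_iff axis_def if_distrib cong: if_cong)
  then show ?thesis using assms by (auto intro!: borel_measurable_sum borel_measurable_scaleR)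
qed

text \<open>The zeros off \<open>A\<close> mirror the vectors \<open>w j = 0\<close> there, so that
  limit and prelimit live in the same space.\<close>

definition gaussian_pair :: "'p::finite set \<Rightarrow> ('p \<times> bool \<Rightarrow> real) \<Rightarrow> (real^'p) \<times> (real^'p)" where
  "gaussian_pair A \<omega> = (\<chi> j. if j \<in> A then \<omega> (j, True) else 0, \<chi> j. if j \<in> A then \<omega> (j, False) else 0)"

lemma gaussian_pair_measurable: "gaussian_pair A \<in> borel_measurable gaussian_space"
proof -
  have "(\<lambda>\<omega>. if j \<in> A then \<omega> (j, c) else 0) \<in> borel_measurable gaussian_space" for j c by simp
  then show ?thesis unfolding gaussian_pair_def[abs_def] by (intro borel_measurable_Pair measurable_vec_lambda)
qed

lemma gaussian_pair_characteristic:
  "(\<integral>\<omega>. cis ((x, y) \<bullet> gaussian_pair A \<omega>) \<partial>gaussian_space)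
    = complex_of_real (exp (- ((\<Sum>j\<in>A. (x $ j)\<^sup>2) + (\<Sum>j\<in>A. (y $ j)\<^sup>2)) / 2))"
proof -
  define c where "c k = (if fst k \<in> A then (if snd k then x $ fst k else y $ fst k) else 0)" for k
  have split: "(\<Sum>k\<in>UNIV. f k) = (\<Sum>j\<in>UNIV. f (j, True)) + (\<Sum>j\<in>UNIV. f (j, False))" for f :: "'a \<times> bool \<Rightarrow> real"
  proof -
    have "(\<Sum>k\<in>UNIV. f k) = (\<Sum>j\<in>UNIV. \<Sum>c\<in>UNIV. f (j, c))"
      by (simp add: sum.cartesian_product UNIV_Times_UNIV[symmetric] del: UNIV_Times_UNIV)
    then show ?thesis by (simp add: UNIV_bool sum.distrib add.commute)
  qed
  have "(x, y) \<bullet> gaussian_pair A \<omega> = (\<Sum>k\<in>UNIV. c k * \<omega> k)" for \<omega>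
    unfolding split by (auto simp: gaussian_pair_def inner_vec_def c_def intro!: sum.cong arg_cong2[of _ _ _ _ "(+)"])
  moreover have "(\<Sum>k\<in>UNIV. (c k)\<^sup>2) = (\<Sum>j\<in>A. (x $ j)\<^sup>2) + (\<Sum>j\<in>A. (y $ j)\<^sup>2)"
    unfolding split by (simp add: c_def if_distrib[of "\<lambda>x. x\<^sup>2"] sum.If_cases cong: if_cong)
  ultimately show ?thesis using gaussian_characteristic[of c] by simp
qed

context random_regression
begin

text \<open>Independence factors the joint characteristic function, and equality in law replaces the
  factor of the copy by one of the data. The limit theorem for a single score thus yields the joint
  limit.\<close>

lemma S_pair_characteristic:
  "(\<lambda>n. \<integral>\<omega>. cis (u \<bullet> S n \<omega> + v \<bullet> S' n \<omega>) \<partial>M)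
    \<longlonglongrightarrow> complex_of_real (exp (- (u \<bullet> (J *v u) + v \<bullet> (J *v v)) / 2))"
proof -
  have prod: "(\<integral>\<omega>. cis (u \<bullet> S n \<omega> + v \<bullet> S' n \<omega>) \<partial>M) = (\<integral>\<omega>. cis (u \<bullet> S n \<omega>) \<partial>M) * (\<integral>\<omega>. cis (v \<bullet> S n \<omega>) \<partial>M)" for n
  proof -
    have m: "(\<lambda>x. cis (a \<bullet> x)) \<in> borel_measurable borel" for a :: "real^'p"
      by (intro borel_measurable_continuous_onI continuous_intros)
    have iv: "indep_var borel (\<lambda>\<omega>. cis (u \<bullet> S n \<omega>)) borel (\<lambda>\<omega>. cis (v \<bullet> S' n \<omega>))"
      using indep_var_compose[OF S_indep[of n] m[of u] m[of v]] by (simp only: comp_def)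
    have i: "integrable M (\<lambda>\<omega>. cis (u \<bullet> S n \<omega>))" "integrable M (\<lambda>\<omega>. cis (v \<bullet> S' n \<omega>))"
      by (intro integrable_cis borel_measurable_inner S_measurable S'_measurable borel_measurable_const)+
    have "(\<integral>\<omega>. cis (u \<bullet> S n \<omega> + v \<bullet> S' n \<omega>) \<partial>M) = (\<integral>\<omega>. cis (u \<bullet> S n \<omega>) * cis (v \<bullet> S' n \<omega>) \<partial>M)"
      by (simp only: cis_mult)
    also have "\<dots> = (\<integral>\<omega>. cis (u \<bullet> S n \<omega>) \<partial>M) * (\<integral>\<omega>. cis (v \<bullet> S' n \<omega>) \<partial>M)"
      by (rule indep_var_lebesgue_integral[OF iv i])
    also have "(\<integral>\<omega>. cis (v \<bullet> S' n \<omega>) \<partial>M) = (\<integral>x. cis (v \<bullet> x) \<partial>distr M borel (S' n))"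
      by (rule integral_distr[OF S'_measurable m, symmetric])
    also have "\<dots> = (\<integral>\<omega>. cis (v \<bullet> S n \<omega>) \<partial>M)"
      unfolding S'_distr by (rule integral_distr[OF S_measurable m])
    finally show ?thesis .
  qed
  have "complex_of_real (exp (- (u \<bullet> (J *v u)) / 2)) * complex_of_real (exp (- (v \<bullet> (J *v v)) / 2))
      = complex_of_real (exp (- (u \<bullet> (J *v u) + v \<bullet> (J *v v)) / 2))"
    by (simp only: of_real_mult[symmetric] exp_add[symmetric] add_divide_distrib minus_add_distrib)
  with tendsto_mult[OF S_characteristic[of u] S_characteristic[of v]] show ?thesis
    unfolding prod by simp
qed

definition coordinates :: "('p \<Rightarrow> real^'p) \<Rightarrow> nat \<Rightarrow> 'w \<Rightarrow> (real^'p) \<times> (real^'p)" where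
  "coordinates w n \<omega> = (\<chi> j. w j \<bullet> S n \<omega>, \<chi> j. w j \<bullet> S' n \<omega>)"

lemma coordinates_measurable: "coordinates w n \<in> borel_measurable M"
  unfolding coordinates_def[abs_def]
  by (intro borel_measurable_Pair measurable_vec_lambda borel_measurable_inner S_measurable S'_measurable borel_measurable_const)

lemma coordinates_norm_le: "norm (coordinates w n \<omega>) \<le> (\<Sum>j\<in>UNIV. norm (w j)) * (norm (S n \<omega>) + norm (S' n \<omega>))"
proof -
  have v: "norm (\<chi> j. w j \<bullet> x) \<le> (\<Sum>j\<in>UNIV. norm (w j)) * norm x" for x
  proof -
    have "norm (\<chi> j. w j \<bullet> x) \<le> (\<Sum>j\<in>UNIV. \<bar>w j \<bullet> x\<bar>)" using norm_le_l1_cart[of "\<chi> j. w j \<bullet> x"] by simp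
    also have "\<dots> \<le> (\<Sum>j\<in>UNIV. norm (w j) * norm x)" by (intro sum_mono Cauchy_Schwarz_ineq2)
    finally show ?thesis by (simp add: sum_distrib_right)
  qed
  have "norm (coordinates w n \<omega>) \<le> norm (\<chi> j. w j \<bullet> S n \<omega>) + norm (\<chi> j. w j \<bullet> S' n \<omega>)"
    unfolding coordinates_def by (rule norm_Pair_le)
  then show ?thesis using v[of "S n \<omega>"] v[of "S' n \<omega>"] by (simp add: distrib_left)
qed

theorem coordinates_limit:
  fixes f :: "(real^'p) \<times> (real^'p) \<Rightarrow> real"
  assumes w0: "\<And>j. j \<notin> A \<Longrightarrow> w j = 0"
    and w: "\<And>j k. j \<in> A \<Longrightarrow> k \<in> A \<Longrightarrow> w j \<bullet> (J *v w k) = (if j = k then 1 else 0)"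
    and f: "continuous_on UNIV f" "\<And>x. \<bar>f x\<bar> \<le> K"
  shows "(\<lambda>n. \<integral>\<omega>. f (coordinates w n \<omega>) \<partial>M) \<longlonglongrightarrow> (\<integral>\<omega>. f (gaussian_pair A \<omega>) \<partial>gaussian_space)"
proof -
  let ?\<mu> = "\<lambda>n. distr M borel (coordinates w n)" and ?\<rho> = "distr gaussian_space borel (gaussian_pair A)"
  interpret G: prob_space gaussian_space by (rule prob_space_gaussian_space)
  have fm: "f \<in> borel_measurable borel" by (rule borel_measurable_continuous_onI[OF f(1)])
  have cm: "(\<lambda>z. cis (\<xi> \<bullet> z)) \<in> borel_measurable borel" for \<xi> :: "(real^'p) \<times> (real^'p)"
    by (intro borel_measurable_continuous_onI continuous_intros)
  have "(\<lambda>n. \<integral>x. f x \<partial>?\<mu> n) \<longlonglongrightarrow> (\<integral>x. f x \<partial>?\<rho>)"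
  proof (rule bounded_continuous_integral_convergence[OF _ _ _ _ _ _ f])
    show "prob_space (?\<mu> n)" for n by (rule prob_space_distr[OF coordinates_measurable])
    show pr: "prob_space ?\<rho>" by (rule G.prob_space_distr[OF gaussian_pair_measurable])
    fix \<xi> :: "(real^'p) \<times> (real^'p)"
    obtain x y where \<xi>: "\<xi> = (x, y)" by fastforce
    \<comment> \<open>The score frequency that corresponds to a frequency \<open>x\<close> on the
      coordinates. Orthonormality turns its \<open>J\<close>-form into the sum of squares over
      \<open>A\<close>, the exponent of independent standard normals.\<close>
    let ?v = "\<lambda>x. \<Sum>j\<in>UNIV. (x $ j) *\<^sub>R w j"
    have vQ: "?v x \<bullet> (J *v ?v x) = (\<Sum>j\<in>A. (x $ j)\<^sup>2)" for x
    proof -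
      have v: "?v x = (\<Sum>j\<in>A. (x $ j) *\<^sub>R w j)"
        by (rule sum.mono_neutral_right) (auto simp: w0)
      have Jv: "J *v ?v x = (\<Sum>k\<in>A. (x $ k) *\<^sub>R (J *v w k))"
        unfolding v using linear_sum[OF matrix_vector_mul_linear[of J], of "\<lambda>k. (x $ k) *\<^sub>R w k" A]
        by (simp add: matrix_vector_mult_scaleR)
      have "?v x \<bullet> (J *v ?v x) = (\<Sum>j\<in>A. \<Sum>k\<in>A. x $ j * (x $ k * (w j \<bullet> (J *v w k))))"
        unfolding Jv unfolding v
        by (simp add: inner_sum_left inner_sum_right sum_distrib_left) (subst sum.swap, simp add: mult.left_commute)
      also have "\<dots> = (\<Sum>j\<in>A. \<Sum>k\<in>A. if k = j then x $ j * x $ j else 0)"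
        by (intro sum.cong refl) (auto simp: w)
      finally show ?thesis by (simp add: power2_eq_square)
    qed
    have in_v: "\<xi> \<bullet> coordinates w n \<omega> = ?v x \<bullet> S n \<omega> + ?v y \<bullet> S' n \<omega>" for n \<omega>
      by (simp add: \<xi> coordinates_def inner_vec_def[of x] inner_vec_def[of y] inner_sum_left)
    have "(\<lambda>n. \<integral>\<omega>. cis (\<xi> \<bullet> coordinates w n \<omega>) \<partial>M) \<longlonglongrightarrow> (\<integral>\<omega>. cis (\<xi> \<bullet> gaussian_pair A \<omega>) \<partial>gaussian_space)"
      using S_pair_characteristic[of "?v x" "?v y"] unfolding in_v vQ unfolding \<xi> gaussian_pair_characteristic .
    then show "(\<lambda>n. \<integral>z. cis (\<xi> \<bullet> z) \<partial>?\<mu> n) \<longlonglongrightarrow> (\<integral>z. cis (\<xi> \<bullet> z) \<partial>?\<rho>)"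
      unfolding integral_distr[OF coordinates_measurable cm] integral_distr[OF gaussian_pair_measurable cm] .
  next
    fix e :: real assume e: "0 < e"
    obtain K where K: "0 < K" "\<And>n. prob {\<omega> \<in> space M. K < norm (S n \<omega>)} \<le> e / 2" "\<And>n. prob {\<omega> \<in> space M. K < norm (S' n \<omega>)} \<le> e / 2"
      using S_tight[of "e / 2"] e by auto
    let ?L = "\<Sum>j\<in>UNIV. norm (w j)"
    have L: "0 \<le> ?L" by (simp add: sum_nonneg)
    obtain R0 where R0: "\<forall>R\<ge>R0. measure ?\<rho> {x. R < norm x} \<le> e"
      using prob_measure_tight[OF G.prob_space_distr[OF gaussian_pair_measurable, of A], of e] e by auto
    \<comment> \<open>\<open>R0\<close> serves the limit law. The other term exceeds by 1 the bound
      on the coordinates when both scores have norm at most \<open>K\<close>, and makes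
      \<open>R\<close> positive.\<close>
    define R where "R = max R0 (?L * (2 * K) + 1)"
    have "0 < R" using L K(1) by (simp add: R_def less_max_iff_disj add_nonneg_pos)
    moreover have "R0 \<le> R" by (simp add: R_def)
    then have "measure ?\<rho> {x. R < norm x} \<le> e" by (rule R0[rule_format])
    moreover have "measure (?\<mu> n) {x. R < norm x} \<le> e" for n
    proof -
      let ?E = "{\<omega> \<in> space M. K < norm (S n \<omega>)}" and ?E' = "{\<omega> \<in> space M. K < norm (S' n \<omega>)}"
      have op: "{x :: (real^'p) \<times> (real^'p). R < norm x} \<in> sets borel" by measurable
      have "measure (?\<mu> n) {x. R < norm x} = prob {\<omega> \<in> space M. R < norm (coordinates w n \<omega>)}"
        unfolding measure_distr[OF coordinates_measurable op] by (simp add: vimage_def Int_def conj_commute)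
      also have "\<dots> \<le> prob (?E \<union> ?E')"
      proof (rule finite_measure_mono)
        show "{\<omega> \<in> space M. R < norm (coordinates w n \<omega>)} \<subseteq> ?E \<union> ?E'"
        proof (intro subsetI, rule ccontr)
          fix \<omega> assume a: "\<omega> \<in> {\<omega> \<in> space M. R < norm (coordinates w n \<omega>)}"
            and b: "\<omega> \<notin> ?E \<union> ?E'"
          have "norm (S n \<omega>) + norm (S' n \<omega>) \<le> 2 * K" using a b by auto
          then have "?L * (norm (S n \<omega>) + norm (S' n \<omega>)) \<le> ?L * (2 * K)" using L by (rule mult_left_mono)
          moreover have "R < norm (coordinates w n \<omega>)" "?L * (2 * K) + 1 \<le> R" using a by (auto simp: R_def)
          ultimately show False using coordinates_norm_le[of w n \<omega>] by linarith
        qed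
      qed measurable
      also have "\<dots> \<le> prob ?E + prob ?E'"
        by (rule measure_Un_le) measurable
      also have "\<dots> \<le> e" using K(2,3)[of n] by linarith
      finally show ?thesis .
    qed
    ultimately show "\<exists>R>0. measure ?\<rho> {x. R < norm x} \<le> e \<and> (\<forall>n. measure (?\<mu> n) {x. R < norm x} \<le> e)" by blast
  qed simp_all
  then show ?thesis
    unfolding integral_distr[OF coordinates_measurable fm] integral_distr[OF gaussian_pair_measurable fm] .
qed

end

definition bias_form :: "'p::finite set \<Rightarrow> (real^'p) \<Rightarrow> (real^'p) \<times> (real^'p) \<Rightarrow> real" where
  "bias_form A r z = (\<Sum>j\<in>A. (fst z $ j - r $ j) * (fst z $ j - snd z $ j))"

lemma bias_form_continuous: "continuous_on UNIV (bias_form A r)"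
  unfolding bias_form_def[abs_def] by (intro continuous_intros)

text \<open>After expansion only the squares have mean 1; the products of distinct variables and the
  linear terms with \<open>r\<close> are centred. Each index of \<open>A\<close> contributes 1, and
  the shift leaves no trace.\<close>

lemma bias_form_gaussian:
  "integrable gaussian_space (\<lambda>\<omega>. bias_form A r (gaussian_pair A \<omega>))"
  "(\<integral>\<omega>. bias_form A r (gaussian_pair A \<omega>) \<partial>gaussian_space) = real (card A)"
proof -
  have eq: "bias_form A r (gaussian_pair A \<omega>) = (\<Sum>j\<in>A. \<omega> (j, True) * \<omega> (j, True) - \<omega> (j, True) * \<omega> (j, False)
      - r $ j * \<omega> (j, True) + r $ j * \<omega> (j, False))" for \<omega>
    unfolding bias_form_def gaussian_pair_def by (intro sum.cong refl) (simp add: algebra_simps)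
  have i: "integrable gaussian_space (\<lambda>\<omega>. \<omega> (j, True) * \<omega> (j, True) - \<omega> (j, True) * \<omega> (j, False)
      - r $ j * \<omega> (j, True) + r $ j * \<omega> (j, False))" for j
    by (intro Bochner_Integration.integrable_add Bochner_Integration.integrable_diff integrable_mult_right gaussian_moments)
  have e: "(\<integral>\<omega>. \<omega> (j, True) * \<omega> (j, True) - \<omega> (j, True) * \<omega> (j, False)
      - r $ j * \<omega> (j, True) + r $ j * \<omega> (j, False) \<partial>gaussian_space) = 1" for j
    by (simp add: gaussian_moments)
  show "integrable gaussian_space (\<lambda>\<omega>. bias_form A r (gaussian_pair A \<omega>))"
    unfolding eq by (intro Bochner_Integration.integrable_sum i)
  show "(\<integral>\<omega>. bias_form A r (gaussian_pair A \<omega>) \<partial>gaussian_space) = real (card A)"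
    unfolding eq by (subst Bochner_Integration.integral_sum) (simp_all only: i e, simp)
qed

section \<open>Bias of the Bridge estimator\<close>

lemma is_arg_min_shift:
  fixes f g :: "'a \<Rightarrow> real"
  assumes "\<And>x. f x = g x + c"
  shows "is_arg_min f P = is_arg_min g P"
  by (simp add: is_arg_min_def fun_eq_iff assms)

text \<open>A minimizer over the open set \<open>B\<close> may fail to exist, so the estimator has
  to minimize only where one does. By \<open>minimizer_asymptotics\<close> this happens with
  probability close to one for large \<open>n\<close>.\<close>

locale bridge_regression = random_regression \<nu> b \<X> X B b0 J M Y Y'
  for \<nu> :: "(real^'r) measure" and b and \<X> :: "(real^'p^'r) set" and X B b0 J and M :: "'w measure" and Y Y' +
  fixes \<gamma> \<gamma>\<^sub>0 lam :: real and lamn :: "nat \<Rightarrow> real" and \<beta>hat :: "nat \<Rightarrow> 'w \<Rightarrow> real^'p" and Z :: "nat \<Rightarrow> 'w \<Rightarrow> real"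
  assumes \<gamma>: "0 < \<gamma>" "\<gamma> < 1" "\<gamma> < \<gamma>\<^sub>0" "\<gamma>\<^sub>0 \<le> 1" and lam: "0 < lam"
    and lamn: "\<And>n. lamn n = real n powr ((\<gamma>\<^sub>0 - 2) / 2) * lam"
    and \<beta>hat_measurable: "\<And>n. \<beta>hat n \<in> borel_measurable M"
    and \<beta>hat_minimizes: "\<And>n. AE \<omega> in M. \<beta>hat n \<omega> \<in> B \<and>
          ((\<exists>\<beta>. is_arg_min (bridge_objective \<nu> b X (\<lambda>i. Y i \<omega>) \<gamma> (lamn n) n) (\<lambda>\<beta>. \<beta> \<in> B) \<beta>) \<longrightarrow>
           is_arg_min (bridge_objective \<nu> b X (\<lambda>i. Y i \<omega>) \<gamma> (lamn n) n) (\<lambda>\<beta>. \<beta> \<in> B) (\<beta>hat n \<omega>))"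
    and Z: "\<And>n \<omega>. Z n \<omega> =
          (\<Sum>i<n. log_lik \<nu> b (X i) (Y i \<omega>) (\<beta>hat n \<omega>) - log_lik \<nu> b (X i) (Y i \<omega>) b0) -
          (\<Sum>i<n. log_lik \<nu> b (X i) (Y' i \<omega>) (\<beta>hat n \<omega>) - log_lik \<nu> b (X i) (Y' i \<omega>) b0)"
begin

lemma Z_eq: "1 \<le> n \<Longrightarrow> Z n \<omega> = (sqrt (real n) *\<^sub>R (\<beta>hat n \<omega> - b0)) \<bullet> (S n \<omega> - S' n \<omega>)"
proof -
  assume n: "1 \<le> n"
  let ?d = "\<beta>hat n \<omega> - b0"
  have "Z n \<omega> = (\<Sum>i<n. (X i *v ?d) \<bullet> (Y i \<omega> - mean (X i *v b0))) - (\<Sum>i<n. (X i *v ?d) \<bullet> (Y' i \<omega> - mean (X i *v b0)))"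
    unfolding Z sum_subtractf[symmetric]
    by (intro sum.cong refl) (simp add: log_lik_def matrix_vector_mult_diff_distrib inner_diff_left inner_diff_right inner_commute)
  also have "\<dots> = sqrt (real n) * (?d \<bullet> S n \<omega>) - sqrt (real n) * (?d \<bullet> S' n \<omega>)"
    using n by (simp add: S_def S'_def inner_score)
  finally show ?thesis by (simp add: inner_diff_right right_diff_distrib)
qed

text \<open>Cancelling cumulants and carriers first leaves a sum of inner products of measurable
  maps and avoids composing the cumulant function with the estimator.\<close>

lemma Z_measurable: "Z n \<in> borel_measurable M"
proof -
  have "Z n = (\<lambda>\<omega>. \<Sum>i<n. (X i *v (\<beta>hat n \<omega> - b0)) \<bullet> (Y i \<omega> - Y' i \<omega>))"
    unfolding Z[abs_def] sum_subtractf[symmetric]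
    by (intro ext sum.cong refl) (simp add: log_lik_def matrix_vector_mult_diff_distrib inner_diff_left inner_diff_right inner_commute)
  also have "\<dots> \<in> borel_measurable M"
    by (intro borel_measurable_sum borel_measurable_inner measurable_matrix_vector borel_measurable_diff
        \<beta>hat_measurable measurable_Y measurable_Y' borel_measurable_const)
  finally show ?thesis .
qed

text \<open>The exceptional event is that one of the two scores exceeds \<open>K\<close>, together
  with the null set where the minimizing property fails. A single \<open>\<eta>\<close> bounds
  probability and distance, which amounts to convergence in probability.\<close>

lemma bridge_approximation:
  obtains w r where "\<And>j. j \<notin> active_set b0 \<Longrightarrow> w j = 0"
    "\<And>j k. j \<in> active_set b0 \<Longrightarrow> k \<in> active_set b0 \<Longrightarrow> w j \<bullet> (J *v w k) = (if j = k then 1 else 0)"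
    "\<And>\<eta>. 0 < \<eta> \<Longrightarrow> \<forall>\<^sub>F n in sequentially. \<exists>E\<in>sets M. prob E \<le> \<eta> \<and>
        (\<forall>\<omega>\<in>space M - E. active_set (\<beta>hat n \<omega>) = active_set b0 \<and>
          \<bar>Z n \<omega> - bias_form (active_set b0) r (coordinates w n \<omega>)\<bar> \<le> \<eta>)"
proof -
  let ?A = "active_set b0"
  let ?obj = "\<lambda>n \<omega>. bridge_objective \<nu> b X (\<lambda>i. Y i \<omega>) \<gamma> (lamn n) n"
  obtain c where c: "0 < c" "\<And>u. c * (norm u)\<^sup>2 \<le> u \<bullet> (J *v u)"
    using positive_definite_lower_bound[OF J] by blast
  have JT: "transpose J = J" using J by (simp add: positive_definite_def)
  interpret P: penalized_quadratic b0 B J D \<gamma> \<gamma>\<^sub>0 lam c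
    by unfold_locales (fact open_B convex_B b0 c JT D_b0 D_convex D_continuous D_quadratic \<gamma> lam)+
  have Jsym: "x \<bullet> (J *v y) = y \<bullet> (J *v x)" for x y
    using inner_transpose_matrix_vector[of x J y] unfolding JT by (simp add: inner_commute)
  obtain w where w: "\<And>j. j \<notin> ?A \<Longrightarrow> w j = 0"
    "\<And>j k. j \<in> ?A \<Longrightarrow> k \<in> ?A \<Longrightarrow> w j \<bullet> (J *v w k) = (if j = k then 1 else 0)"
    "\<And>j k. k \<notin> ?A \<Longrightarrow> w j $ k = 0"
    "\<And>u. (\<And>k. k \<notin> ?A \<Longrightarrow> u $ k = 0) \<Longrightarrow> u = (\<Sum>j\<in>?A. (u \<bullet> (J *v w j)) *\<^sub>R w j)"
    using orthonormal_coordinate_basis[OF J, of ?A] by blast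
  \<comment> \<open>The restricted minimizer in the orthonormal basis; \<open>m2\<close> is its
    normal equation.\<close>
  define m where "m s = (\<Sum>j\<in>?A. (w j \<bullet> (s - P.shift)) *\<^sub>R w j)" for s
  have supp: "P.supported u \<longleftrightarrow> (\<forall>k. k \<notin> ?A \<longrightarrow> u $ k = 0)" for u
    by (simp add: P.supported_def active_set_def)
  have m1: "P.supported (m s)" for s
    unfolding supp m_def using w(3) by simp
  have m2: "x \<bullet> (s - P.shift) = m s \<bullet> (J *v x)" if "P.supported x" for s x
  proof -
    have "x = (\<Sum>j\<in>?A. (x \<bullet> (J *v w j)) *\<^sub>R w j)" using that unfolding supp by (intro w(4)) blast
    then have "x \<bullet> (s - P.shift) = (\<Sum>j\<in>?A. (x \<bullet> (J *v w j)) *\<^sub>R w j) \<bullet> (s - P.shift)" by simp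
    also have "\<dots> = (\<Sum>j\<in>?A. (w j \<bullet> (s - P.shift)) * (w j \<bullet> (J *v x)))"
      by (simp add: inner_sum_left Jsym[of x] mult.commute)
    also have "\<dots> = m s \<bullet> (J *v x)" by (simp add: m_def inner_sum_left)
    finally show ?thesis .
  qed
  define r :: "real^'p" where "r = (\<chi> j. w j \<bullet> P.shift)"
  have form: "bias_form ?A r (coordinates w n \<omega>) = m (S n \<omega>) \<bullet> (S n \<omega> - S' n \<omega>)" for n \<omega>
    by (simp add: bias_form_def coordinates_def r_def m_def inner_sum_left inner_diff_right right_diff_distrib sum_subtractf)
  \<comment> \<open>The two objectives differ by a quantity independent of \<open>\<beta>\<close>,
    so they have the same minimizers.\<close>
  have obj: "?obj n \<omega> \<beta>
      = P.objective n (S n \<omega>) \<beta> + ?obj n \<omega> b0" if n: "1 \<le> n" for n \<omega> \<beta>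
  proof -
    have rate: "real n * lamn n = real n powr (\<gamma>\<^sub>0 / 2) * lam"
    proof -
      have "real n * real n powr ((\<gamma>\<^sub>0 - 2) / 2) = real n powr (\<gamma>\<^sub>0 / 2)"
        using n powr_mult_base[of "real n" "(\<gamma>\<^sub>0 - 2) / 2"] by (simp add: diff_divide_distrib)
      then show ?thesis by (simp add: lamn flip: mult.assoc)
    qed
    have "- (S n \<omega> \<bullet> (sqrt (real n) *\<^sub>R (\<beta> - b0))) + D n \<beta>
        = (\<Sum>i<n. - ((X i *v (\<beta> - b0)) \<bullet> (Y i \<omega> - mean (X i *v b0))) +
           (cumulant \<nu> b (X i *v \<beta>) - cumulant \<nu> b (X i *v b0) - mean (X i *v b0) \<bullet> (X i *v (\<beta> - b0))))"
    proof -
      have "S n \<omega> \<bullet> (sqrt (real n) *\<^sub>R (\<beta> - b0)) = (\<Sum>i<n. (X i *v (\<beta> - b0)) \<bullet> (Y i \<omega> - mean (X i *v b0)))"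
        using n inner_score[of "\<beta> - b0" n "\<lambda>i. Y i \<omega>"] by (simp add: S_def inner_commute[of "score n _"])
      then show ?thesis by (simp only: D_def sum.distrib sum_negf)
    qed
    also have "\<dots> = (\<Sum>i<n. log_lik \<nu> b (X i) (Y i \<omega>) b0 - log_lik \<nu> b (X i) (Y i \<omega>) \<beta>)"
      by (intro sum.cong refl) (simp add: log_lik_def matrix_vector_mult_diff_distrib inner_diff_left inner_diff_right inner_commute)
    finally show ?thesis
      unfolding P.objective_def P.penalty_def bridge_objective_def rate
      by (simp add: sum_subtractf right_diff_distrib)
  qed
  have "\<forall>\<^sub>F n in sequentially. \<exists>E\<in>sets M. prob E \<le> \<eta> \<and>
        (\<forall>\<omega>\<in>space M - E. active_set (\<beta>hat n \<omega>) = ?A \<and> \<bar>Z n \<omega> - bias_form ?A r (coordinates w n \<omega>)\<bar> \<le> \<eta>)"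
    if \<eta>: "0 < \<eta>" for \<eta>
  proof -
    obtain K where K: "0 < K" "\<And>n. prob {\<omega> \<in> space M. K < norm (S n \<omega>)} \<le> \<eta> / 2" "\<And>n. prob {\<omega> \<in> space M. K < norm (S' n \<omega>)} \<le> \<eta> / 2"
      using S_tight[of "\<eta> / 2"] \<eta> by auto
    \<comment> \<open>The two scores differ by at most 2K in norm off the exceptional event, so an
      error \<open>e\<close> of the rescaled estimator changes the bias by at most
      \<open>\<eta>\<close>.\<close>
    define e where "e = \<eta> / (2 * K)"
    have e: "0 < e" using \<eta> K(1) by (simp add: e_def)
    have "\<forall>\<^sub>F n in sequentially. \<forall>s. norm s \<le> K \<longrightarrow>
        (\<exists>\<beta>. is_arg_min (P.objective n s) (\<lambda>\<beta>. \<beta> \<in> B) \<beta>) \<and>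
        (\<forall>\<beta>. is_arg_min (P.objective n s) (\<lambda>\<beta>. \<beta> \<in> B) \<beta> \<longrightarrow>
          active_set \<beta> = ?A \<and> norm (sqrt (real n) *\<^sub>R (\<beta> - b0) - m s) \<le> e)"
      by (rule P.minimizer_asymptotics[OF e m1]) (rule m2)
    then show ?thesis
      using eventually_ge_at_top[of 1]
    proof eventually_elim
      case (elim n)
      obtain N where N: "N \<in> null_sets M" "{\<omega> \<in> space M. \<not> (\<beta>hat n \<omega> \<in> B \<and>
          ((\<exists>\<beta>. is_arg_min (?obj n \<omega>) (\<lambda>\<beta>. \<beta> \<in> B) \<beta>) \<longrightarrow>
           is_arg_min (?obj n \<omega>) (\<lambda>\<beta>. \<beta> \<in> B) (\<beta>hat n \<omega>)))} \<subseteq> N"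
        using \<beta>hat_minimizes[of n] by (auto simp: eventually_ae_filter)
      let ?E1 = "{\<omega> \<in> space M. K < norm (S n \<omega>)}" and ?E2 = "{\<omega> \<in> space M. K < norm (S' n \<omega>)}"
      have E12: "?E1 \<in> sets M" "?E2 \<in> sets M" by measurable
      have EN: "N \<in> sets M" "prob N = 0" using N(1) by (auto simp: measure_eq_0_null_sets)
      have "prob (?E1 \<union> ?E2 \<union> N) \<le> prob (?E1 \<union> ?E2) + prob N"
        using E12 EN by (intro measure_Un_le) auto
      also have "prob (?E1 \<union> ?E2) \<le> prob ?E1 + prob ?E2" by (rule measure_Un_le[OF E12])
      finally have pE: "prob (?E1 \<union> ?E2 \<union> N) \<le> \<eta>" using K(2,3)[of n] EN(2) by linarith
      have good: "active_set (\<beta>hat n \<omega>) = ?A \<and> \<bar>Z n \<omega> - bias_form ?A r (coordinates w n \<omega>)\<bar> \<le> \<eta>"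
        if \<omega>: "\<omega> \<in> space M - (?E1 \<union> ?E2 \<union> N)" for \<omega>
      proof -
        have SK: "norm (S n \<omega>) \<le> K" "norm (S' n \<omega>) \<le> K" using \<omega> by auto
        have arg: "is_arg_min (?obj n \<omega>) P = is_arg_min (P.objective n (S n \<omega>)) P" for P
          by (rule is_arg_min_shift[OF obj[OF elim(2)]])
        note asym = elim(1)[rule_format, OF SK(1)]
        have "(\<exists>\<beta>. is_arg_min (?obj n \<omega>) (\<lambda>\<beta>. \<beta> \<in> B) \<beta>) \<longrightarrow>
            is_arg_min (?obj n \<omega>) (\<lambda>\<beta>. \<beta> \<in> B) (\<beta>hat n \<omega>)"
          using \<omega> N(2) by blast
        then have "is_arg_min (P.objective n (S n \<omega>)) (\<lambda>\<beta>. \<beta> \<in> B) (\<beta>hat n \<omega>)"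
          using conjunct1[OF asym] unfolding arg by blast
        then have a: "active_set (\<beta>hat n \<omega>) = ?A" "norm (sqrt (real n) *\<^sub>R (\<beta>hat n \<omega> - b0) - m (S n \<omega>)) \<le> e"
          using conjunct2[OF asym] by blast+
        have "Z n \<omega> - bias_form ?A r (coordinates w n \<omega>)
            = (sqrt (real n) *\<^sub>R (\<beta>hat n \<omega> - b0) - m (S n \<omega>)) \<bullet> (S n \<omega> - S' n \<omega>)"
          unfolding form Z_eq[OF elim(2)] by (simp add: inner_diff_left)
        also have "\<bar>\<dots>\<bar> \<le> norm (sqrt (real n) *\<^sub>R (\<beta>hat n \<omega> - b0) - m (S n \<omega>)) * norm (S n \<omega> - S' n \<omega>)"
          by (rule Cauchy_Schwarz_ineq2)
        also have "\<dots> \<le> e * (2 * K)"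
          using a(2) e SK norm_triangle_ineq4[of "S n \<omega>" "S' n \<omega>"] by (intro mult_mono) auto
        also have "\<dots> = \<eta>" using K(1) by (simp add: e_def)
        finally show ?thesis using a(1) by blast
      qed
      show ?case
        by (rule bexI[of _ "?E1 \<union> ?E2 \<union> N"]) (use pE good E12 EN in \<open>blast+\<close>)
    qed
  qed
  with w(1,2) show thesis by (rule that)
qed

theorem bridge_bias_limit:
  "\<exists>zlimit. real_distribution zlimit \<and> weak_conv_m (\<lambda>n. distr M borel (Z n)) zlimit \<and>
     integrable zlimit (\<lambda>z. z) \<and>
     (\<forall>\<epsilon>>0. (\<lambda>n. prob {\<omega> \<in> space M. \<bar>real (card (active_set (\<beta>hat n \<omega>))) - (\<integral>z. z \<partial>zlimit)\<bar> > \<epsilon>}) \<longlonglongrightarrow> 0)"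
proof -
  let ?A = "active_set b0"
  obtain w r where w: "\<And>j. j \<notin> ?A \<Longrightarrow> w j = 0"
      "\<And>j k. j \<in> ?A \<Longrightarrow> k \<in> ?A \<Longrightarrow> w j \<bullet> (J *v w k) = (if j = k then 1 else 0)"
    and approx: "\<And>\<eta>. 0 < \<eta> \<Longrightarrow> \<forall>\<^sub>F n in sequentially. \<exists>E\<in>sets M. prob E \<le> \<eta> \<and>
        (\<forall>\<omega>\<in>space M - E. active_set (\<beta>hat n \<omega>) = ?A \<and> \<bar>Z n \<omega> - bias_form ?A r (coordinates w n \<omega>)\<bar> \<le> \<eta>)"
    using bridge_approximation by blast
  interpret G: prob_space gaussian_space by (rule prob_space_gaussian_space)
  let ?h = "bias_form ?A r"
  define g where "g \<omega> = ?h (gaussian_pair ?A \<omega>)" for \<omega>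
  define hn where "hn n \<omega> = ?h (coordinates w n \<omega>)" for n \<omega>
  have hm: "?h \<in> borel_measurable borel" by (rule borel_measurable_continuous_onI[OF bias_form_continuous])
  have gm: "g \<in> borel_measurable gaussian_space"
    unfolding g_def[abs_def] by (rule measurable_compose[OF gaussian_pair_measurable hm])
  have hnm: "hn n \<in> borel_measurable M" for n
    unfolding hn_def[abs_def] by (rule measurable_compose[OF coordinates_measurable hm])
  define zlimit where "zlimit = distr gaussian_space borel g"
  have dist: "real_distribution zlimit" unfolding zlimit_def by (rule G.real_distribution_distr[OF gm])
  have int: "integrable zlimit (\<lambda>z. z)" and mean_z: "(\<integral>z. z \<partial>zlimit) = real (card ?A)"
    unfolding zlimit_def using bias_form_gaussian[of ?A r] gm
    by (simp_all add: integrable_distr_eq integral_distr g_def)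
  have "weak_conv_m (\<lambda>n. distr M borel (Z n)) zlimit"
  proof (rule levy_continuity)
    show "real_distribution (distr M borel (Z n))" for n by (rule real_distribution_distr[OF Z_measurable])
    fix t :: real
    \<comment> \<open>The composition with a cosine or sine is a bounded continuous test function,
      although \<open>?h\<close> is unbounded.\<close>
    have "(\<lambda>n. expectation (\<lambda>\<omega>. cos (t * hn n \<omega>))) \<longlonglongrightarrow> (\<integral>\<omega>. cos (t * g \<omega>) \<partial>gaussian_space)"
      unfolding hn_def g_def
      by (rule coordinates_limit[of ?A w "\<lambda>z. cos (t * ?h z)" 1]) (auto simp: w intro!: continuous_intros bias_form_continuous)
    moreover have "(\<lambda>n. expectation (\<lambda>\<omega>. sin (t * hn n \<omega>))) \<longlonglongrightarrow> (\<integral>\<omega>. sin (t * g \<omega>) \<partial>gaussian_space)"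
      unfolding hn_def g_def
      by (rule coordinates_limit[of ?A w "\<lambda>z. sin (t * ?h z)" 1]) (auto simp: w intro!: continuous_intros bias_form_continuous)
    ultimately have lim: "(\<lambda>n. \<integral>\<omega>. cis (t * hn n \<omega>) \<partial>M) \<longlonglongrightarrow> (\<integral>\<omega>. cis (t * g \<omega>) \<partial>gaussian_space)"
      unfolding expectation_cis[OF borel_measurable_times[OF borel_measurable_const hnm]]
        G.expectation_cis[OF borel_measurable_times[OF borel_measurable_const gm]]
      by (intro tendsto_intros)
    have diff: "(\<lambda>n. (\<integral>\<omega>. cis (t * Z n \<omega>) \<partial>M) - (\<integral>\<omega>. cis (t * hn n \<omega>) \<partial>M)) \<longlonglongrightarrow> 0"
    proof (rule tendstoI)
      fix e :: real assume e: "0 < e"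
      \<comment> \<open>The waves differ by at most |t| \<eta> off \<open>E\<close> and by at most 2
        on \<open>E\<close>, in total by (|t| + 2) \<eta>, which is strictly below
        \<open>e\<close>.\<close>
      define \<eta> where "\<eta> = e / (\<bar>t\<bar> + 3)"
      have \<eta>: "0 < \<eta>" using e by (simp add: \<eta>_def)
      show "\<forall>\<^sub>F n in sequentially. dist ((\<integral>\<omega>. cis (t * Z n \<omega>) \<partial>M) - (\<integral>\<omega>. cis (t * hn n \<omega>) \<partial>M)) 0 < e"
        using approx[OF \<eta>]
      proof eventually_elim
        case (elim n)
        then obtain E where E: "E \<in> sets M" "prob E \<le> \<eta>" "\<And>\<omega>. \<omega> \<in> space M \<Longrightarrow> \<omega> \<notin> E \<Longrightarrow> \<bar>Z n \<omega> - hn n \<omega>\<bar> \<le> \<eta>"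
          unfolding hn_def by blast
        have iZ: "integrable M (\<lambda>\<omega>. cis (t * Z n \<omega>))" and ih: "integrable M (\<lambda>\<omega>. cis (t * hn n \<omega>))"
          by (intro integrable_cis borel_measurable_times borel_measurable_const Z_measurable hnm)+
        let ?d = "\<lambda>\<omega>. cmod (cis (t * Z n \<omega>) - cis (t * hn n \<omega>))"
        have pw: "?d \<omega> \<le> \<bar>t\<bar> * \<eta> + 2 * indicator E \<omega>" if "\<omega> \<in> space M" for \<omega>
        proof (cases "\<omega> \<in> E")
          case True
          have "?d \<omega> \<le> 2"
            using norm_triangle_ineq4[of "cis (t * Z n \<omega>)" "cis (t * hn n \<omega>)"] by simp
          moreover have "0 \<le> \<bar>t\<bar> * \<eta>" using \<eta> by simp
          ultimately show ?thesis using True by simp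
        next
          case False
          have "?d \<omega> \<le> \<bar>t * Z n \<omega> - t * hn n \<omega>\<bar>" by (rule cmod_cis_diff)
          also have "\<dots> = \<bar>t\<bar> * \<bar>Z n \<omega> - hn n \<omega>\<bar>" by (simp add: abs_mult right_diff_distrib[symmetric])
          also have "\<dots> \<le> \<bar>t\<bar> * \<eta>" using E(3)[OF that False] by (intro mult_left_mono) auto
          finally show ?thesis using False by simp
        qed
        have iE: "integrable M (indicat_real E)" using E(1) by (intro integrable_real_indicator) (auto simp: emeasure_eq_measure)
        have "cmod ((\<integral>\<omega>. cis (t * Z n \<omega>) \<partial>M) - (\<integral>\<omega>. cis (t * hn n \<omega>) \<partial>M)) = cmod (\<integral>\<omega>. cis (t * Z n \<omega>) - cis (t * hn n \<omega>) \<partial>M)"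
          using iZ ih by simp
        also have "\<dots> \<le> expectation ?d" by (rule integral_norm_bound)
        also have "\<dots> \<le> expectation (\<lambda>\<omega>. \<bar>t\<bar> * \<eta> + 2 * indicator E \<omega>)"
        proof (rule integral_mono)
          show "integrable M ?d" using iZ ih by simp
          show "integrable M (\<lambda>\<omega>. \<bar>t\<bar> * \<eta> + 2 * indicator E \<omega>)" using iE by simp
        qed (rule pw)
        also have "\<dots> = \<bar>t\<bar> * \<eta> + 2 * prob E" using iE E(1) by (simp add: prob_space)
        also have "\<dots> < (\<bar>t\<bar> + 3) * \<eta>" using E(2) \<eta> by (simp add: distrib_right)
        also have "\<dots> = e" by (simp add: \<eta>_def)
        finally show ?case by (simp add: dist_norm)
      qed
    qed
    have "(\<lambda>n. \<integral>\<omega>. cis (t * Z n \<omega>) \<partial>M) \<longlonglongrightarrow> (\<integral>\<omega>. cis (t * g \<omega>) \<partial>gaussian_space)"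
      using tendsto_add[OF diff lim] by simp
    then show "(\<lambda>n. char (distr M borel (Z n)) t) \<longlonglongrightarrow> char zlimit t"
      unfolding char_def zlimit_def using Z_measurable gm by (simp add: integral_distr cis_conv_exp)
  qed (rule dist)
  moreover have "(\<lambda>n. prob {\<omega> \<in> space M. \<bar>real (card (active_set (\<beta>hat n \<omega>))) - (\<integral>z. z \<partial>zlimit)\<bar> > \<epsilon>}) \<longlonglongrightarrow> 0"
    if "0 < \<epsilon>" for \<epsilon>
  proof (rule tendstoI)
    fix e :: real assume e: "0 < e"
    let ?bad = "\<lambda>n. {\<omega> \<in> space M. \<bar>real (card (active_set (\<beta>hat n \<omega>))) - (\<integral>z. z \<partial>zlimit)\<bar> > \<epsilon>}"
    from e have "0 < e / 2" by simp
    from approx[OF this]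
    show "\<forall>\<^sub>F n in sequentially. dist (prob (?bad n)) 0 < e"
    proof eventually_elim
      case (elim n)
      then obtain E where E: "E \<in> sets M" "prob E \<le> e / 2" "\<And>\<omega>. \<omega> \<in> space M \<Longrightarrow> \<omega> \<notin> E \<Longrightarrow> active_set (\<beta>hat n \<omega>) = ?A"
        by blast
      \<comment> \<open>Off \<open>E\<close> the active set is the true one, so the count equals the
        mean of the limit exactly; this settles every positive tolerance at once.\<close>
      have "?bad n \<subseteq> E"
        using E(3) that unfolding mean_z by fastforce
      then have "prob (?bad n) \<le> prob E"
        by (rule finite_measure_mono[OF _ E(1)])
      then show ?case using E(2) e by simp
    qed
  qed
  ultimately show ?thesis using dist int by blast
qed

end

theorem mainTheorem9:
  fixes \<nu> :: "(real^'r) measure" and b :: "real^'r \<Rightarrow> real"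
    and M :: "'w measure" and Y Y' :: "nat \<Rightarrow> 'w \<Rightarrow> real^'r"
    and \<X> :: "(real^'p^'r) set" and X :: "nat \<Rightarrow> real^'p^'r"
    and B :: "(real^'p) set" and \<beta>\<^sub>0 :: "real^'p"
    and \<beta>hat :: "nat \<Rightarrow> 'w \<Rightarrow> real^'p"
    and \<gamma> \<gamma>\<^sub>0 lam :: real and lamn :: "nat \<Rightarrow> real"
    and Z :: "nat \<Rightarrow> 'w \<Rightarrow> real"
  assumes "sets \<nu> = sets borel" and "sigma_finite_measure \<nu>" and "b \<in> borel_measurable borel"
    and "\<And>\<theta>. \<theta> \<in> interior (natural_parameter_space \<nu> b) \<Longrightarrow>
          positive_definite (hessian (cumulant \<nu> b) \<theta>)"
    and "open B" and "convex B" and "\<beta>\<^sub>0 \<in> B"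
    and "\<And>i. X i \<in> \<X>"
    and "condition_C1 \<nu> b \<X> B" and "condition_C2 \<nu> b \<X> B X"
    and "prob_space M"
    and "prob_space.indep_vars M (\<lambda>_. borel) Y UNIV"
    and "\<And>i. distributed M \<nu> (Y i) (\<lambda>y. ennreal (expfam_density \<nu> b (X i *v \<beta>\<^sub>0) y))"
    and "\<And>i. Y' i \<in> borel_measurable M"
    and "\<And>n. distr M (Pi\<^sub>M {..<n} (\<lambda>_. borel)) (\<lambda>\<omega>. \<lambda>i\<in>{..<n}. Y' i \<omega>) =
             distr M (Pi\<^sub>M {..<n} (\<lambda>_. borel)) (\<lambda>\<omega>. \<lambda>i\<in>{..<n}. Y i \<omega>)"
    and "\<And>n. prob_space.indep_var M
             (Pi\<^sub>M {..<n} (\<lambda>_. borel)) (\<lambda>\<omega>. \<lambda>i\<in>{..<n}. Y i \<omega>)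
             (Pi\<^sub>M {..<n} (\<lambda>_. borel)) (\<lambda>\<omega>. \<lambda>i\<in>{..<n}. Y' i \<omega>)"
    and "0 < \<gamma>" and "\<gamma> < 1" and "\<gamma> < \<gamma>\<^sub>0" and "\<gamma>\<^sub>0 \<le> 1" and "0 < lam"
    and lamn_def: "\<And>n. lamn n = real n powr ((\<gamma>\<^sub>0 - 2) / 2) * lam"
    and "\<And>n. \<beta>hat n \<in> borel_measurable M"
    and "\<And>n. AE \<omega> in M. \<beta>hat n \<omega> \<in> B \<and>
          ((\<exists>\<beta>. is_arg_min (bridge_objective \<nu> b X (\<lambda>i. Y i \<omega>) \<gamma> (lamn n) n) (\<lambda>\<beta>. \<beta> \<in> B) \<beta>) \<longrightarrow>
           is_arg_min (bridge_objective \<nu> b X (\<lambda>i. Y i \<omega>) \<gamma> (lamn n) n) (\<lambda>\<beta>. \<beta> \<in> B) (\<beta>hat n \<omega>))"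
    and Z_def: "\<And>n \<omega>. Z n \<omega> =
          (\<Sum>i<n. log_lik \<nu> b (X i) (Y i \<omega>) (\<beta>hat n \<omega>) - log_lik \<nu> b (X i) (Y i \<omega>) \<beta>\<^sub>0) -
          (\<Sum>i<n. log_lik \<nu> b (X i) (Y' i \<omega>) (\<beta>hat n \<omega>) - log_lik \<nu> b (X i) (Y' i \<omega>) \<beta>\<^sub>0)"
  shows "\<exists>zlimit. real_distribution zlimit \<and>
           weak_conv_m (\<lambda>n. distr M borel (Z n)) zlimit \<and>
           integrable zlimit (\<lambda>z. z) \<and>
           (\<forall>\<epsilon>>0. (\<lambda>n. measure M {\<omega> \<in> space M.
               \<bar>real (card (active_set (\<beta>hat n \<omega>))) - (\<integral>z. z \<partial>zlimit)\<bar> > \<epsilon>}) \<longlonglongrightarrow> 0)"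
proof -
  interpret E: exponential_family \<nu> b
    using assms(1,3) by (rule exponential_family.intro)
  interpret M: prob_space M by fact
  obtain \<mu> where \<mu>: "\<forall>\<beta>\<in>B.
        (\<lambda>n. (1 / real n) *\<^sub>R (\<Sum>i<n. information \<nu> b \<beta> (X i))) \<longlonglongrightarrow> (\<integral>x. information \<nu> b \<beta> x \<partial>\<mu>) \<and>
        positive_definite (\<integral>x. information \<nu> b \<beta> x \<partial>\<mu>)"
    using \<open>condition_C2 \<nu> b \<X> B X\<close> unfolding condition_C2_def by blast
  define J where "J = (\<integral>x. information \<nu> b \<beta>\<^sub>0 x \<partial>\<mu>)"
  have C1: "compact \<X>" "\<And>A \<beta>. A \<in> \<X> \<Longrightarrow> \<beta> \<in> B \<Longrightarrow> A *v \<beta> \<in> E.domain"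
    using \<open>condition_C1 \<nu> b \<X> B\<close> unfolding condition_C1_def by blast+
  \<comment> \<open>Positive definiteness speaks of nonzero vectors; what convexity of the cumulant
    function asks for is the weak inequality for all of them.\<close>
  have cov: "0 \<le> v \<bullet> (E.covariance \<theta> *v v)" if "\<theta> \<in> E.domain" for \<theta> v
    using assms(4)[OF that] unfolding positive_definite_def E.hessian_cumulant[OF that]
    by (cases "v = 0") (auto intro: less_imp_le)
  have lim: "(\<lambda>n. (1 / real n) *\<^sub>R (\<Sum>i<n. information \<nu> b \<beta>\<^sub>0 (X i))) \<longlonglongrightarrow> J" and pd: "positive_definite J"
    using \<mu> \<open>\<beta>\<^sub>0 \<in> B\<close> unfolding J_def by blast+
  interpret bridge_regression \<nu> b \<X> X B \<beta>\<^sub>0 J M Y Y' \<gamma> \<gamma>\<^sub>0 lam lamn \<beta>hat Z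
    by unfold_locales (fact assms C1 cov lim pd)+
  show ?thesis by (rule bridge_bias_limit)
qed

end
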